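(* Let $d\ge 1$, let $L_i<R_i$ be real numbers for $i=1,\dots,d$, and let $D=(L_1,R_1)\times\cdots\times(L_d,R_d)$ with closure $\bar D$. Let $\mathbf f=(f_1,\dots,f_d)$ and $\mathbf g=(g_1,\dots,g_d)$ belong to $C^1(\bar D;\mathbb R^d)$ and suppose that for every $i\in\{1,\dots,d\}$ and every $\mathbf y\in\bar D$ one has $f_i(\Pi_i^{L_i}(\mathbf y))\ge 0$ and $f_i(\Pi_i^{R_i}(\mathbf y))\le 0$. Set $G_i(\mathbf y)=g_i(\mathbf y)(y_i-L_i)(R_i-y_i)$, let $\mathbf X_0\in D$, and let $\mathbf X(t)=(X_1(t),\dots,X_d(t))$, $t\in[0,T]$, be the ($D$-valued) solution of $$dX_i(t)=f_i(\mathbf X(t))\,dt+G_i(\mathbf X(t))\,dW_i(t),\qquad \mathbf X(0)=\mathbf X_0,\qquad i=1,\dots,d.$$ For $N\in\mathbb N$ let $\Delta t=T/N$, $t_n=n\Delta t$, and let $\mathbf Y_n$, $n=0,1,\dots,N$, be the Euler domain preserving approximation with $\mathbf Y_0=\mathbf X_0$ defined in the context. Let $\mathbf E_n=\mathbf X(t_n)-\mathbf Y_n$. Then there exists a constant $K>0$, independent of $N$ (equivalently of $\Delta t$), such that for all $n\in\{1,\dots,N\}$ $$\mathbb E\big[\|\mathbf E_n\|^2\big]\le K\,\Delta t\,e^{KT}.$$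
   Context: For $s\in\mathbb R$, $\Pi_i^{s}$ replaces the $i$-th coordinate by $s$: $\Pi_i^{s}(y_1,\dots,y_d)=(y_1,\dots,y_{i-1},s,y_{i+1},\dots,y_d)$. $\|\cdot\|$ is the Euclidean norm on $\mathbb R^d$. $T\in(0,\infty)$; we work on a probability space $(\Omega,\mathcal F,\mathbb P)$ with normal filtration $(\mathcal F_t)_{t\in[0,T]}$, and $\mathbf W=(W_1,\dots,W_d)$ is a standard $d$-dimensional $(\mathcal F_t)$-Brownian motion (independent components). $\Delta W_{i,n}=W_i(t_{n+1})-W_i(t_n)$. For $\mathbf y\in D$ define $$F_i^L(\mathbf y)=\frac{f_i(\mathbf y)-f_i(\Pi_i^{L_i}(\mathbf y))}{y_i-L_i},\qquad F_i^R(\mathbf y)=\frac{f_i(\mathbf y)-f_i(\Pi_i^{R_i}(\mathbf y))}{y_i-R_i},$$ $$\alpha_i^L(\mathbf y)=F_i^L(\mathbf y)-\tfrac12\big(g_i(\mathbf y)(R_i-y_i)\big)^2,\qquad \beta_i^L(\mathbf y)=g_i(\mathbf y)(R_i-y_i),$$ $$\alpha_i^R(\mathbf y)=F_i^R(\mathbf y)-\tfrac12\big(g_i(\mathbf y)(y_i-L_i)\big)^2,\qquad \beta_i^R(\mathbf y)=-g_i(\mathbf y)(y_i-L_i).$$ The Euler domain preserving method: given $\mathbf Y_n=(Y_{1,n},\dots,Y_{d,n})\in D$, for each $i$ set $$Y_i^L(t_{n+1})=L_i+\exp\big(\alpha_i^L(\mathbf Y_n)\Delta t+\beta_i^L(\mathbf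 Y_n)\Delta W_{i,n}\big)\big(Y_{i,n}+f_i(\Pi_i^{L_i}(\mathbf Y_n))\Delta t-L_i\big),$$ $$Y_i^R(t_{n+1})=R_i-\exp\big(\alpha_i^R(\mathbf Y_n)\Delta t+\beta_i^R(\mathbf Y_n)\Delta W_{i,n}\big)\big(R_i-Y_{i,n}-f_i(\Pi_i^{R_i}(\mathbf Y_n))\Delta t\big),$$ $$Y_i^\theta(t_{n+1})=(1-\theta_{i,n+1})Y_i^L(t_{n+1})+\theta_{i,n+1}Y_i^R(t_{n+1}),$$ where $0<\theta_{i,n+1}<1$ is a parameter that may change with $i$ and $n$ (it is chosen at time $t_n$, i.e. it is $\mathcal F_{t_n}$-measurable, e.g. a constant or a function of $\mathbf Y_n$), and $$Y_{i,n+1}=Y_i^L(t_{n+1})\mathbf 1_{\{Y_i^R(t_{n+1})\le L_i\}}+Y_i^R(t_{n+1})\mathbf 1_{\{Y_i^L(t_{n+1})\ge R_i\}}+Y_i^\theta(t_{n+1})\mathbf 1_{\{Y_i^R(t_{n+1})>L_i,\ Y_i^L(t_{n+1})<R_i\}}.$$ The resulting sequence $\mathbf Y_n$ stays in $D$, so the recursion is well defined. *)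

theory Defs
  imports "HOL-Probability.Probability"
begin

definition coord_subst :: "'d::finite \<Rightarrow> real \<Rightarrow> real^'d \<Rightarrow> real^'d" where
  "coord_subst i s y = (\<chi> j. if j = i then s else y $ j)"

text \<open>On the closure of an open box the derivative within that set is unique. Continuous
  differentiability in this sense means that \<open>f\<close> and its partial derivatives extend
  continuously from the box to its closure.\<close>

definition C1_on :: "('a::real_normed_vector) set \<Rightarrow> ('a \<Rightarrow> 'b::real_normed_vector) \<Rightarrow> bool" where
  "C1_on S f \<longleftrightarrow> (\<exists>f' :: 'a \<Rightarrow> 'a \<Rightarrow>\<^sub>L 'b. continuous_on S f' \<and>
     (\<forall>x\<in>S. (f has_derivative blinfun_apply (f' x)) (at x within S)))"

definition diffusion_coeff ::
  "(real^'d \<Rightarrow> real^'d) \<Rightarrow> real^'d \<Rightarrow> real^'d \<Rightarrow> 'd::finite \<Rightarrow> real^'d \<Rightarrow> real" where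
  "diffusion_coeff g L R i y = g y $ i * (y $ i - L $ i) * (R $ i - y $ i)"

definition normal_filtration :: "'a measure \<Rightarrow> real \<Rightarrow> (real \<Rightarrow> 'a measure) \<Rightarrow> bool" where
  "normal_filtration M T F \<longleftrightarrow>
     (\<forall>t\<in>{0..T}. subalgebra M (F t)) \<and>
     (\<forall>s t. 0 \<le> s \<longrightarrow> s \<le> t \<longrightarrow> t \<le> T \<longrightarrow> sets (F s) \<subseteq> sets (F t)) \<and>
     null_sets M \<subseteq> sets (F 0) \<and>
     (\<forall>t\<in>{0..<T}. sets (F t) = (\<Inter>s\<in>{t<..T}. sets (F s)))"

definition brownian_motion ::
  "'a measure \<Rightarrow> real \<Rightarrow> (real \<Rightarrow> 'a measure) \<Rightarrow> (real \<Rightarrow> 'a \<Rightarrow> real^'d::finite) \<Rightarrow> bool" where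
  "brownian_motion M T F W \<longleftrightarrow>
     (\<forall>t\<in>{0..T}. W t \<in> borel_measurable (F t)) \<and>
     (AE \<omega> in M. W 0 \<omega> = 0) \<and>
     (AE \<omega> in M. continuous_on {0..T} (\<lambda>t. W t \<omega>)) \<and>
     (\<forall>s t. 0 \<le> s \<longrightarrow> s < t \<longrightarrow> t \<le> T \<longrightarrow>
        prob_space.indep_set M (sets (F s))
          {(\<lambda>\<omega>. W t \<omega> - W s \<omega>) -` A \<inter> space M | A. A \<in> sets borel} \<and>
        prob_space.indep_vars M (\<lambda>_. borel) (\<lambda>i \<omega>. W t \<omega> $ i - W s \<omega> $ i) UNIV \<and>
        (\<forall>i. distributed M lborel (\<lambda>\<omega>. W t \<omega> $ i - W s \<omega> $ i)
               (\<lambda>x. ennreal (normal_density 0 (sqrt (t - s)) x))))"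

text \<open>An elementary process on \<open>[0,t]\<close> is
  \<open>\<Sum>j<k. \<xi> j * indicator {\<tau> j<..\<tau> (Suc j)}\<close> for time points \<open>\<tau> 0 \<le> \<dots> \<le> \<tau> k\<close> in \<open>[0,t]\<close>
  and bounded random variables \<open>\<xi> j\<close> measurable with respect to \<open>F (\<tau> j)\<close>.\<close>

definition elementary_data ::
  "'a measure \<Rightarrow> (real \<Rightarrow> 'a measure) \<Rightarrow> real \<Rightarrow> nat \<Rightarrow> (nat \<Rightarrow> real) \<Rightarrow> (nat \<Rightarrow> 'a \<Rightarrow> real) \<Rightarrow> bool"
where
  "elementary_data M F t k \<tau> \<xi> \<longleftrightarrow>
     0 \<le> \<tau> 0 \<and> \<tau> k \<le> t \<and> (\<forall>j<k. \<tau> j \<le> \<tau> (Suc j)) \<and>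
     (\<forall>j<k. \<xi> j \<in> borel_measurable (F (\<tau> j))) \<and>
     (\<exists>C. \<forall>j<k. \<forall>\<omega>\<in>space M. \<bar>\<xi> j \<omega>\<bar> \<le> C)"

definition elementary_process ::
  "nat \<Rightarrow> (nat \<Rightarrow> real) \<Rightarrow> (nat \<Rightarrow> 'a \<Rightarrow> real) \<Rightarrow> real \<Rightarrow> 'a \<Rightarrow> real" where
  "elementary_process k \<tau> \<xi> u \<omega> = (\<Sum>j<k. \<xi> j \<omega> * indicator {\<tau> j<..\<tau> (Suc j)} u)"

definition elementary_integral ::
  "(real \<Rightarrow> 'a \<Rightarrow> real) \<Rightarrow> nat \<Rightarrow> (nat \<Rightarrow> real) \<Rightarrow> (nat \<Rightarrow> 'a \<Rightarrow> real) \<Rightarrow> 'a \<Rightarrow> real" where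
  "elementary_integral B k \<tau> \<xi> \<omega> = (\<Sum>j<k. \<xi> j \<omega> * (B (\<tau> (Suc j)) \<omega> - B (\<tau> j) \<omega>))"

text \<open>\<open>has_ito_integral M F B H t I\<close> says that the integrand \<open>H\<close> is jointly measurable, adapted
  and square integrable on \<open>[0,t]\<close>, and that \<open>I\<close> is (a version of) \<open>\<integral>\<^sub>0\<^sup>t H dB\<close>, the
  \<open>L\<^sup>2\<close>-limit of the integrals of elementary processes converging to \<open>H\<close>. For a Brownian
  motion \<open>B\<close> the Ito isometry makes \<open>I\<close> unique up to null sets. The measurability conditions
  matter because \<open>nn_integral\<close> is only a lower integral on nonmeasurable functions.\<close>

definition has_ito_integral ::
  "'a measure \<Rightarrow> (real \<Rightarrow> 'a measure) \<Rightarrow> (real \<Rightarrow> 'a \<Rightarrow> real) \<Rightarrow> (real \<Rightarrow> 'a \<Rightarrow> real) \<Rightarrow> real \<Rightarrow>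
   ('a \<Rightarrow> real) \<Rightarrow> bool" where
  "has_ito_integral M F B H t I \<longleftrightarrow>
     (\<lambda>(u, \<omega>). H u \<omega>) \<in> borel_measurable (restrict_space borel {0..t} \<Otimes>\<^sub>M M) \<and>
     (\<forall>u\<in>{0..t}. H u \<in> borel_measurable (F u)) \<and>
     (\<integral>\<^sup>+\<omega>. (\<integral>\<^sup>+u\<in>{0..t}. ennreal ((H u \<omega>)\<^sup>2) \<partial>lborel) \<partial>M) < \<infinity> \<and>
     I \<in> borel_measurable M \<and>
     (\<exists>k \<tau> \<xi>.
        (\<forall>m. elementary_data M F t (k m) (\<tau> m) (\<xi> m)) \<and>
        (\<lambda>m::nat. \<integral>\<^sup>+\<omega>. (\<integral>\<^sup>+u\<in>{0..t}.
            ennreal ((elementary_process (k m) (\<tau> m) (\<xi> m) u \<omega> - H u \<omega>)\<^sup>2) \<partial>lborel) \<partial>M)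
          \<longlonglongrightarrow> 0 \<and>
        (\<lambda>m. \<integral>\<^sup>+\<omega>. ennreal ((elementary_integral B (k m) (\<tau> m) (\<xi> m) \<omega> - I \<omega>)\<^sup>2) \<partial>M)
          \<longlonglongrightarrow> 0)"

text \<open>The integrand \<open>G\<^sub>i(X)\<close> is bounded because \<open>X\<close> takes values in the bounded box, so the
  square-integrable theory of the Ito integral suffices.\<close>

definition sde_solution ::
  "'a measure \<Rightarrow> real \<Rightarrow> (real \<Rightarrow> 'a measure) \<Rightarrow> (real \<Rightarrow> 'a \<Rightarrow> real^'d::finite) \<Rightarrow>
   (real^'d \<Rightarrow> real^'d) \<Rightarrow> (real^'d \<Rightarrow> real^'d) \<Rightarrow> real^'d \<Rightarrow> real^'d \<Rightarrow> real^'d \<Rightarrow>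
   (real \<Rightarrow> 'a \<Rightarrow> real^'d) \<Rightarrow> bool" where
  "sde_solution M T F W f g L R x0 X \<longleftrightarrow>
     (\<forall>t\<in>{0..T}. X t \<in> borel_measurable (F t)) \<and>
     (AE \<omega> in M. continuous_on {0..T} (\<lambda>t. X t \<omega>)) \<and>
     (AE \<omega> in M. \<forall>t\<in>{0..T}. X t \<omega> \<in> box L R) \<and>
     (\<forall>t\<in>{0..T}. \<forall>i. \<exists>I.
        has_ito_integral M F (\<lambda>u \<omega>. W u \<omega> $ i) (\<lambda>u \<omega>. diffusion_coeff g L R i (X u \<omega>)) t I \<and>
        (AE \<omega> in M. X t \<omega> $ i = x0 $ i + (LBINT s:{0..t}. f (X s \<omega>) $ i) + I \<omega>))"

definition F_left :: "(real^'d \<Rightarrow> real^'d) \<Rightarrow> real^'d \<Rightarrow> 'd::finite \<Rightarrow> real^'d \<Rightarrow> real" where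
  "F_left f L i y = (f y $ i - f (coord_subst i (L $ i) y) $ i) / (y $ i - L $ i)"

definition F_right :: "(real^'d \<Rightarrow> real^'d) \<Rightarrow> real^'d \<Rightarrow> 'd::finite \<Rightarrow> real^'d \<Rightarrow> real" where
  "F_right f R i y = (f y $ i - f (coord_subst i (R $ i) y) $ i) / (y $ i - R $ i)"

definition alpha_left ::
  "(real^'d \<Rightarrow> real^'d) \<Rightarrow> (real^'d \<Rightarrow> real^'d) \<Rightarrow> real^'d \<Rightarrow> real^'d \<Rightarrow> 'd::finite \<Rightarrow> real^'d \<Rightarrow> real"
where
  "alpha_left f g L R i y = F_left f L i y - 1 / 2 * (g y $ i * (R $ i - y $ i))\<^sup>2"

definition alpha_right ::
  "(real^'d \<Rightarrow> real^'d) \<Rightarrow> (real^'d \<Rightarrow> real^'d) \<Rightarrow> real^'d \<Rightarrow> real^'d \<Rightarrow> 'd::finite \<Rightarrow> real^'d \<Rightarrow> real"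
where
  "alpha_right f g L R i y = F_right f R i y - 1 / 2 * (g y $ i * (y $ i - L $ i))\<^sup>2"

definition beta_left :: "(real^'d \<Rightarrow> real^'d) \<Rightarrow> real^'d \<Rightarrow> 'd::finite \<Rightarrow> real^'d \<Rightarrow> real" where
  "beta_left g R i y = g y $ i * (R $ i - y $ i)"

definition beta_right :: "(real^'d \<Rightarrow> real^'d) \<Rightarrow> real^'d \<Rightarrow> 'd::finite \<Rightarrow> real^'d \<Rightarrow> real" where
  "beta_right g L i y = - g y $ i * (y $ i - L $ i)"

text \<open>Below, \<open>h\<close> is the step size, \<open>y\<close> the current state, \<open>w\<close> the Brownian increment
  and \<open>\<theta>\<close> the vector of weights.\<close>

definition step_left ::
  "(real^'d \<Rightarrow> real^'d) \<Rightarrow> (real^'d \<Rightarrow> real^'d) \<Rightarrow> real^'d \<Rightarrow> real^'d \<Rightarrow> real \<Rightarrow>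
   real^'d \<Rightarrow> real^'d \<Rightarrow> 'd::finite \<Rightarrow> real" where
  "step_left f g L R h y w i =
     L $ i + exp (alpha_left f g L R i y * h + beta_left g R i y * w $ i)
               * (y $ i + f (coord_subst i (L $ i) y) $ i * h - L $ i)"

definition step_right ::
  "(real^'d \<Rightarrow> real^'d) \<Rightarrow> (real^'d \<Rightarrow> real^'d) \<Rightarrow> real^'d \<Rightarrow> real^'d \<Rightarrow> real \<Rightarrow>
   real^'d \<Rightarrow> real^'d \<Rightarrow> 'd::finite \<Rightarrow> real" where
  "step_right f g L R h y w i =
     R $ i - exp (alpha_right f g L R i y * h + beta_right g L i y * w $ i)
               * (R $ i - y $ i - f (coord_subst i (R $ i) y) $ i * h)"

definition edp_step ::
  "(real^'d \<Rightarrow> real^'d) \<Rightarrow> (real^'d \<Rightarrow> real^'d) \<Rightarrow> real^'d \<Rightarrow> real^'d \<Rightarrow> real \<Rightarrow>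
   real^'d \<Rightarrow> real^'d \<Rightarrow> real^'d \<Rightarrow> real^'d::finite" where
  "edp_step f g L R h y w \<theta> = (\<chi> i.
     let yl = step_left f g L R h y w i;
         yr = step_right f g L R h y w i;
         y\<theta> = (1 - \<theta> $ i) * yl + \<theta> $ i * yr
     in yl * of_bool (yr \<le> L $ i) + yr * of_bool (R $ i \<le> yl)
        + y\<theta> * of_bool (L $ i < yr \<and> yl < R $ i))"

text \<open>\<open>\<theta> n\<close> is the weight used in the step from \<open>t\<^sub>n\<close> to \<open>t\<^sub>n\<^sub>+\<^sub>1\<close>; it is chosen at time
  \<open>t\<^sub>n\<close>.\<close>

primrec edp ::
  "(real^'d \<Rightarrow> real^'d) \<Rightarrow> (real^'d \<Rightarrow> real^'d) \<Rightarrow> real^'d \<Rightarrow> real^'d \<Rightarrow> real^'d \<Rightarrow>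
   (real \<Rightarrow> 'a \<Rightarrow> real^'d) \<Rightarrow> real \<Rightarrow> (nat \<Rightarrow> 'a \<Rightarrow> real^'d) \<Rightarrow> nat \<Rightarrow> 'a \<Rightarrow> real^'d::finite"
where
  "edp f g L R x0 W h \<theta> 0 \<omega> = x0"
| "edp f g L R x0 W h \<theta> (Suc n) \<omega> =
     edp_step f g L R h (edp f g L R x0 W h \<theta> n \<omega>)
       (W (real (Suc n) * h) \<omega> - W (real n * h) \<omega>) (\<theta> n \<omega>)"

end

theory Submission
  imports Defs
begin

text \<open>
  Both exponential candidates expand as \<open>y + f h + G w + m (w\<^sup>2 - h)\<close> with an error of order
  \<open>h\<^sup>2 + h |w| + |w|\<^sup>3\<close> and a coefficient \<open>m\<close> known before the step, and a candidate can
  leave the box only if the increment \<open>w\<close> is bounded away from \<open>0\<close>; hence the expansion holds for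
  all \<open>w\<close>, whatever the weights. The terms \<open>w\<close> and \<open>w\<^sup>2 - h\<close> are orthogonal to the past, so
  comparing with the integrated equation on one step gives
  \<open>E |e\<^sub>n\<^sub>+\<^sub>1|\<^sup>2 \<le> (1 + K h) E |e\<^sub>n|\<^sup>2 + K h\<^sup>2\<close>, and the discrete Gronwall inequality
  finishes the proof. The Ito integral enters only through an isometry bound for its increments
  and through their orthogonality to the past.
\<close>

subsection \<open>The exponential factors\<close>

text \<open>The update map is not smooth in \<open>w\<close>: which candidate is kept depends on the
  increment itself, and the rate in the exponential contains a quotient by the distance to a face.
  Multiplying by that distance removes the quotient, so the estimates are uniform up to the
  boundary.

  Of \<open>m\<close> only boundedness and measurability at the start of the step matter; it need
  not be a Milstein coefficient, because \<open>w\<^sup>2 - h\<close> has variance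
  \<open>2 * h\<^sup>2\<close> and is uncorrelated with the current error. The remainder may have a
  nonzero mean, so orthogonality does not dispose of it; its second moment is of order
  \<open>h ^ 3\<close>, and the division by \<open>h\<close> in Young's inequality leaves the
  admissible order \<open>h\<^sup>2\<close>. Since \<open>h\<close> is not assumed to be small,
  steps too coarse for the expansion are treated apart: for them the squared diameter of the box is
  itself at most a multiple of \<open>h\<close>, with a constant that depends only on the
  data.\<close>

lemma square_add2_le: "(x + y)\<^sup>2 \<le> 2 * x\<^sup>2 + 2 * (y::real)\<^sup>2"
  using sum_squares_bound[of x y] by (simp add: power2_sum)

lemma square_add3_le: "(x + y + z)\<^sup>2 \<le> 3 * x\<^sup>2 + 3 * y\<^sup>2 + 3 * (z::real)\<^sup>2"
proof -
  have "0 \<le> (x - y)\<^sup>2 + (x - z)\<^sup>2 + (y - z)\<^sup>2" by simp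
  then show ?thesis by (simp add: power2_eq_square algebra_simps)
qed

text \<open>\<open>b\<close> and \<open>a\<close> are the distances from the state to the face that the candidate cannot cross
  and to the opposite one, \<open>p\<close> and \<open>v\<close> the drift on the former face and at the state. Reflecting the
  box reduces the right candidate to the left one, with \<open>v\<close> and \<open>g\<close> negated.\<close>

definition expfac :: "real \<Rightarrow> real \<Rightarrow> real \<Rightarrow> real \<Rightarrow> real \<Rightarrow> real \<Rightarrow> real \<Rightarrow> real" where
  "expfac b a p v g h w = exp (((v - p) / b - 1 / 2 * (g * a)\<^sup>2) * h + g * a * w) * (b + p * h)"

lemma expfac_pos: "0 < b \<Longrightarrow> 0 \<le> p \<Longrightarrow> 0 \<le> h \<Longrightarrow> 0 < expfac b a p v g h w"
  unfolding expfac_def by (simp add: add_pos_nonneg)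

text \<open>Writing \<open>b + p * h = b * (1 + p * h / b)\<close> and using
  \<open>ln (1 + x) \<le> x\<close> makes the face drift \<open>p\<close> cancel against the
  \<open>- p\<close> in the exponent, so that only the drift \<open>v\<close> at the state survives.
  The quadratic correction has a favourable sign and is dropped. The factor \<open>b\<close> leaves
  no quotient that degenerates at the face.\<close>

lemma ln_expfac_le:
  assumes "0 < b" "0 \<le> p" "0 \<le> h"
  shows "b * ln (expfac b a p v g h w) \<le> v * h + g * a * b * w + b * ln b"
proof -
  have "b + p * h = b * (1 + p * h / b)" using assms by (simp add: field_simps)
  moreover have "0 < 1 + p * h / b" using assms by (simp add: add_pos_nonneg)
  ultimately have "ln (b + p * h) = ln b + ln (1 + p * h / b)"
    using assms by (simp add: ln_mult)
  also have "ln (1 + p * h / b) \<le> p * h / b"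
    using assms by (intro ln_add_one_self_le_self) auto
  finally have l: "b * ln (b + p * h) \<le> b * ln b + p * h"
    using assms by (simp add: field_simps)
  have "0 < b + p * h" using assms by (simp add: add_pos_nonneg)
  then have "ln (expfac b a p v g h w)
      = ((v - p) / b - 1 / 2 * (g * a)\<^sup>2) * h + g * a * w + ln (b + p * h)"
    unfolding expfac_def by (simp add: ln_mult)
  then have "b * ln (expfac b a p v g h w)
      = (v - p) * h - b * (1 / 2 * (g * a)\<^sup>2 * h) + g * a * b * w + b * ln (b + p * h)"
    using assms by (simp add: field_simps)
  moreover have "0 \<le> b * (1 / 2 * (g * a)\<^sup>2 * h)" using assms by simp
  ultimately show ?thesis using l by (simp add: algebra_simps)
qed

text \<open>The increment \<open>w\<close> cancels when the two logarithms are weighted with \<open>b\<close> and \<open>a\<close>.\<close>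

lemma expfac_not_both:
  assumes "0 < a" "0 < b" "0 \<le> p" "0 \<le> q" "0 \<le> h"
  shows "expfac b a p v g h w < a + b \<or> expfac a b q (- v) (- g) h w < a + b"
proof (rule ccontr)
  assume "\<not> ?thesis"
  then have 1: "a + b \<le> expfac b a p v g h w" and 2: "a + b \<le> expfac a b q (- v) (- g) h w"
    by auto
  have "b * ln (a + b) \<le> b * ln (expfac b a p v g h w)"
    using 1 assms by (intro mult_left_mono) auto
  then have "b * ln (a + b) \<le> v * h + g * a * b * w + b * ln b"
    using ln_expfac_le[of b p h a v g w] assms by linarith
  moreover have "a * ln (a + b) \<le> a * ln (expfac a b q (- v) (- g) h w)"
    using 2 assms by (intro mult_left_mono) auto
  then have "a * ln (a + b) \<le> - v * h - g * b * a * w + a * ln a"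
    using ln_expfac_le[of a q h b "- v" "- g" w] assms by linarith
  ultimately have "b * ln (a + b) + a * ln (a + b) \<le> b * ln b + a * ln a"
    by (simp add: algebra_simps)
  moreover have "b * ln b < b * ln (a + b)" "a * ln a < a * ln (a + b)"
    using assms by auto
  ultimately show False by linarith
qed

text \<open>The bound has to hold arbitrarily close to either face. If \<open>b \<le> a\<close>, the
  prefactor \<open>b + p * h\<close> is at most two thirds of \<open>a + b\<close>, and an
  exponential below \<open>3 / 2\<close> is enough. If \<open>a < b\<close>, the room
  \<open>a\<close> that is left may be tiny and such an estimate is too coarse; there the
  logarithmic bound is used, and \<open>v \<le> K * a\<close> makes the drift towards the opposite
  face as small as the room itself.\<close>

lemma expfac_less_total:
  assumes "0 < a" "0 < b" "0 \<le> p" "p \<le> C" "\<bar>v - p\<bar> \<le> K * b" "v \<le> K * a" "\<bar>g\<bar> \<le> B"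
    and "0 \<le> h" "C * h \<le> (a + b) / 6" "K * h \<le> 1 / 6" "\<bar>w\<bar> * (B * (a + b)) < 1 / 6"
  shows "expfac b a p v g h w < a + b"
proof (rule ccontr)
  assume neg: "\<not> ?thesis"
  have gw: "g * w \<le> B * \<bar>w\<bar>"
  proof -
    have "g * w \<le> \<bar>g\<bar> * \<bar>w\<bar>" by (metis abs_ge_self abs_mult)
    also have "\<dots> \<le> B * \<bar>w\<bar>" using assms(7) by (rule mult_right_mono) simp
    finally show ?thesis .
  qed
  have B0: "0 \<le> B * \<bar>w\<bar>"
    using mult_right_mono[OF assms(7), of "\<bar>w\<bar>"] mult_nonneg_nonneg[of "\<bar>g\<bar>" "\<bar>w\<bar>"] by linarith
  have gaw: "g * a * w \<le> a * (B * \<bar>w\<bar>)"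
    using mult_left_mono[OF gw, of a] assms(1) by (simp add: mult_ac)
  have ph: "p * h \<le> (a + b) / 6" using assms(4,8,9) mult_right_mono[of p C h] by linarith
  show False
  proof (cases "b \<le> a")
    case True
    let ?x = "((v - p) / b - 1 / 2 * (g * a)\<^sup>2) * h + g * a * w"
    have "(v - p) / b \<le> K" using assms(2,5) by (simp add: field_simps abs_le_iff)
    then have "(v - p) / b * h \<le> K * h" using assms by (intro mult_right_mono) auto
    moreover have "a * (B * \<bar>w\<bar>) \<le> (a + b) * (B * \<bar>w\<bar>)" using B0 assms(1,2) by (intro mult_right_mono) auto
    moreover have "0 \<le> (g * a)\<^sup>2 * h" using assms by simp
    moreover have "?x = (v - p) / b * h - 1 / 2 * ((g * a)\<^sup>2 * h) + g * a * w"
      by (simp add: left_diff_distrib)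
    moreover have "(a + b) * (B * \<bar>w\<bar>) < 1 / 6" using assms(11) by (simp only: mult_ac)
    ultimately have "?x \<le> 1 / 3" using assms(10) gaw by linarith
    then have "exp ?x \<le> exp (1/3)" by simp
    also have "exp (1/3::real) \<le> 1 + 1/3 + (1/3)^2" by (rule exp_bound) auto
    also have "\<dots> < 3 / 2" by (simp add: power2_eq_square)
    finally have e: "exp ?x < 3 / 2" .
    have "expfac b a p v g h w < 3 / 2 * (b + p * h)"
      unfolding expfac_def using e assms by (intro mult_strict_right_mono) (auto simp: add_pos_nonneg)
    also have "\<dots> \<le> a + b" using ph True by (simp add: distrib_left)
    finally show False using neg by simp
  next
    case False
    have "b * ln (a + b) \<le> b * ln (expfac b a p v g h w)"
      using neg assms by (intro mult_left_mono) auto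
    then have "b * ln (a + b) - b * ln b \<le> v * h + g * a * b * w"
      using ln_expfac_le[of b p h a v g w] assms by linarith
    \<comment> \<open>From \<open>ln x \<le> x - 1\<close> at \<open>x = b / (a + b)\<close>. Times
      \<open>b\<close>, this required gain exceeds \<open>a / 2\<close> because
      \<open>a < b\<close>, whereas drift and noise supply at most \<open>a / 6\<close>
      each.\<close>
    moreover have "a / (a + b) \<le> ln (a + b) - ln b"
    proof -
      have "ln (b / (a + b)) \<le> b / (a + b) - 1" using assms by (intro ln_le_minus_one) auto
      then show ?thesis using assms(1,2) by (simp add: ln_div field_simps)
    qed
    then have "b * (a / (a + b)) \<le> b * (ln (a + b) - ln b)" using assms by (intro mult_left_mono) auto
    moreover have "v * h \<le> K * a * h" using assms by (intro mult_right_mono) auto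
    moreover have "K * a * h \<le> a / 6" using mult_left_mono[OF assms(10), of a] assms(1) by (simp add: mult_ac)
    moreover have "g * a * b * w \<le> b * (a * (B * \<bar>w\<bar>))"
      using mult_left_mono[OF gaw, of b] assms(2) by (simp add: mult_ac)
    moreover have "b * (a * (B * \<bar>w\<bar>)) \<le> a / 6"
    proof -
      have "a * (b * (B * \<bar>w\<bar>)) \<le> a * ((a + b) * (B * \<bar>w\<bar>))"
        using assms(1,2) B0 by (intro mult_left_mono mult_right_mono) auto
      also have "\<dots> \<le> a * (1 / 6)" using assms(1,11) by (intro mult_left_mono) (auto simp: mult_ac)
      finally show ?thesis by (simp add: mult_ac)
    qed
    ultimately have "b * (a / (a + b)) \<le> a / 3" by (simp add: algebra_simps)
    moreover have "a / 2 < b * (a / (a + b))" using False assms(1,2) by (simp add: field_simps)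
    ultimately show False using assms by simp
  qed
qed

lemma exp_Taylor2_bound:
  assumes "\<bar>x::real\<bar> \<le> 1"
  shows "\<bar>exp x - (1 + x + x\<^sup>2 / 2)\<bar> \<le> \<bar>x\<bar>^3"
proof -
  obtain t where t: "\<bar>t\<bar> \<le> \<bar>x\<bar>" "exp x = (\<Sum>m<3. (x ^ m) / fact m) + (exp t / fact 3) * x ^ 3"
    using Maclaurin_exp_le[of x 3] by blast
  have "exp x - (1 + x + x\<^sup>2 / 2) = exp t / 6 * x^3"
    using t(2) by (simp add: eval_nat_numeral)
  moreover have "exp t \<le> exp 1" using t assms by auto
  then have "exp t / 6 \<le> 1" using exp_le by linarith
  then have "exp t / 6 * \<bar>x\<bar>^3 \<le> 1 * \<bar>x\<bar>^3" by (intro mult_right_mono) auto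
  moreover have "\<bar>exp t / 6 * x^3\<bar> = exp t / 6 * \<bar>x\<bar>^3" by (simp add: abs_mult power_abs)
  ultimately show ?thesis by linarith
qed

text \<open>Two cancellations produce this form: \<open>b * k\<close> contains \<open>v - p\<close>,
  whose \<open>- p * h\<close> cancels the \<open>p * h\<close> of the prefactor, and the correction
  \<open>- 1 / 2 * q\<^sup>2\<close> in \<open>k\<close> turns \<open>w\<^sup>2\<close> into
  \<open>w\<^sup>2 - h\<close>. In the constant, \<open>36 = 2 + 2 + 32\<close> collects the mixed
  term, the squared drift and the Taylor remainder, and \<open>6\<close> comes from
  \<open>p * h * (exp x - 1)\<close>. The power \<open>A ^ 12\<close> is the cube of the bound
  \<open>A ^ 4 * s\<close> for \<open>x\<close>; the remaining factor \<open>A\<close> bounds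
  \<open>b\<close> or \<open>p\<close>.\<close>

lemma expfac_expansion:
  assumes "0 < b" "0 \<le> a" "a \<le> A" "b \<le> A" "1 \<le> A" "0 \<le> p" "p \<le> A" "\<bar>v - p\<bar> \<le> A * b" "\<bar>g\<bar> \<le> A"
    and "0 \<le> h" "h \<le> 1" "A ^ 4 * (2 * h + \<bar>w\<bar>) \<le> 1"
  shows "\<bar>expfac b a p v g h w
      - (b + v * h + g * a * b * w + 1 / 2 * (g * a)\<^sup>2 * b * (w\<^sup>2 - h))\<bar>
    \<le> 42 * A ^ 13 * (h\<^sup>2 + h * \<bar>w\<bar> + \<bar>w\<bar> ^ 3)"
proof -
  define q where "q = g * a"
  define k where "k = (v - p) / b - 1 / 2 * q\<^sup>2"
  define x where "x = k * h + q * w"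
  define \<rho> where "\<rho> = exp x - (1 + x + x\<^sup>2 / 2)"
  define s where "s = 2 * h + \<bar>w\<bar>"
  have A0: "0 \<le> A" using assms by simp
  have s0: "0 \<le> s" using assms by (simp add: s_def)
  have q: "\<bar>q\<bar> \<le> A\<^sup>2" unfolding q_def abs_mult power2_eq_square
    using assms by (intro mult_mono) auto
  have q2: "q\<^sup>2 \<le> A ^ 4"
    using power_mono[OF q, of 2] by (simp flip: power_mult)
  have A2: "A \<le> A ^ 4" "A\<^sup>2 \<le> A ^ 4"
    using assms power_increasing[of 1 4 A] power_increasing[of 2 4 A] by auto
  have "\<bar>(v - p) / b\<bar> \<le> A" using assms by (simp add: abs_divide field_simps)
  then have k: "\<bar>k\<bar> \<le> 2 * A ^ 4" unfolding k_def using q2 A2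
    zero_le_power2[of q] unfolding abs_le_iff by linarith
  have "\<bar>x\<bar> \<le> \<bar>k\<bar> * h + \<bar>q\<bar> * \<bar>w\<bar>" unfolding x_def
    using assms abs_triangle_ineq[of "k * h" "q * w"] by (simp add: abs_mult)
  also have "\<dots> \<le> (2 * A^4) * h + A^4 * \<bar>w\<bar>" using k q A2 assms
    by (intro add_mono mult_right_mono) auto
  finally have x: "\<bar>x\<bar> \<le> A^4 * s" by (simp add: algebra_simps s_def)
  then have x1: "\<bar>x\<bar> \<le> 1" using assms by (simp add: s_def)
  have \<rho>: "\<bar>\<rho>\<bar> \<le> \<bar>x\<bar>^3" unfolding \<rho>_def by (rule exp_Taylor2_bound[OF x1])
  have ppos: "0 \<le> \<bar>x\<bar>^3" "0 \<le> x\<^sup>2" by auto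
  have x3: "\<bar>x\<bar>^3 \<le> A^12 * s^3" using power_mono[OF x, of 3] by (simp add: power_mult_distrib flip: power_mult)
  have bk: "b * k = v - p - 1 / 2 * q\<^sup>2 * b" using assms by (simp add: k_def field_simps)
  have ee: "exp x = 1 + x + x\<^sup>2 / 2 + \<rho>" by (simp add: \<rho>_def)
  have "expfac b a p v g h w = exp x * (b + p * h)"
    by (simp add: expfac_def x_def k_def q_def)
  also have "\<dots> = b + (b * k) * h + p * h + q * b * w + 1 / 2 * q\<^sup>2 * b * w\<^sup>2
      + (b * (k * q * h * w + 1 / 2 * k\<^sup>2 * h\<^sup>2 + \<rho>) + p * h * (exp x - 1))"
    unfolding ee by (simp add: x_def power2_eq_square algebra_simps add_divide_distrib)
  also have "\<dots> = b + v * h + g * a * b * w + 1 / 2 * (g * a)\<^sup>2 * b * (w\<^sup>2 - h)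
      + (b * (k * q * h * w + 1 / 2 * k\<^sup>2 * h\<^sup>2 + \<rho>) + p * h * (exp x - 1))"
    unfolding bk by (simp add: q_def field_simps)
  finally have eq: "expfac b a p v g h w - (b + v * h + g * a * b * w + 1 / 2 * (g * a)\<^sup>2 * b * (w\<^sup>2 - h))
      = b * (k * q * h * w + 1 / 2 * k\<^sup>2 * h\<^sup>2 + \<rho>) + p * h * (exp x - 1)" by simp
  define Q where "Q = h\<^sup>2 + h * \<bar>w\<bar> + \<bar>w\<bar>^3"
  have Q0: "0 \<le> Q" "h\<^sup>2 \<le> Q" "h * \<bar>w\<bar> \<le> Q" "h * s \<le> 2 * Q"
    using assms by (auto simp: Q_def s_def power2_eq_square algebra_simps)
  \<comment> \<open>Each monomial of the expanded cube is dominated by one of the three terms of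
    \<open>Q\<close>, because \<open>h \<le> 1\<close> and \<open>|w| \<le> 1\<close>; the latter
    follows from the smallness assumption and \<open>1 \<le> A\<close>.\<close>
  have s3: "s^3 \<le> 32 * Q"
  proof -
    have "s \<le> 2 * max (2 * h) \<bar>w\<bar>" by (simp add: s_def)
    then have "s^3 \<le> (2 * max (2 * h) \<bar>w\<bar>)^3" using s0 by (rule power_mono)
    also have "\<dots> = 8 * (max (2 * h) \<bar>w\<bar>)^3" by (simp add: power_mult_distrib)
    also have "(max (2 * h) \<bar>w\<bar>)^3 \<le> (2*h)^3 + \<bar>w\<bar>^3" using assms by (auto simp: max_def)
    also have "(2*h)^3 = 8 * (h * h\<^sup>2)" by (simp add: power_mult_distrib eval_nat_numeral)
    finally have "s^3 \<le> 64 * (h * h\<^sup>2) + 8 * \<bar>w\<bar>^3" by simp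
    have "s^3 = 8 * (h * h\<^sup>2) + 12 * (h\<^sup>2 * \<bar>w\<bar>) + 6 * (h * (\<bar>w\<bar> * \<bar>w\<bar>)) + \<bar>w\<bar>^3"
      by (simp add: s_def eval_nat_numeral algebra_simps)
    moreover have "h * h\<^sup>2 \<le> 1 * h\<^sup>2" using assms by (intro mult_right_mono) auto
    moreover have "h\<^sup>2 * \<bar>w\<bar> \<le> h * \<bar>w\<bar>" using assms by (intro mult_right_mono) (auto simp: power2_eq_square mult_left_le)
    moreover have "\<bar>w\<bar> \<le> 1"
    proof -
      have "1 * \<bar>w\<bar> \<le> A^4 * \<bar>w\<bar>" using assms by (intro mult_right_mono one_le_power) auto
      moreover have "0 \<le> A^4 * (2 * h)" using assms A0 by simp
      ultimately show ?thesis using assms(12) by (simp add: algebra_simps)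
    qed
    then have "h * (\<bar>w\<bar> * \<bar>w\<bar>) \<le> h * (\<bar>w\<bar> * 1)" using assms by (intro mult_left_mono) auto
    moreover have "0 \<le> h * \<bar>w\<bar>" "0 \<le> \<bar>w\<bar>^3" "0 \<le> h\<^sup>2" using assms by auto
    ultimately show ?thesis unfolding Q_def distrib_left by linarith
  qed
  have e1: "\<bar>exp x - 1\<bar> \<le> 3 * \<bar>x\<bar>"
  proof -
    have "\<bar>exp x - 1\<bar> \<le> \<bar>x\<bar> + x\<^sup>2 / 2 + \<bar>\<rho>\<bar>" unfolding ee using ppos by linarith
    moreover have "x\<^sup>2 \<le> \<bar>x\<bar>" using x1 by (metis abs_ge_zero mult_left_le power2_abs power2_eq_square)
    moreover have "\<bar>x\<bar>^3 \<le> \<bar>x\<bar>" using x1 power_decreasing[of 1 3 "\<bar>x\<bar>"] by simp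
    ultimately show ?thesis using \<rho> by linarith
  qed
  have A4: "A^8 \<le> A^12" "A^6 \<le> A^12" "A^4 \<le> A^12" using assms by (auto intro!: power_increasing)
  have t1: "\<bar>k * q * h * w\<bar> \<le> 2 * A^12 * Q"
  proof -
    have "\<bar>k * q * h * w\<bar> = \<bar>k\<bar> * \<bar>q\<bar> * (h * \<bar>w\<bar>)" using assms by (simp add: abs_mult)
    also have "\<dots> \<le> (2 * A^4) * A\<^sup>2 * Q" using k q Q0 assms by (intro mult_mono) auto
    also have "\<dots> = 2 * A^6 * Q" by (simp add: eval_nat_numeral)
    also have "\<dots> \<le> 2 * A^12 * Q" using A4 Q0 by (intro mult_right_mono) auto
    finally show ?thesis .
  qed
  have t2: "\<bar>1 / 2 * k\<^sup>2 * h\<^sup>2\<bar> \<le> 2 * A^12 * Q"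
  proof -
    have "k\<^sup>2 \<le> (2 * A^4)\<^sup>2" using power_mono[OF k, of 2] by simp
    also have "\<dots> = 4 * A^8" by (simp add: power_mult_distrib flip: power_mult)
    finally have "1 / 2 * k\<^sup>2 \<le> 2 * A^12" using A4 by simp
    then have "1 / 2 * k\<^sup>2 * h\<^sup>2 \<le> 2 * A^12 * Q"
      by (rule mult_mono) (use Q0(2) A0 in simp_all)
    then show ?thesis by simp
  qed
  have t3: "\<bar>\<rho>\<bar> \<le> 32 * A^12 * Q"
  proof -
    have "A^12 * s^3 \<le> A^12 * (32 * Q)" using s3 A0 by (intro mult_left_mono) auto
    then show ?thesis using \<rho> x3 by linarith
  qed
  have t4: "\<bar>p * h * (exp x - 1)\<bar> \<le> A * (6 * A^12 * Q)"
  proof -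
    have "\<bar>p * h * (exp x - 1)\<bar> = p * (h * \<bar>exp x - 1\<bar>)" using assms by (simp add: abs_mult)
    also have "\<dots> \<le> A * (h * (3 * (A^4 * s)))"
      using assms e1 x A0 s0 by (intro mult_mono) (auto intro!: mult_nonneg_nonneg)
    also have "\<dots> = A * (3 * A^4 * (h * s))" by (simp add: algebra_simps)
    also have "\<dots> \<le> A * (3 * A^12 * (2 * Q))"
    proof -
      have "3 * A^4 * (h * s) \<le> 3 * A^12 * (2 * Q)"
        by (rule mult_mono) (use A4(3) A0 Q0(4) s0 assms(10) in auto)
      then show ?thesis using A0 by (rule mult_left_mono)
    qed
    finally show ?thesis by simp
  qed
  have "\<bar>b * (k * q * h * w + 1 / 2 * k\<^sup>2 * h\<^sup>2 + \<rho>)\<bar>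
      = b * \<bar>k * q * h * w + 1 / 2 * k\<^sup>2 * h\<^sup>2 + \<rho>\<bar>" using assms by (simp add: abs_mult)
  also have "\<dots> \<le> A * (36 * A^12 * Q)"
  proof (rule mult_mono)
    show "\<bar>k * q * h * w + 1 / 2 * k\<^sup>2 * h\<^sup>2 + \<rho>\<bar> \<le> 36 * A^12 * Q"
      using t1 t2 t3 by linarith
  qed (use assms in auto)
  finally have "\<bar>b * (k * q * h * w + 1 / 2 * k\<^sup>2 * h\<^sup>2 + \<rho>) + p * h * (exp x - 1)\<bar>
    \<le> A * (36 * A^12 * Q) + A * (6 * A^12 * Q)" using t4 by linarith
  also have "\<dots> = 42 * A^13 * Q" by (simp add: eval_nat_numeral)
  finally show ?thesis unfolding eq Q_def .
qed

subsection \<open>Deterministic analysis of one step\<close>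

text \<open>A continuous derivative is bounded on the compact box, and the mean value inequality on
  the convex box turns this into a Lipschitz bound. The smoothness of the coefficients enters all
  later estimates in this form.\<close>

lemma C1_on_cbox_bounds:
  fixes f :: "'a::euclidean_space \<Rightarrow> 'b::real_normed_vector"
  assumes "C1_on (cbox l r) f"
  shows "\<exists>K\<ge>0. (\<forall>x\<in>cbox l r. norm (f x) \<le> K) \<and>
    (\<forall>x\<in>cbox l r. \<forall>y\<in>cbox l r. norm (f x - f y) \<le> K * norm (x - y))"
proof -
  obtain f' where c: "continuous_on (cbox l r) f'" and
    d: "\<And>x. x \<in> cbox l r \<Longrightarrow> (f has_derivative blinfun_apply (f' x)) (at x within cbox l r)"
    using assms unfolding C1_on_def by blast
  have "bounded (f' ` cbox l r)" by (intro compact_imp_bounded compact_continuous_image c compact_cbox)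
  then obtain B where B: "\<And>x. x \<in> cbox l r \<Longrightarrow> norm (f' x) \<le> B"
    unfolding bounded_iff by auto
  have "continuous_on (cbox l r) f"
    using d by (meson continuous_on_eq_continuous_within has_derivative_continuous)
  then have "bounded (f ` cbox l r)" by (intro compact_imp_bounded compact_continuous_image compact_cbox)
  then obtain B' where B': "\<And>x. x \<in> cbox l r \<Longrightarrow> norm (f x) \<le> B'"
    unfolding bounded_iff by auto
  define K where "K = max 0 (max B B')"
  have K: "0 \<le> K" "B \<le> K" "B' \<le> K" by (auto simp: K_def)
  have "norm (f x - f y) \<le> K * norm (x - y)" if "x \<in> cbox l r" "y \<in> cbox l r" for x y
  proof (rule differentiable_bound[OF convex_box(1) d])
    fix z assume "z \<in> cbox l r"
    then show "onorm (blinfun_apply (f' z)) \<le> K" using B[of z] K by (simp add: norm_blinfun.rep_eq)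
  qed (use that in auto)
  then show ?thesis using K B' by (intro exI[of _ K]) (auto intro: order_trans)
qed

lemma step_left_expfac:
  "step_left f g L R h y w i = L $ i + expfac (y $ i - L $ i) (R $ i - y $ i)
     (f (coord_subst i (L $ i) y) $ i) (f y $ i) (g y $ i) h (w $ i)"
  by (simp add: step_left_def expfac_def alpha_left_def beta_left_def F_left_def add_ac)

text \<open>Numerator and denominator of \<open>F_right\<close> change sign together under the
  reflection, and the square in \<open>alpha_right\<close> does not see the sign of
  \<open>g\<close>.\<close>

lemma step_right_expfac:
  "step_right f g L R h y w i = R $ i - expfac (R $ i - y $ i) (y $ i - L $ i)
     (- f (coord_subst i (R $ i) y) $ i) (- f y $ i) (- g y $ i) h (w $ i)"
proof -
  have "(f y $ i - f (coord_subst i (R $ i) y) $ i) / (y $ i - R $ i)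
    = (- f y $ i - - f (coord_subst i (R $ i) y) $ i) / (R $ i - y $ i)"
    by (metis (no_types, opaque_lifting) minus_diff_commute minus_diff_eq minus_divide_divide minus_minus)
  then show ?thesis
    by (simp add: step_right_def expfac_def alpha_right_def beta_right_def F_right_def power2_eq_square)
qed

lemma mem_box_vec: "y \<in> box L R \<longleftrightarrow> (\<forall>i. L $ i < y $ i \<and> y $ i < R $ i)" for y :: "real^'d"
  by (auto simp: mem_box_cart)

lemma coord_subst_mem_cbox:
  assumes "y \<in> cbox L R" "L $ i \<le> s" "s \<le> R $ i"
  shows "coord_subst i s y \<in> cbox L R"
  using assms by (auto simp: mem_box_cart coord_subst_def)

lemma norm_coord_subst: "norm (y - coord_subst i s y) = \<bar>y $ i - s\<bar>"
proof -
  have "y - coord_subst i s y = axis i (y $ i - s)"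
    by (simp add: vec_eq_iff coord_subst_def axis_def)
  then show ?thesis by (simp add: norm_eq_sqrt_inner inner_axis_axis)
qed

text \<open>This is the coefficient \<open>m\<close> of \<open>w\<^sup>2 - h\<close>. With
  \<open>b\<close> and \<open>a\<close> the distances to the left and right face, it is the weighted
  sum of \<open>1 / 2 * (g * a)\<^sup>2 * b\<close> from the left candidate and
  \<open>- 1 / 2 * (g * b)\<^sup>2 * a\<close> from the right one. It involves only the state and
  the weight.\<close>

definition step_coeff :: "(real^'d \<Rightarrow> real^'d) \<Rightarrow> real^'d \<Rightarrow> real^'d \<Rightarrow> real^'d \<Rightarrow> real^'d \<Rightarrow> 'd::finite \<Rightarrow> real" where
  "step_coeff g L R y \<theta> i = 1 / 2 * (g y $ i)\<^sup>2 * (y $ i - L $ i) * (R $ i - y $ i) *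
     ((1 - \<theta> $ i) * (R $ i - y $ i) - \<theta> $ i * (y $ i - L $ i))"

text \<open>A single constant dominates the sup norms, the Lipschitz constants, the widths and the
  reciprocals of the widths. Since \<open>1 \<le> A\<close>, products of such bounds can be raised
  to a common power of \<open>A\<close>, which reduces the bookkeeping to exponents.\<close>

locale box_domain =
  fixes L R :: "real^'d::finite" and f g :: "real^'d \<Rightarrow> real^'d" and A :: real
  assumes L_less_R: "L $ i < R $ i"
    and A_ge_1: "1 \<le> A"
    and width: "R $ i - L $ i \<le> A" "1 \<le> A * (R $ i - L $ i)"
    and f_bound: "y \<in> cbox L R \<Longrightarrow> norm (f y) \<le> A"
    and g_bound: "y \<in> cbox L R \<Longrightarrow> norm (g y) \<le> A"
    and f_lip: "y \<in> cbox L R \<Longrightarrow> z \<in> cbox L R \<Longrightarrow> norm (f y - f z) \<le> A * norm (y - z)"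
    and g_lip: "y \<in> cbox L R \<Longrightarrow> z \<in> cbox L R \<Longrightarrow> norm (g y - g z) \<le> A * norm (y - z)"
    and f_left: "y \<in> cbox L R \<Longrightarrow> 0 \<le> f (coord_subst i (L $ i) y) $ i"
    and f_right: "y \<in> cbox L R \<Longrightarrow> f (coord_subst i (R $ i) y) $ i \<le> 0"
begin

lemma A_nonneg: "0 \<le> A" using A_ge_1 by simp

section \<open>Candidates and scheme at a fixed state and coordinate\<close>

context
  fixes y :: "real^'d" and i :: 'd
  assumes y: "y \<in> box L R"
begin

lemma y_cbox: "y \<in> cbox L R" using y box_subset_cbox by blast

lemma gap_pos: "0 < y $ i - L $ i" "0 < R $ i - y $ i" using y by (auto simp: mem_box_vec)

lemma gap_le: "y $ i - L $ i \<le> A" "R $ i - y $ i \<le> A" using gap_pos width(1)[of i] by auto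

lemma face_mem: "coord_subst i (L $ i) y \<in> cbox L R" "coord_subst i (R $ i) y \<in> cbox L R"
  using y_cbox L_less_R[of i] by (auto intro!: coord_subst_mem_cbox)

lemma comp_le: "\<bar>f y $ i\<bar> \<le> A" "\<bar>g y $ i\<bar> \<le> A" "\<bar>f (coord_subst i (L $ i) y) $ i\<bar> \<le> A"
  "\<bar>f (coord_subst i (R $ i) y) $ i\<bar> \<le> A"
  using f_bound[OF y_cbox] g_bound[OF y_cbox] f_bound[OF face_mem(1)] f_bound[OF face_mem(2)]
    component_le_norm_cart order_trans by blast+

text \<open>Only one coordinate changes on the way to the face, so the Lipschitz bound yields
  exactly the distance to it. This keeps the quotients \<open>F_left\<close> and
  \<open>F_right\<close> bounded near the boundary and, with the signs of \<open>f\<close> on the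
  faces, bounds an outward drift by the distance to the face it points to.\<close>

lemma face_diff:
  "\<bar>f y $ i - f (coord_subst i (L $ i) y) $ i\<bar> \<le> A * (y $ i - L $ i)"
  "\<bar>f y $ i - f (coord_subst i (R $ i) y) $ i\<bar> \<le> A * (R $ i - y $ i)"
proof -
  have "\<bar>f y $ i - f (coord_subst i s y) $ i\<bar> \<le> A * \<bar>y $ i - s\<bar>"
    if "coord_subst i s y \<in> cbox L R" for s
    using component_le_norm_cart[of "f y - f (coord_subst i s y)" i] f_lip[OF y_cbox that]
    by (simp add: norm_coord_subst)
  from this[OF face_mem(1)] this[OF face_mem(2)]
  show "\<bar>f y $ i - f (coord_subst i (L $ i) y) $ i\<bar> \<le> A * (y $ i - L $ i)"
    "\<bar>f y $ i - f (coord_subst i (R $ i) y) $ i\<bar> \<le> A * (R $ i - y $ i)"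
    using gap_pos by auto
qed

text \<open>Each candidate is its own face shifted inwards by a positive quantity, so it can leave
  only through the opposite face. The third claim says that they do not both leave, which makes the
  three indicators of the scheme mutually exclusive.\<close>

lemma steps_bounds:
  assumes h: "0 \<le> h"
  shows "L $ i < step_left f g L R h y w i" "step_right f g L R h y w i < R $ i"
    "step_left f g L R h y w i < R $ i \<or> L $ i < step_right f g L R h y w i"
proof -
  show "L $ i < step_left f g L R h y w i"
    unfolding step_left_expfac using expfac_pos[OF gap_pos(1) f_left[OF y_cbox] h] by simp
  have q: "0 \<le> - f (coord_subst i (R $ i) y) $ i" using f_right[OF y_cbox] by simp
  show "step_right f g L R h y w i < R $ i"
    unfolding step_right_expfac using expfac_pos[OF gap_pos(2) q h] by simp
  show "step_left f g L R h y w i < R $ i \<or> L $ i < step_right f g L R h y w i"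
    unfolding step_left_expfac step_right_expfac
    using expfac_not_both[OF gap_pos(2,1) f_left[OF y_cbox, of i] q h, where v = "f y $ i" and g = "g y $ i" and w = "w $ i"]
    by fastforce
qed

text \<open>If one candidate has left through the opposite face, the other one is the new state and
  lies inside. If neither has left, both lie in the interval and so does their convex
  combination.\<close>

lemma edp_step_bounds:
  assumes h: "0 \<le> h" and \<theta>: "0 < \<theta> $ i" "\<theta> $ i < 1"
  shows "L $ i < edp_step f g L R h y w \<theta> $ i" "edp_step f g L R h y w \<theta> $ i < R $ i"
proof -
  define yl yr where "yl = step_left f g L R h y w i" and "yr = step_right f g L R h y w i"
  note b = steps_bounds[OF h, of w, folded yl_def yr_def]
  have m: "L $ i < (1 - \<theta> $ i) * yl + \<theta> $ i * yr \<and> (1 - \<theta> $ i) * yl + \<theta> $ i * yr < R $ i"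
    if "L $ i < yr" "yl < R $ i"
  proof
    have "(1 - \<theta> $ i) * L $ i + \<theta> $ i * L $ i < (1 - \<theta> $ i) * yl + \<theta> $ i * yr"
      using that b \<theta> by (intro add_strict_mono mult_strict_left_mono) auto
    then show "L $ i < (1 - \<theta> $ i) * yl + \<theta> $ i * yr" by (simp add: algebra_simps)
    have "(1 - \<theta> $ i) * yl + \<theta> $ i * yr < (1 - \<theta> $ i) * R $ i + \<theta> $ i * R $ i"
      using that b \<theta> by (intro add_strict_mono mult_strict_left_mono) auto
    then show "(1 - \<theta> $ i) * yl + \<theta> $ i * yr < R $ i" by (simp add: algebra_simps)
  qed
  have "edp_step f g L R h y w \<theta> $ i = yl * of_bool (yr \<le> L $ i) + yr * of_bool (R $ i \<le> yl)
        + ((1 - \<theta> $ i) * yl + \<theta> $ i * yr) * of_bool (L $ i < yr \<and> yl < R $ i)"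
    by (simp add: edp_step_def yl_def yr_def Let_def)
  then show "L $ i < edp_step f g L R h y w \<theta> $ i" "edp_step f g L R h y w \<theta> $ i < R $ i"
    using b m by (auto simp: of_bool_def split: if_splits)
qed

end

lemma edp_step_mem_box:
  assumes "y \<in> box L R" "0 \<le> h" "\<And>i. 0 < \<theta> $ i \<and> \<theta> $ i < 1"
  shows "edp_step f g L R h y w \<theta> \<in> box L R"
  using edp_step_bounds[OF assms(1,2)] assms(3) by (simp add: mem_box_vec)

lemma abs_step_coeff_le:
  assumes "y \<in> box L R" "0 < \<theta> $ i" "\<theta> $ i < 1"
  shows "\<bar>step_coeff g L R y \<theta> i\<bar> \<le> A ^ 5"
proof -
  note gp = gap_pos[OF assms(1), of i] and gl = gap_le[OF assms(1), of i]
  have "(1 - \<theta> $ i) * (R $ i - y $ i) \<le> 1 * A" "\<theta> $ i * (y $ i - L $ i) \<le> 1 * A"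
    using assms gp gl by (intro mult_mono; simp)+
  moreover have "0 \<le> (1 - \<theta> $ i) * (R $ i - y $ i)" "0 \<le> \<theta> $ i * (y $ i - L $ i)"
    using assms gp by auto
  ultimately have 1: "\<bar>(1 - \<theta> $ i) * (R $ i - y $ i) - \<theta> $ i * (y $ i - L $ i)\<bar> \<le> A"
    by linarith
  have 2: "(g y $ i)\<^sup>2 \<le> A\<^sup>2"
    using comp_le(2)[OF assms(1), of i] A_nonneg by (metis abs_le_square_iff abs_of_nonneg)
  have "\<bar>step_coeff g L R y \<theta> i\<bar> = 1 / 2 * (g y $ i)\<^sup>2 * (y $ i - L $ i) * (R $ i - y $ i) *
     \<bar>(1 - \<theta> $ i) * (R $ i - y $ i) - \<theta> $ i * (y $ i - L $ i)\<bar>"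
    unfolding step_coeff_def using gp by (simp add: abs_mult)
  also have "\<dots> \<le> 1 * A\<^sup>2 * A * A * A"
    using gp gl 1 2 A_nonneg by (intro mult_mono) auto
  finally show ?thesis by (simp add: eval_nat_numeral)
qed

text \<open>The size is dictated by large increments: cubing \<open>1 \<le> 12 * A ^ 4 * |w|\<close>
  gives \<open>1 \<le> 1728 * A ^ 12 * |w| ^ 3\<close>, and constants up to \<open>A ^ 5\<close>
  have to be absorbed, whence \<open>A ^ 17\<close>. The coefficients add up to
  \<open>3 * 1728 + 144 + 12 = 5340\<close>. Small increments need only
  \<open>42 * A ^ 13\<close>.\<close>

definition step_const :: real where "step_const = 10000 * A ^ 17"

text \<open>Below the threshold \<open>12 * A ^ 4 * |w| < 1\<close> both candidates are inside, and
  the new state is the weighted mean of two expansions with the same linear part. Above it the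
  branch is not determined: the new state is known only to lie in the box, and every term of the
  claim is estimated separately against \<open>|w| ^ 3\<close>.\<close>

lemma edp_step_expansion:
  assumes y: "y \<in> box L R" and h: "0 \<le> h" "12 * A ^ 4 * h \<le> 1"
    and \<theta>: "0 < \<theta> $ i" "\<theta> $ i < 1"
  shows "\<bar>edp_step f g L R h y w \<theta> $ i - (y $ i + f y $ i * h + diffusion_coeff g L R i y * w $ i
      + step_coeff g L R y \<theta> i * ((w $ i)\<^sup>2 - h))\<bar>
    \<le> step_const * (h\<^sup>2 + h * \<bar>w $ i\<bar> + \<bar>w $ i\<bar> ^ 3)"
proof -
  define b a p q v G u where "b = y $ i - L $ i" and "a = R $ i - y $ i"
    and "p = f (coord_subst i (L $ i) y) $ i" and "q = - f (coord_subst i (R $ i) y) $ i"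
    and "v = f y $ i" and "G = g y $ i" and "u = w $ i"
  note defs = b_def a_def p_def q_def v_def G_def u_def
  have ba: "0 < b" "0 < a" "a \<le> A" "b \<le> A" "a + b \<le> A" "1 \<le> A * (a + b)"
    using gap_pos[OF y, of i] gap_le[OF y, of i] width[of i] by (auto simp: defs)
  have pq: "0 \<le> p" "0 \<le> q" "p \<le> A" "q \<le> A" "\<bar>v\<bar> \<le> A" "\<bar>G\<bar> \<le> A"
    using f_left[OF y_cbox[OF y], of i] f_right[OF y_cbox[OF y], of i] comp_le[OF y, of i]
    by (auto simp: defs abs_le_iff)
  have vp: "\<bar>v - p\<bar> \<le> A * b" "\<bar>v + q\<bar> \<le> A * a"
    using face_diff[OF y, of i] by (auto simp: defs)
  define Q where "Q = h\<^sup>2 + h * \<bar>u\<bar> + \<bar>u\<bar>^3"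
  have Q: "0 \<le> Q" "\<bar>u\<bar>^3 \<le> Q" using h by (auto simp: Q_def)
  have pw: "A \<le> A^4" "1 \<le> A^4" "A\<^sup>2 \<le> A^4"
    using A_ge_1 power_increasing[of 1 4 A] power_increasing[of 2 4 A] by auto
  define yl yr where "yl = step_left f g L R h y w i" and "yr = step_right f g L R h y w i"
  have yl: "yl = L $ i + expfac b a p v G h u"
    by (simp add: yl_def step_left_expfac defs)
  have yr: "yr = R $ i - expfac a b q (- v) (- G) h u"
    by (simp add: yr_def step_right_expfac defs)
  let ?lin = "y $ i + v * h + G * a * b * u"
  define Y where "Y = edp_step f g L R h y w \<theta> $ i"
  have Y: "Y = yl * of_bool (yr \<le> L $ i) + yr * of_bool (R $ i \<le> yl)
        + ((1 - \<theta> $ i) * yl + \<theta> $ i * yr) * of_bool (L $ i < yr \<and> yl < R $ i)"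
    by (simp add: Y_def edp_step_def yl_def yr_def Let_def)
  define c where "c = step_coeff g L R y \<theta> i"
  have c: "c = (1 - \<theta> $ i) * (1 / 2 * (G * a)\<^sup>2 * b) - \<theta> $ i * (1 / 2 * (G * b)\<^sup>2 * a)"
    unfolding c_def step_coeff_def b_def[symmetric] a_def[symmetric] G_def[symmetric]
    by (simp add: power2_eq_square field_simps)
  have dc: "diffusion_coeff g L R i y = G * a * b"
    by (simp add: diffusion_coeff_def defs)
  have small: "\<bar>Y - (?lin + c * (u\<^sup>2 - h))\<bar> \<le> step_const * Q"
    if u: "12 * A^4 * \<bar>u\<bar> < 1"
  proof -
    have h1: "h \<le> 1" using mult_right_mono[OF pw(2) h(1)] h by simp
    have Ah: "A\<^sup>2 * h \<le> 1 / 12" using mult_right_mono[OF pw(3) h(1)] h by linarith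
    have A6: "A * h \<le> 1 / 6" using mult_right_mono[OF pw(1) h(1)] h by linarith
    \<comment> \<open>The width may be small; \<open>1 \<le> A * (a + b)\<close> makes the
      comparison possible at the price of one more factor \<open>A\<close>.\<close>
    have A7: "A * h \<le> (a + b) / 6"
    proof -
      have "A * h * 1 \<le> A * h * (A * (a + b))" using ba h A_nonneg by (intro mult_left_mono) auto
      also have "\<dots> = (A\<^sup>2 * h) * (a + b)" by (simp add: power2_eq_square)
      also have "\<dots> \<le> (1 / 12) * (a + b)" using Ah ba by (intro mult_right_mono) auto
      finally show ?thesis using ba by simp
    qed
    have uA: "\<bar>u\<bar> * (A * (a + b)) < 1 / 6"
    proof -
      have "A * (a + b) \<le> A * A" using ba A_nonneg by (intro mult_left_mono)
      then have "\<bar>u\<bar> * (A * (a + b)) \<le> \<bar>u\<bar> * A^4"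
        using pw(3) by (intro mult_left_mono) (auto simp: power2_eq_square)
      moreover have "\<bar>u\<bar> * A^4 < 1 / 6" using u by (simp add: mult_ac)
      ultimately show ?thesis by linarith
    qed
    have A4: "A^4 * (2 * h + \<bar>u\<bar>) \<le> 1" using u h by (simp add: distrib_left)
    have vA: "v \<le> A * a" "- v \<le> A * b" using vp pq by auto
    have "expfac b a p v G h u < a + b"
      by (rule expfac_less_total[OF ba(2,1) pq(1,3) vp(1) vA(1) pq(6) h(1) A7 A6 uA])
    then have 1: "yl < R $ i" by (simp add: yl defs)
    have "expfac a b q (- v) (- G) h u < b + a"
      by (rule expfac_less_total[OF ba(1,2) pq(2,4) _ vA(2) _ h(1) _ A6])
        (use vp pq A7 uA in \<open>auto simp: add_ac\<close>)
    then have 2: "L $ i < yr" by (simp add: yr defs)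
    have e1: "\<bar>yl - (?lin + 1 / 2 * (G * a)\<^sup>2 * b * (u\<^sup>2 - h))\<bar> \<le> 42 * A^13 * Q"
    proof -
      have "\<bar>expfac b a p v G h u - (b + v * h + G * a * b * u + 1 / 2 * (G * a)\<^sup>2 * b * (u\<^sup>2 - h))\<bar>
        \<le> 42 * A^13 * Q" unfolding Q_def
        by (rule expfac_expansion) (use ba pq vp A_ge_1 h h1 A4 in auto)
      moreover have "y $ i = L $ i + b" by (simp add: defs)
      ultimately show ?thesis by (simp add: yl)
    qed
    have e2: "\<bar>yr - (?lin - 1 / 2 * (G * b)\<^sup>2 * a * (u\<^sup>2 - h))\<bar> \<le> 42 * A^13 * Q"
    proof -
      have *: "\<bar>expfac a b q (- v) (- G) h u - (a + - v * h + - G * b * a * u + 1 / 2 * (- G * b)\<^sup>2 * a * (u\<^sup>2 - h))\<bar>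
        \<le> 42 * A^13 * Q" unfolding Q_def
        by (rule expfac_expansion) (use ba pq vp A_ge_1 h h1 A4 in auto)
      have "yr - (?lin - 1 / 2 * (G * b)\<^sup>2 * a * (u\<^sup>2 - h))
        = - (expfac a b q (- v) (- G) h u - (a + - v * h + - G * b * a * u + 1 / 2 * (- G * b)\<^sup>2 * a * (u\<^sup>2 - h)))"
        unfolding yr by (simp add: a_def)
      then show ?thesis using * by (simp only: abs_minus_cancel)
    qed
    \<comment> \<open>The linear parts agree and the weights sum to one, so the weights are felt
      only in the second-order coefficients, which combine to \<open>c\<close>.\<close>
    have "Y = (1 - \<theta> $ i) * yl + \<theta> $ i * yr" using 1 2 by (simp add: Y)
    then have "Y - (?lin + c * (u\<^sup>2 - h))
      = (1 - \<theta> $ i) * (yl - (?lin + 1 / 2 * (G * a)\<^sup>2 * b * (u\<^sup>2 - h)))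
      + \<theta> $ i * (yr - (?lin - 1 / 2 * (G * b)\<^sup>2 * a * (u\<^sup>2 - h)))"
      unfolding c by (simp add: algebra_simps)
    also have "\<bar>\<dots>\<bar> \<le> (1 - \<theta> $ i) * (42 * A^13 * Q) + \<theta> $ i * (42 * A^13 * Q)"
      using \<theta> e1 e2 by (intro order_trans[OF abs_triangle_ineq] add_mono)
        (auto simp: abs_mult intro!: mult_left_mono)
    also have "\<dots> = 42 * A^13 * Q" by (simp add: algebra_simps)
    also have "\<dots> \<le> step_const * Q" unfolding step_const_def
      using Q A_ge_1 by (intro mult_right_mono mult_mono power_increasing) auto
    finally show ?thesis .
  qed
  have large: "\<bar>Y - (?lin + c * (u\<^sup>2 - h))\<bar> \<le> step_const * Q"
    if u: "1 \<le> 12 * A^4 * \<bar>u\<bar>"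
  proof -
    have h1: "h \<le> 1" using mult_right_mono[OF pw(2) h(1)] h by simp
    have "L $ i < Y" "Y < R $ i" unfolding Y_def using edp_step_bounds[OF y h(1) \<theta>] by auto
    then have Yy: "\<bar>Y - y $ i\<bar> \<le> A" using ba by (simp add: defs abs_le_iff)
    have vh: "\<bar>v * h\<bar> \<le> A" using pq h h1 mult_mono[of "\<bar>v\<bar>" A h 1] A_nonneg by (simp add: abs_mult)
    have "\<bar>G * a * b\<bar> \<le> A * A * A" unfolding abs_mult using ba pq A_nonneg by (intro mult_mono) auto
    then have Gu: "\<bar>G * a * b * u\<bar> \<le> A * A * A * \<bar>u\<bar>" unfolding abs_mult[of _ u] by (intro mult_right_mono) auto
    have "\<bar>c\<bar> \<le> A^5" unfolding c_def by (rule abs_step_coeff_le[OF y \<theta>])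
    moreover have "\<bar>u\<^sup>2 - h\<bar> \<le> u\<^sup>2 + 1" using h h1 zero_le_power2[of u] unfolding abs_le_iff by linarith
    ultimately have cu: "\<bar>c * (u\<^sup>2 - h)\<bar> \<le> A^5 * (u\<^sup>2 + 1)" unfolding abs_mult by (rule mult_mono) (use A_nonneg in simp_all)
    define U z where "U = \<bar>u\<bar>" and "z = U^3"
    have U: "0 \<le> U" "u\<^sup>2 = U\<^sup>2" "1 \<le> 12 * A^4 * U" using u by (auto simp: U_def)
    have z0: "0 \<le> z" using U(1) by (simp add: z_def)
    have A0: "0 \<le> A ^ n" for n using A_nonneg by simp
    \<comment> \<open>Powers of \<open>U\<close> below the third are raised to the third by factors
      \<open>12 * A ^ 4 * U\<close>, each of which is at least \<open>1\<close>.\<close>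
    have u1: "U * 1 \<le> U * (12 * A^4 * U)\<^sup>2" by (rule mult_left_mono[OF one_le_power[OF U(3)] U(1)])
    have u2: "U\<^sup>2 * 1 \<le> U\<^sup>2 * (12 * A^4 * U)" by (rule mult_left_mono[OF U(3)]) simp
    have u0: "1 \<le> (12 * A^4 * U)^3" by (rule one_le_power[OF U(3)])
    have z: "U \<le> 144 * A^8 * z" "U\<^sup>2 \<le> 12 * A^4 * z" "1 \<le> 1728 * A^12 * z"
      using u0 u1 u2 by (simp_all add: z_def power_mult_distrib eval_nat_numeral mult_ac)
    have r1: "A * A * A * \<bar>u\<bar> \<le> 144 * (A^17 * z)"
    proof -
      have "A^3 * U \<le> A^3 * (144 * A^8 * z)" by (rule mult_left_mono[OF z(1) A0])
      also have "\<dots> = 144 * (A^11 * z)" by (simp flip: power_add add: mult.left_commute)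
      also have "\<dots> \<le> 144 * (A^17 * z)"
        using mult_right_mono[OF power_increasing[of 11 17 A] z0] A_ge_1 by simp
      finally show ?thesis by (simp add: U_def eval_nat_numeral mult_ac)
    qed
    have r2: "A^5 * u\<^sup>2 \<le> 12 * (A^17 * z)"
    proof -
      have "A^5 * U\<^sup>2 \<le> A^5 * (12 * A^4 * z)" by (rule mult_left_mono[OF z(2) A0])
      also have "\<dots> = 12 * (A^9 * z)" by (simp flip: power_add add: mult.left_commute)
      also have "\<dots> \<le> 12 * (A^17 * z)"
        using mult_right_mono[OF power_increasing[of 9 17 A] z0] A_ge_1 by simp
      finally show ?thesis unfolding U(2) .
    qed
    have r3: "A^5 \<le> 1728 * (A^17 * z)"
    proof -
      have "A^5 * 1 \<le> A^5 * (1728 * A^12 * z)" by (rule mult_left_mono[OF z(3) A0])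
      also have "\<dots> = 1728 * (A^17 * z)" by (simp flip: power_add add: mult.left_commute)
      finally show ?thesis by simp
    qed
    have r4: "A \<le> A^5" using A_ge_1 power_increasing[of 1 5 A] by simp
    have "\<bar>Y - (?lin + c * (u\<^sup>2 - h))\<bar>
      \<le> \<bar>Y - y $ i\<bar> + \<bar>v * h\<bar> + \<bar>G * a * b * u\<bar> + \<bar>c * (u\<^sup>2 - h)\<bar>" by linarith
    also have "\<dots> \<le> A + A + A * A * A * \<bar>u\<bar> + A^5 * (u\<^sup>2 + 1)"
      using Yy vh Gu cu by linarith
    also have "\<dots> = A + A + A * A * A * \<bar>u\<bar> + (A^5 * u\<^sup>2 + A^5)" by (simp add: distrib_left)
    also have "\<dots> \<le> 10000 * (A^17 * z)" using r1 r2 r3 r4 mult_nonneg_nonneg[OF A0[of 17] z0] by linarith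
    also have "\<dots> \<le> 10000 * (A^17 * Q)"
      using mult_left_mono[OF Q(2) A0[of 17]] by (simp add: z_def U_def)
    finally show ?thesis by (simp add: step_const_def)
  qed
  show ?thesis using small large
    unfolding dc Q_def Y_def[symmetric] c_def[symmetric] v_def[symmetric] u_def[symmetric]
    by (meson not_le)
qed

end

subsection \<open>Increments of Brownian motion\<close>

text \<open>The error is estimated one coordinate at a time, so the stochastic calculus is set up
  for a real process. The filtration is a parameter of its own, so that coefficients may depend on
  all coordinates of the solution and of the scheme.\<close>

locale brownian_component = prob_space M for M :: "'a measure" +
  fixes T :: real and F :: "real \<Rightarrow> 'a measure" and B :: "real \<Rightarrow> 'a \<Rightarrow> real"
  assumes subalg: "t \<in> {0..T} \<Longrightarrow> subalgebra M (F t)"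
    and filtration_mono: "0 \<le> s \<Longrightarrow> s \<le> t \<Longrightarrow> t \<le> T \<Longrightarrow> sets (F s) \<subseteq> sets (F t)"
    and adapted: "t \<in> {0..T} \<Longrightarrow> B t \<in> borel_measurable (F t)"
    and indep_increment: "0 \<le> s \<Longrightarrow> s < t \<Longrightarrow> t \<le> T \<Longrightarrow>
      indep_set (sets (F s)) {(\<lambda>\<omega>. B t \<omega> - B s \<omega>) -` A \<inter> space M | A. A \<in> sets borel}"
    and normal_increment: "0 \<le> s \<Longrightarrow> s < t \<Longrightarrow> t \<le> T \<Longrightarrow>
      distributed M lborel (\<lambda>\<omega>. B t \<omega> - B s \<omega>) (\<lambda>x. ennreal (normal_density 0 (sqrt (t - s)) x))"
begin

lemma space_F: "t \<in> {0..T} \<Longrightarrow> space (F t) = space M"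
  using subalg[of t] by (simp add: subalgebra_def)

lemma measurable_F_mono:
  assumes "0 \<le> s" "s \<le> t" "t \<le> T" "X \<in> borel_measurable (F s)"
  shows "X \<in> borel_measurable (F t)"
proof -
  have "subalgebra (F t) (F s)"
    using assms filtration_mono[of s t] by (simp add: subalgebra_def space_F)
  then show ?thesis using assms(4) by (rule measurable_from_subalg)
qed

lemma measurable_F: "t \<in> {0..T} \<Longrightarrow> X \<in> borel_measurable (F t) \<Longrightarrow> X \<in> borel_measurable M"
  by (rule measurable_from_subalg[OF subalg])

lemma B_measurable: "t \<in> {0..T} \<Longrightarrow> B t \<in> borel_measurable M"
  by (rule measurable_F[OF _ adapted])

text \<open>The sigma-algebra generated by \<open>\<phi>\<close> of the increment lies within that
  of the increment, and the one generated by \<open>Z\<close> within \<open>F s\<close>. The assumed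
  independence of set systems thus passes to the two random variables, and the product formula
  applies.\<close>

lemma increment_indep:
  fixes Z :: "'a \<Rightarrow> real" and \<phi> :: "real \<Rightarrow> real"
  assumes st: "0 \<le> s" "s < t" "t \<le> T"
    and Z: "Z \<in> borel_measurable (F s)" "integrable M Z"
    and \<phi>: "\<phi> \<in> borel_measurable borel" "integrable M (\<lambda>\<omega>. \<phi> (B t \<omega> - B s \<omega>))"
  shows "integrable M (\<lambda>\<omega>. Z \<omega> * \<phi> (B t \<omega> - B s \<omega>))"
    and "expectation (\<lambda>\<omega>. Z \<omega> * \<phi> (B t \<omega> - B s \<omega>))
      = expectation Z * expectation (\<lambda>\<omega>. \<phi> (B t \<omega> - B s \<omega>))"
proof -
  let ?D = "\<lambda>\<omega>. B t \<omega> - B s \<omega>"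
  have s: "s \<in> {0..T}" and t: "t \<in> {0..T}" using st by auto
  have D: "?D \<in> borel_measurable M" using B_measurable[OF s] B_measurable[OF t] by measurable
  have ZM: "Z \<in> borel_measurable M" using measurable_F[OF s Z(1)] .
  have 1: "sigma_sets (space M) {Z -` A \<inter> space M |A. A \<in> sets borel} \<subseteq> sets (F s)"
  proof -
    have "{Z -` A \<inter> space M |A. A \<in> sets borel} \<subseteq> sets (F s)"
      using measurable_sets[OF Z(1)] space_F[OF s] by auto
    then show ?thesis using sets.sigma_sets_subset[of _ "F s"] space_F[OF s] by simp
  qed
  have 2: "sigma_sets (space M) {(\<lambda>\<omega>. \<phi> (?D \<omega>)) -` A \<inter> space M |A. A \<in> sets borel}
    \<subseteq> {?D -` A \<inter> space M | A. A \<in> sets borel}"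
  proof -
    have eq: "{?D -` A \<inter> space M | A. A \<in> sets borel} = sets (vimage_algebra (space M) ?D borel)"
      by (simp add: sets_vimage_algebra2)
    have "{(\<lambda>\<omega>. \<phi> (?D \<omega>)) -` A \<inter> space M |A. A \<in> sets borel}
      \<subseteq> {?D -` A \<inter> space M | A. A \<in> sets borel}"
    proof safe
      fix A :: "real set" assume "A \<in> sets borel"
      then have "\<phi> -` A \<in> sets borel" using measurable_sets[OF \<phi>(1)] by simp
      then show "\<exists>A'. (\<lambda>\<omega>. \<phi> (?D \<omega>)) -` A \<inter> space M = ?D -` A' \<inter> space M \<and> A' \<in> sets borel"
        by (intro exI[of _ "\<phi> -` A"]) auto
    qed
    then show ?thesis
      unfolding eq using sets.sigma_sets_subset[of _ "vimage_algebra (space M) ?D borel"] by simp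
  qed
  have "indep_var borel Z borel (\<lambda>\<omega>. \<phi> (?D \<omega>))"
    unfolding indep_var_eq
  proof (intro conjI)
    show "indep_set (sigma_sets (space M) {Z -` A \<inter> space M |A. A \<in> sets borel})
       (sigma_sets (space M) {(\<lambda>\<omega>. \<phi> (?D \<omega>)) -` A \<inter> space M |A. A \<in> sets borel})"
    proof -
      have i: "sets (F s) \<subseteq> events" "{?D -` A \<inter> space M | A. A \<in> sets borel} \<subseteq> events"
        "\<And>a b. a \<in> sets (F s) \<Longrightarrow> b \<in> {?D -` A \<inter> space M | A. A \<in> sets borel} \<Longrightarrow>
          prob (a \<inter> b) = prob a * prob b"
        using indep_increment[OF st] unfolding indep_sets2_eq by simp_all
      show ?thesis
        by (rule indep_setI[OF order_trans[OF 1 i(1)] order_trans[OF 2 i(2)]])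
          (rule i(3)[OF subsetD[OF 1] subsetD[OF 2]])
    qed
    show "Z \<in> borel_measurable M" by (rule ZM)
    show "(\<lambda>\<omega>. \<phi> (?D \<omega>)) \<in> borel_measurable M" by (rule measurable_compose[OF D \<phi>(1)])
  qed
  then show "integrable M (\<lambda>\<omega>. Z \<omega> * \<phi> (?D \<omega>))"
    "expectation (\<lambda>\<omega>. Z \<omega> * \<phi> (?D \<omega>)) = expectation Z * expectation (\<lambda>\<omega>. \<phi> (?D \<omega>))"
    using indep_var_integrable indep_var_lebesgue_integral Z(2) \<phi>(2) by blast+
qed

text \<open>The second and fourth moments give the variance of \<open>w\<^sup>2 - h\<close>, and the
  sixth controls the square of the cubic remainder. The case \<open>s = t\<close> stands apart
  because the normal density requires a positive deviation.\<close>

lemma increment_moments: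
  assumes st: "0 \<le> s" "s \<le> t" "t \<le> T"
  shows "integrable M (\<lambda>\<omega>. (B t \<omega> - B s \<omega>) ^ k)" (is ?A)
    and "expectation (\<lambda>\<omega>. B t \<omega> - B s \<omega>) = 0" (is ?B)
    and "expectation (\<lambda>\<omega>. (B t \<omega> - B s \<omega>)\<^sup>2) = t - s" (is ?C)
    and "expectation (\<lambda>\<omega>. (B t \<omega> - B s \<omega>) ^ 4) = 3 * (t - s)\<^sup>2" (is ?D)
    and "expectation (\<lambda>\<omega>. (B t \<omega> - B s \<omega>) ^ 6) = 15 * (t - s) ^ 3" (is ?E)
proof -
  have "?A \<and> ?B \<and> ?C \<and> ?D \<and> ?E"
  proof (cases "s = t")
    case False
    then have lt: "s < t" using st by simp
    note d = normal_increment[OF st(1) lt st(3)]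
    let ?\<sigma> = "sqrt (t - s)"
    have \<sigma>: "0 < ?\<sigma>" "?\<sigma>\<^sup>2 = t - s" using lt by auto
    have ex: "expectation (\<lambda>\<omega>. (B t \<omega> - B s \<omega>) ^ n) = (\<integral>x. normal_density 0 ?\<sigma> x * x ^ n \<partial>lborel)" for n
      by (rule distributed_integral[OF d, symmetric]) auto
    have ev: "expectation (\<lambda>\<omega>. (B t \<omega> - B s \<omega>) ^ (2 * n)) = fact (2 * n) / ((2 / (t - s)) ^ n * fact n)" for n
      unfolding ex using integral_normal_moment_even[OF \<sigma>(1), of 0 n] \<sigma>(2) by simp
    have i: "integrable M (\<lambda>\<omega>. (B t \<omega> - B s \<omega>) ^ k)"
    proof -
      have "integrable lborel (\<lambda>x. normal_density 0 ?\<sigma> x * x ^ k)"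
        using integrable_normal_moment[OF \<sigma>(1), of 0 k] by simp
      then show ?thesis
        by (subst distributed_integrable[OF d, symmetric]) auto
    qed
    have o: "expectation (\<lambda>\<omega>. B t \<omega> - B s \<omega>) = 0"
      using ex[of 1] integral_normal_moment_odd[OF \<sigma>(1), of 0 0] by simp
    have f: "fact (2 * 1) / ((2 / h) ^ 1 * fact 1) = h" "fact (2 * 2) / ((2 / h)\<^sup>2 * fact 2) = 3 * h\<^sup>2"
      "fact (2 * 3) / ((2 / h) ^ 3 * fact 3) = 15 * h ^ 3" for h :: real
      by (simp_all add: fact_numeral power_divide)
    have "expectation (\<lambda>\<omega>. (B t \<omega> - B s \<omega>)\<^sup>2) = t - s"
      "expectation (\<lambda>\<omega>. (B t \<omega> - B s \<omega>) ^ 4) = 3 * (t - s)\<^sup>2"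
      "expectation (\<lambda>\<omega>. (B t \<omega> - B s \<omega>) ^ 6) = 15 * (t - s) ^ 3"
      using ev[of 1] ev[of 2] ev[of 3] unfolding f by simp_all
    then show ?thesis using i o by blast
  qed (auto simp: power_0_left)
  then show ?A ?B ?C ?D ?E by auto
qed

text \<open>These are the two cancellations of the one-step estimate: given the past, the increment
  has mean zero and its square has mean \<open>t - s\<close>.\<close>

lemma increment_orthogonal:
  assumes st: "0 \<le> s" "s \<le> t" "t \<le> T" and Z: "Z \<in> borel_measurable (F s)" "integrable M Z"
  shows "integrable M (\<lambda>\<omega>. Z \<omega> * (B t \<omega> - B s \<omega>))" (is ?A)
    and "expectation (\<lambda>\<omega>. Z \<omega> * (B t \<omega> - B s \<omega>)) = 0" (is ?B)
    and "integrable M (\<lambda>\<omega>. Z \<omega> * (B t \<omega> - B s \<omega>)\<^sup>2)" (is ?C)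
    and "expectation (\<lambda>\<omega>. Z \<omega> * (B t \<omega> - B s \<omega>)\<^sup>2) = expectation Z * (t - s)" (is ?D)
proof -
  have "?A \<and> ?B \<and> ?C \<and> ?D"
  proof (cases "s = t")
    case False
    then have lt: "s < t" using st by simp
    note i = increment_indep[OF st(1) lt st(3) Z] and m = increment_moments[OF st]
    show ?thesis
      using i[of "\<lambda>x. x"] i[of "\<lambda>x. x\<^sup>2"] m(1)[of 1] m(1)[of 2] m(2,3) by simp
  qed auto
  then show ?A ?B ?C ?D by auto
qed

text \<open>Boundedness makes the class closed under products and keeps products with any integrable
  variable integrable. It is also what is required of the coefficients of elementary
  processes.\<close>

definition bounded_meas :: "real \<Rightarrow> ('a \<Rightarrow> real) \<Rightarrow> bool" where
  "bounded_meas t Z \<longleftrightarrow> Z \<in> borel_measurable (F t) \<and> (\<exists>C. \<forall>\<omega>\<in>space M. \<bar>Z \<omega>\<bar> \<le> C)"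

lemma bounded_meas_integrable_mult:
  assumes "t \<in> {0..T}" "bounded_meas t Z" "integrable M Y"
  shows "integrable M (\<lambda>\<omega>. Z \<omega> * Y \<omega>)"
proof -
  obtain C where C: "\<And>\<omega>. \<omega> \<in> space M \<Longrightarrow> \<bar>Z \<omega>\<bar> \<le> C" using assms by (auto simp: bounded_meas_def)
  have [measurable]: "Z \<in> borel_measurable M" using assms by (auto simp: bounded_meas_def intro: measurable_F)
  have [measurable]: "Y \<in> borel_measurable M" using assms by auto
  show ?thesis
  proof (rule Bochner_Integration.integrable_bound)
    show "integrable M (\<lambda>\<omega>. C * Y \<omega>)" using assms by simp
    show "AE \<omega> in M. norm (Z \<omega> * Y \<omega>) \<le> norm (C * Y \<omega>)"
      using C by (intro AE_I2) (auto simp: abs_mult intro!: mult_right_mono order_trans[OF C])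
  qed measurable
qed

lemma bounded_meas_integrable:
  assumes "t \<in> {0..T}" "bounded_meas t Z" shows "integrable M Z"
  using bounded_meas_integrable_mult[OF assms, of "\<lambda>_. 1"] by simp

lemma bounded_meas_mono:
  "0 \<le> s \<Longrightarrow> s \<le> t \<Longrightarrow> t \<le> T \<Longrightarrow> bounded_meas s Z \<Longrightarrow> bounded_meas t Z"
  by (auto simp: bounded_meas_def intro: measurable_F_mono)

lemma bounded_meas_mult:
  assumes "bounded_meas t Z" "bounded_meas t Z'" shows "bounded_meas t (\<lambda>\<omega>. Z \<omega> * Z' \<omega>)"
proof -
  obtain C C' where "\<forall>\<omega>\<in>space M. \<bar>Z \<omega>\<bar> \<le> C" "\<forall>\<omega>\<in>space M. \<bar>Z' \<omega>\<bar> \<le> C'"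
    using assms by (auto simp: bounded_meas_def)
  then have "\<forall>\<omega>\<in>space M. \<bar>Z \<omega> * Z' \<omega>\<bar> \<le> C * C'"
    unfolding abs_mult by (meson abs_ge_zero mult_mono order_trans)
  then show ?thesis using assms by (auto simp: bounded_meas_def)
qed

lemma bounded_meas_const: "bounded_meas t (\<lambda>_. c)"
  by (auto simp: bounded_meas_def)

lemma integrable_mult_square:
  assumes [measurable]: "X \<in> borel_measurable M" "Y \<in> borel_measurable M"
    and "integrable M (\<lambda>\<omega>. (X \<omega>)\<^sup>2)" "integrable M (\<lambda>\<omega>. (Y \<omega>)\<^sup>2)"
  shows "integrable M (\<lambda>\<omega>. X \<omega> * Y \<omega> :: real)"
proof (rule Bochner_Integration.integrable_bound)
  show "integrable M (\<lambda>\<omega>. (X \<omega>)\<^sup>2 + (Y \<omega>)\<^sup>2)" using assms by simp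
  show "AE \<omega> in M. norm (X \<omega> * Y \<omega>) \<le> norm ((X \<omega>)\<^sup>2 + (Y \<omega>)\<^sup>2)"
  proof (rule AE_I2)
    fix \<omega>
    have "0 \<le> (\<bar>X \<omega>\<bar> - \<bar>Y \<omega>\<bar>)\<^sup>2" by simp
    then have "2 * \<bar>X \<omega> * Y \<omega>\<bar> \<le> (X \<omega>)\<^sup>2 + (Y \<omega>)\<^sup>2"
      by (simp add: power2_diff abs_mult mult.assoc)
    then show "norm (X \<omega> * Y \<omega>) \<le> norm ((X \<omega>)\<^sup>2 + (Y \<omega>)\<^sup>2)" by simp
  qed
qed measurable

text \<open>When the intervals overlap, both increments are split at \<open>c\<close> and at the end
  of the overlap. Every product of pieces over different intervals is a past factor times a later
  increment and has mean zero; what survives is the squared increment over the overlap, whose mean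
  is the length of the overlap.\<close>

lemma increment_product_expectation_aux:
  assumes ab: "0 \<le> a" "a \<le> b" "b \<le> T" and cd: "a \<le> c" "c \<le> d" "d \<le> T"
    and \<xi>: "bounded_meas a \<xi>" and \<eta>: "bounded_meas c \<eta>"
  shows "integrable M (\<lambda>\<omega>. (\<xi> \<omega> * (B b \<omega> - B a \<omega>)) * (\<eta> \<omega> * (B d \<omega> - B c \<omega>)))" (is ?A)
    and "expectation (\<lambda>\<omega>. (\<xi> \<omega> * (B b \<omega> - B a \<omega>)) * (\<eta> \<omega> * (B d \<omega> - B c \<omega>)))
      = expectation (\<lambda>\<omega>. \<xi> \<omega> * \<eta> \<omega>) * measure lborel ({a<..b} \<inter> {c<..d})" (is ?B)
proof -
  let ?D = "\<lambda>s t \<omega>. B t \<omega> - B s \<omega>"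
  have times: "a \<in> {0..T}" "b \<in> {0..T}" "c \<in> {0..T}" "d \<in> {0..T}" using ab cd by auto
  have \<xi>c: "bounded_meas c \<xi>" using ab cd \<xi> by (intro bounded_meas_mono[of a c]) auto
  note \<xi>\<eta> = bounded_meas_mult[OF \<xi>c \<eta>]
  have Z: "(\<lambda>\<omega>. \<xi> \<omega> * \<eta> \<omega> * ?D s t \<omega>) \<in> borel_measurable (F r)"
    "integrable M (\<lambda>\<omega>. \<xi> \<omega> * \<eta> \<omega> * ?D s t \<omega>)"
    if "0 \<le> s" "s \<le> t" "t \<le> r" "c \<le> r" "r \<le> T" for s t r
  proof -
    have [measurable]: "B s \<in> borel_measurable (F r)" "B t \<in> borel_measurable (F r)"
      using that by (auto intro: measurable_F_mono[OF _ _ _ adapted])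
    have [measurable]: "(\<lambda>\<omega>. \<xi> \<omega> * \<eta> \<omega>) \<in> borel_measurable (F r)"
      using \<xi>\<eta> that times by (auto simp: bounded_meas_def intro: measurable_F_mono[of c r])
    show "(\<lambda>\<omega>. \<xi> \<omega> * \<eta> \<omega> * ?D s t \<omega>) \<in> borel_measurable (F r)" by measurable
    show "integrable M (\<lambda>\<omega>. \<xi> \<omega> * \<eta> \<omega> * ?D s t \<omega>)"
      using increment_moments(1)[of s t 1] that times(3) by (intro bounded_meas_integrable_mult[OF _ \<xi>\<eta>]) auto
  qed
  have "?A \<and> ?B"
  proof (cases "b \<le> c")
    case True
    then have "{a<..b} \<inter> {c<..d} = {}" by auto
    then have m: "measure lborel ({a<..b} \<inter> {c<..d}) = 0" by (simp only: measure_empty)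
    have eq: "(\<xi> \<omega> * ?D a b \<omega>) * (\<eta> \<omega> * ?D c d \<omega>) = (\<xi> \<omega> * \<eta> \<omega> * ?D a b \<omega>) * ?D c d \<omega>" for \<omega>
      by (simp add: mult_ac)
    have "integrable M (\<lambda>\<omega>. (\<xi> \<omega> * \<eta> \<omega> * ?D a b \<omega>) * ?D c d \<omega>)"
      "expectation (\<lambda>\<omega>. (\<xi> \<omega> * \<eta> \<omega> * ?D a b \<omega>) * ?D c d \<omega>) = 0"
      using ab cd True times by (auto intro!: increment_orthogonal Z)
    then show ?thesis unfolding eq m by simp
  next
    case False
    \<comment> \<open>The overlap ends at \<open>e\<close>. As \<open>e\<close> equals
      \<open>b\<close> or \<open>d\<close>, one of the leftover increments from \<open>e\<close> to
      \<open>b\<close> and from \<open>e\<close> to \<open>d\<close> vanishes, and so does their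
      product.\<close>
    define e where "e = min b d"
    have e: "c \<le> e" "e \<le> b" "e \<le> d" "0 \<le> e" "e \<le> T" "e = b \<or> e = d"
      using False ab cd unfolding e_def by linarith+
    have "{a<..b} \<inter> {c<..d} = {c<..e}"
      unfolding greaterThanAtMost_def greaterThan_def atMost_def e_def using cd(1) by auto
    then have m: "measure lborel ({a<..b} \<inter> {c<..d}) = e - c" using e(1) by simp
    let ?t1 = "\<lambda>\<omega>. (\<xi> \<omega> * \<eta> \<omega> * ?D a c \<omega>) * ?D c d \<omega>"
    let ?t2 = "\<lambda>\<omega>. (\<xi> \<omega> * \<eta> \<omega>) * (?D c e \<omega>)\<^sup>2"
    let ?t3 = "\<lambda>\<omega>. (\<xi> \<omega> * \<eta> \<omega> * ?D c e \<omega>) * ?D e d \<omega>"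
    let ?t4 = "\<lambda>\<omega>. (\<xi> \<omega> * \<eta> \<omega> * ?D c e \<omega>) * ?D e b \<omega>"
    have i1: "integrable M ?t1" "expectation ?t1 = 0"
      by (rule increment_orthogonal; use e ab cd times in \<open>auto intro!: Z\<close>)+
    have i2: "integrable M ?t2" "expectation ?t2 = expectation (\<lambda>\<omega>. \<xi> \<omega> * \<eta> \<omega>) * (e - c)"
      using increment_orthogonal(3,4)[OF _ e(1,5), of "\<lambda>\<omega>. \<xi> \<omega> * \<eta> \<omega>"]
        \<xi>\<eta> bounded_meas_integrable[OF times(3) \<xi>\<eta>] times by (auto simp: bounded_meas_def)
    have i3: "integrable M ?t3" "expectation ?t3 = 0"
      by (rule increment_orthogonal; use e ab cd times in \<open>auto intro!: Z\<close>)+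
    have i4: "integrable M ?t4" "expectation ?t4 = 0"
      by (rule increment_orthogonal; use e ab cd times in \<open>auto intro!: Z\<close>)+
    have eq: "(\<xi> \<omega> * ?D a b \<omega>) * (\<eta> \<omega> * ?D c d \<omega>) = ?t1 \<omega> + (?t2 \<omega> + (?t3 \<omega> + ?t4 \<omega>))" for \<omega>
    proof -
      have z: "?D e b \<omega> * ?D e d \<omega> = 0" using e(6) by auto
      have "(\<xi> \<omega> * ?D a b \<omega>) * (\<eta> \<omega> * ?D c d \<omega>)
        = ?t1 \<omega> + (?t2 \<omega> + (?t3 \<omega> + ?t4 \<omega>)) + \<xi> \<omega> * \<eta> \<omega> * (?D e b \<omega> * ?D e d \<omega>)"
        by (simp add: power2_eq_square algebra_simps)
      then show ?thesis unfolding z by simp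
    qed
    show ?thesis unfolding eq m using i1 i2 i3 i4 by simp
  qed
  then show ?A ?B by auto
qed

lemma increment_product_expectation:
  assumes ab: "0 \<le> a" "a \<le> b" "b \<le> T" and cd: "0 \<le> c" "c \<le> d" "d \<le> T"
    and \<xi>: "bounded_meas a \<xi>" and \<eta>: "bounded_meas c \<eta>"
  shows "integrable M (\<lambda>\<omega>. (\<xi> \<omega> * (B b \<omega> - B a \<omega>)) * (\<eta> \<omega> * (B d \<omega> - B c \<omega>)))" (is ?A)
    and "expectation (\<lambda>\<omega>. (\<xi> \<omega> * (B b \<omega> - B a \<omega>)) * (\<eta> \<omega> * (B d \<omega> - B c \<omega>)))
      = expectation (\<lambda>\<omega>. \<xi> \<omega> * \<eta> \<omega>) * measure lborel ({a<..b} \<inter> {c<..d})" (is ?B)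
proof -
  have "?A \<and> ?B"
  proof (cases "a \<le> c")
    case True
    then show ?thesis using increment_product_expectation_aux[OF ab True cd(2,3) \<xi> \<eta>] by simp
  next
    case False
    then show ?thesis
      using increment_product_expectation_aux[OF cd _ ab(2,3) \<eta> \<xi>]
      by (simp add: mult.commute Int_commute)
  qed
  then show ?A ?B by auto
qed

section \<open>Simple integrals and their isometry\<close>

text \<open>The intervals need be neither ordered nor disjoint, so that sums of simple integrals do
  not require a common refinement.\<close>

inductive simple_integral :: "real \<Rightarrow> (real \<Rightarrow> 'a \<Rightarrow> real) \<Rightarrow> ('a \<Rightarrow> real) \<Rightarrow> bool" for s where
  zero: "simple_integral s (\<lambda>u \<omega>. 0) (\<lambda>\<omega>. 0)"
| add: "simple_integral s H J \<Longrightarrow> s \<le> a \<Longrightarrow> a \<le> b \<Longrightarrow> b \<le> T \<Longrightarrow> bounded_meas a \<xi> \<Longrightarrow>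
    simple_integral s (\<lambda>u \<omega>. H u \<omega> + \<xi> \<omega> * indicator {a<..b} u)
      (\<lambda>\<omega>. J \<omega> + \<xi> \<omega> * (B b \<omega> - B a \<omega>))"

lemma simple_integral_term:
  "s \<le> a \<Longrightarrow> a \<le> b \<Longrightarrow> b \<le> T \<Longrightarrow> bounded_meas a \<xi> \<Longrightarrow>
    simple_integral s (\<lambda>u \<omega>. \<xi> \<omega> * indicator {a<..b} u) (\<lambda>\<omega>. \<xi> \<omega> * (B b \<omega> - B a \<omega>))"
  using simple_integral.add[OF simple_integral.zero] by simp

lemma simple_integral_plus:
  assumes "simple_integral s H J" "simple_integral s H' J'"
  shows "simple_integral s (\<lambda>u \<omega>. H u \<omega> + H' u \<omega>) (\<lambda>\<omega>. J \<omega> + J' \<omega>)"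
  using assms(2)
proof induction
  case (add H' J' a b \<xi>)
  then show ?case using simple_integral.add[OF add.IH add.hyps(2-5)] by (simp add: add.assoc)
qed (use assms(1) in simp)

lemma simple_integral_uminus:
  assumes "simple_integral s H J"
  shows "simple_integral s (\<lambda>u \<omega>. - H u \<omega>) (\<lambda>\<omega>. - J \<omega>)"
  using assms
proof induction
  case (add H J a b \<xi>)
  have "bounded_meas a (\<lambda>\<omega>. - \<xi> \<omega>)" using add.hyps(5) bounded_meas_mult[OF bounded_meas_const[of a "-1"]] by force
  from simple_integral.add[OF add.IH add.hyps(2-4) this] show ?case by simp
qed (simp add: simple_integral.zero)

lemma simple_integral_minus:
  assumes "simple_integral s H J" "simple_integral s H' J'"
  shows "simple_integral s (\<lambda>u \<omega>. H u \<omega> - H' u \<omega>) (\<lambda>\<omega>. J \<omega> - J' \<omega>)"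
  using simple_integral_plus[OF assms(1) simple_integral_uminus[OF assms(2)]] by simp

lemma simple_integral_measurable:
  assumes "simple_integral s H J" "0 \<le> s"
  shows "(\<lambda>(u, \<omega>). H u \<omega>) \<in> borel_measurable (lborel \<Otimes>\<^sub>M M)" (is ?A) "J \<in> borel_measurable M" (is ?B)
proof -
  have "?A \<and> ?B"
    using assms(1)
  proof induction
    case (add H J a b \<xi>)
    have [measurable]: "\<xi> \<in> borel_measurable M" "B a \<in> borel_measurable M" "B b \<in> borel_measurable M"
      using add.hyps assms(2) by (auto simp: bounded_meas_def intro: measurable_F[of a] B_measurable)
    have [measurable]: "(\<lambda>(u, \<omega>). H u \<omega>) \<in> borel_measurable (lborel \<Otimes>\<^sub>M M)" "J \<in> borel_measurable M"
      using add.IH by auto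
    have "(\<lambda>(u, \<omega>). H u \<omega> + \<xi> \<omega> * indicator {a<..b} u) \<in> borel_measurable (lborel \<Otimes>\<^sub>M M)" by measurable
    then show ?case by simp
  qed simp
  then show ?A ?B by auto
qed

text \<open>The isometry is kept in polarised form: the relation is additive in each argument, which
  a statement about squares is not, and so it can be proved by induction. Integrability in time is
  demanded for every \<open>\<omega>\<close>, so that the inner integral is additive
  pointwise.\<close>

definition isometric :: "(real \<Rightarrow> 'a \<Rightarrow> real) \<Rightarrow> ('a \<Rightarrow> real) \<Rightarrow> (real \<Rightarrow> 'a \<Rightarrow> real) \<Rightarrow> ('a \<Rightarrow> real) \<Rightarrow> bool" where
  "isometric H J H' J' \<longleftrightarrow>
    (\<forall>\<omega>\<in>space M. integrable lborel (\<lambda>u. H u \<omega> * H' u \<omega>)) \<and>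
    integrable M (\<lambda>\<omega>. \<integral>u. H u \<omega> * H' u \<omega> \<partial>lborel) \<and>
    integrable M (\<lambda>\<omega>. J \<omega> * J' \<omega>) \<and>
    expectation (\<lambda>\<omega>. J \<omega> * J' \<omega>) = expectation (\<lambda>\<omega>. \<integral>u. H u \<omega> * H' u \<omega> \<partial>lborel)"

lemma isometric_commute: "isometric H J H' J' \<Longrightarrow> isometric H' J' H J"
  by (simp add: isometric_def mult.commute)

lemma isometric_add:
  assumes 1: "isometric H J K N" and 2: "isometric H' J' K N"
  shows "isometric (\<lambda>u \<omega>. H u \<omega> + H' u \<omega>) (\<lambda>\<omega>. J \<omega> + J' \<omega>) K N"
proof -
  have eq: "(\<integral>u. H u \<omega> * K u \<omega> + H' u \<omega> * K u \<omega> \<partial>lborel)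
    = (\<integral>u. H u \<omega> * K u \<omega> \<partial>lborel) + (\<integral>u. H' u \<omega> * K u \<omega> \<partial>lborel)" if "\<omega> \<in> space M" for \<omega>
    using 1 2 that by (intro Bochner_Integration.integral_add) (auto simp: isometric_def)
  have "integrable M (\<lambda>\<omega>. \<integral>u. H u \<omega> * K u \<omega> + H' u \<omega> * K u \<omega> \<partial>lborel)"
    using 1 2 by (subst Bochner_Integration.integrable_cong[OF refl eq]) (auto simp: isometric_def)
  moreover have "expectation (\<lambda>\<omega>. \<integral>u. H u \<omega> * K u \<omega> + H' u \<omega> * K u \<omega> \<partial>lborel)
    = expectation (\<lambda>\<omega>. (\<integral>u. H u \<omega> * K u \<omega> \<partial>lborel) + (\<integral>u. H' u \<omega> * K u \<omega> \<partial>lborel))"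
    by (rule Bochner_Integration.integral_cong[OF refl eq])
  ultimately show ?thesis using 1 2 by (simp add: isometric_def distrib_right)
qed

lemma isometric_term:
  assumes ab: "0 \<le> a" "a \<le> b" "b \<le> T" and cd: "0 \<le> c" "c \<le> d" "d \<le> T"
    and \<xi>: "bounded_meas a \<xi>" and \<eta>: "bounded_meas c \<eta>"
  shows "isometric (\<lambda>u \<omega>. \<xi> \<omega> * indicator {a<..b} u) (\<lambda>\<omega>. \<xi> \<omega> * (B b \<omega> - B a \<omega>))
    (\<lambda>u \<omega>. \<eta> \<omega> * indicator {c<..d} u) (\<lambda>\<omega>. \<eta> \<omega> * (B d \<omega> - B c \<omega>))"
proof -
  have eq: "(\<xi> \<omega> * indicator {a<..b} u) * (\<eta> \<omega> * indicator {c<..d} u)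
    = \<xi> \<omega> * \<eta> \<omega> * indicator ({a<..b} \<inter> {c<..d}) u" for u \<omega>
    by (simp add: indicator_def)
  have fin: "emeasure lborel ({a<..b} \<inter> {c<..d}) < \<infinity>"
    by (rule le_less_trans[OF emeasure_mono[of _ "{a<..b}"]]) (use ab in auto)
  have int: "integrable lborel (indicator ({a<..b} \<inter> {c<..d}) :: real \<Rightarrow> real)"
    using fin by (intro integrable_real_indicator) auto
  have "integrable M (\<lambda>\<omega>. \<xi> \<omega> * \<eta> \<omega>)"
    using ab cd \<xi> \<eta> by (intro bounded_meas_integrable_mult[of a] bounded_meas_integrable[of c]) auto
  then show ?thesis unfolding isometric_def eq
    using increment_product_expectation[OF assms] int by auto
qed

text \<open>By bilinearity the claim reduces to two single terms. The outer induction decomposes the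
  first integrand and the inner one the second; symmetry lets the same additivity lemma serve
  both.\<close>

lemma simple_integral_isometric:
  assumes "simple_integral s H J" "simple_integral s' H' J'" "0 \<le> s" "0 \<le> s'"
  shows "isometric H J H' J'"
  using assms(1)
proof induction
  case zero show ?case by (simp add: isometric_def)
next
  case (add H J a b \<xi>)
  have "isometric (\<lambda>u \<omega>. \<xi> \<omega> * indicator {a<..b} u) (\<lambda>\<omega>. \<xi> \<omega> * (B b \<omega> - B a \<omega>)) H' J'"
    using assms(2)
  proof induction
    case zero show ?case by (simp add: isometric_def)
  next
    case (add H' J' c d \<eta>)
    show ?case
      by (rule isometric_commute, rule isometric_add; rule isometric_commute)
        (use add \<open>s \<le> a\<close> \<open>a \<le> b\<close> \<open>b \<le> T\<close> \<open>bounded_meas a \<xi>\<close> assms(3,4) in \<open>auto intro: isometric_term\<close>)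
  qed
  then show ?case by (rule isometric_add[OF add.IH])
qed

text \<open>Stated with nonnegative integrals, the identity can be chained directly with the
  approximation errors, which are given as nonnegative integrals too.\<close>

lemma ito_isometry_simple:
  assumes "simple_integral s H J" "0 \<le> s"
  shows "(\<integral>\<^sup>+\<omega>. ennreal ((J \<omega>)\<^sup>2) \<partial>M) = (\<integral>\<^sup>+\<omega>. \<integral>\<^sup>+u. ennreal ((H u \<omega>)\<^sup>2) \<partial>lborel \<partial>M)"
    and "integrable M (\<lambda>\<omega>. (J \<omega>)\<^sup>2)"
proof -
  have i: "isometric H J H J" using simple_integral_isometric[OF assms(1) assms(1)] assms(2) by simp
  then show "integrable M (\<lambda>\<omega>. (J \<omega>)\<^sup>2)" by (simp add: isometric_def power2_eq_square)
  then have "(\<integral>\<^sup>+\<omega>. ennreal ((J \<omega>)\<^sup>2) \<partial>M) = ennreal (expectation (\<lambda>\<omega>. (J \<omega>)\<^sup>2))"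
    by (intro nn_integral_eq_integral) auto
  also have "\<dots> = ennreal (expectation (\<lambda>\<omega>. \<integral>u. (H u \<omega>)\<^sup>2 \<partial>lborel))"
    using i by (simp add: isometric_def power2_eq_square)
  also have "\<dots> = (\<integral>\<^sup>+\<omega>. ennreal (\<integral>u. (H u \<omega>)\<^sup>2 \<partial>lborel) \<partial>M)"
    using i by (intro nn_integral_eq_integral[symmetric])
      (auto simp: isometric_def power2_eq_square intro!: AE_I2 Bochner_Integration.integral_nonneg)
  also have "\<dots> = (\<integral>\<^sup>+\<omega>. \<integral>\<^sup>+u. ennreal ((H u \<omega>)\<^sup>2) \<partial>lborel \<partial>M)"
    using i by (intro nn_integral_cong nn_integral_eq_integral[symmetric])
      (auto simp: isometric_def power2_eq_square)
  finally show "(\<integral>\<^sup>+\<omega>. ennreal ((J \<omega>)\<^sup>2) \<partial>M) = (\<integral>\<^sup>+\<omega>. \<integral>\<^sup>+u. ennreal ((H u \<omega>)\<^sup>2) \<partial>lborel \<partial>M)" .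
qed

subsection \<open>Increments of Ito integrals\<close>

text \<open>All intervals begin at or after \<open>s\<close>, so \<open>Z\<close> can be absorbed
  into each coefficient without losing its measurability at the left end point. Each term is then a
  past factor times a centred increment.\<close>

lemma simple_integral_orthogonal:
  assumes "simple_integral s H J" "bounded_meas s Z" "0 \<le> s" "s \<le> T"
  shows "integrable M (\<lambda>\<omega>. Z \<omega> * J \<omega>)" (is ?A) "expectation (\<lambda>\<omega>. Z \<omega> * J \<omega>) = 0" (is ?B)
proof -
  have "?A \<and> ?B"
    using assms(1)
  proof induction
    case (add H J a b \<xi>)
    have Z\<xi>: "bounded_meas a (\<lambda>\<omega>. Z \<omega> * \<xi> \<omega>)"
      by (rule bounded_meas_mult[OF bounded_meas_mono[of s a]]) (use add.hyps assms in \<open>simp_all\<close>)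
    have "integrable M (\<lambda>\<omega>. Z \<omega> * \<xi> \<omega> * (B b \<omega> - B a \<omega>))"
      "expectation (\<lambda>\<omega>. Z \<omega> * \<xi> \<omega> * (B b \<omega> - B a \<omega>)) = 0"
      by (rule increment_orthogonal; use add.hyps assms Z\<xi> in
        \<open>auto simp: bounded_meas_def intro: bounded_meas_integrable[OF _ Z\<xi>]\<close>)+
    then show ?case using add.IH by (simp add: distrib_left mult.assoc)
  qed simp
  then show ?A ?B by auto
qed

text \<open>A term whose interval starts by time \<open>t\<close> is cut at \<open>t\<close>: its
  coefficient is known at \<open>a \<le> t\<close>, hence also at \<open>t\<close>, and remains
  admissible for the second piece. With \<open>min b t\<close> and \<open>max b t\<close> an
  interval that ends before \<open>t\<close> contributes an empty second piece.\<close>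

lemma simple_integral_split:
  assumes "simple_integral 0 H J" "0 \<le> t" "t \<le> T"
  shows "\<exists>J1 J2. simple_integral 0 (\<lambda>u \<omega>. H u \<omega> * indicator {..t} u) J1 \<and>
    simple_integral t (\<lambda>u \<omega>. H u \<omega> * indicator {t<..} u) J2 \<and> J = (\<lambda>\<omega>. J1 \<omega> + J2 \<omega>)"
  using assms(1)
proof induction
  case zero
  show ?case
    by (rule exI[of _ "\<lambda>_. 0"], rule exI[of _ "\<lambda>_. 0"]) (simp add: simple_integral.zero)
next
  case (add H J a b \<xi>)
  from add.IH obtain J1 J2 where J: "simple_integral 0 (\<lambda>u \<omega>. H u \<omega> * indicator {..t} u) J1"
    "simple_integral t (\<lambda>u \<omega>. H u \<omega> * indicator {t<..} u) J2" "J = (\<lambda>\<omega>. J1 \<omega> + J2 \<omega>)" by blast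
  show ?case
  proof (cases "a \<le> t")
    case True
    have "simple_integral 0 (\<lambda>u \<omega>. H u \<omega> * indicator {..t} u + \<xi> \<omega> * indicator {a<..min b t} u)
      (\<lambda>\<omega>. J1 \<omega> + \<xi> \<omega> * (B (min b t) \<omega> - B a \<omega>))"
      using True add.hyps by (intro simple_integral.add[OF J(1)]) auto
    moreover have "H u \<omega> * indicator {..t} u + \<xi> \<omega> * indicator {a<..min b t} u
      = (H u \<omega> + \<xi> \<omega> * indicator {a<..b} u) * indicator {..t} u" for u \<omega>
      by (auto simp: indicator_def)
    moreover have "simple_integral t (\<lambda>u \<omega>. H u \<omega> * indicator {t<..} u + \<xi> \<omega> * indicator {t<..max b t} u)
      (\<lambda>\<omega>. J2 \<omega> + \<xi> \<omega> * (B (max b t) \<omega> - B t \<omega>))"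
      using True add.hyps assms(2,3) by (intro simple_integral.add[OF J(2)]) (auto intro: bounded_meas_mono[of a t])
    moreover have "H u \<omega> * indicator {t<..} u + \<xi> \<omega> * indicator {t<..max b t} u
      = (H u \<omega> + \<xi> \<omega> * indicator {a<..b} u) * indicator {t<..} u" for u \<omega>
      using True by (auto simp: indicator_def)
    moreover have "(\<lambda>\<omega>. J \<omega> + \<xi> \<omega> * (B b \<omega> - B a \<omega>)) = (\<lambda>\<omega>. (J1 \<omega> + \<xi> \<omega> * (B (min b t) \<omega> - B a \<omega>))
      + (J2 \<omega> + \<xi> \<omega> * (B (max b t) \<omega> - B t \<omega>)))"
      by (auto simp: J(3) min_def max_def algebra_simps fun_eq_iff)
    ultimately show ?thesis
      by (intro exI[of _ "\<lambda>\<omega>. J1 \<omega> + \<xi> \<omega> * (B (min b t) \<omega> - B a \<omega>)"]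
        exI[of _ "\<lambda>\<omega>. J2 \<omega> + \<xi> \<omega> * (B (max b t) \<omega> - B t \<omega>)"] conjI) simp_all
  next
    case False
    have "(\<lambda>u \<omega>. H u \<omega> * indicator {..t} u) = (\<lambda>u \<omega>. (H u \<omega> + \<xi> \<omega> * indicator {a<..b} u) * indicator {..t} u)"
      using False by (auto simp: indicator_def fun_eq_iff)
    moreover have "simple_integral t (\<lambda>u \<omega>. H u \<omega> * indicator {t<..} u + \<xi> \<omega> * indicator {a<..b} u)
      (\<lambda>\<omega>. J2 \<omega> + \<xi> \<omega> * (B b \<omega> - B a \<omega>))"
      using False add.hyps by (intro simple_integral.add[OF J(2)]) auto
    moreover have "H u \<omega> * indicator {t<..} u + \<xi> \<omega> * indicator {a<..b} u
      = (H u \<omega> + \<xi> \<omega> * indicator {a<..b} u) * indicator {t<..} u" for u \<omega>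
      using False by (auto simp: indicator_def)
    ultimately show ?thesis using J
      by (intro exI[of _ J1] exI[of _ "\<lambda>\<omega>. J2 \<omega> + \<xi> \<omega> * (B b \<omega> - B a \<omega>)"]) (simp add: add.assoc)
  qed
qed


abbreviation (input) "sq_dist S H K \<equiv>
  (\<integral>\<^sup>+\<omega>. (\<integral>\<^sup>+u\<in>S. ennreal ((H u \<omega> - K u \<omega>)\<^sup>2) \<partial>lborel) \<partial>M)"

abbreviation (input) "mean_sq_dist J I \<equiv> (\<integral>\<^sup>+\<omega>. ennreal ((J \<omega> - I \<omega>)\<^sup>2) \<partial>M)"

text \<open>The approximating sequences are replaced by a choice for every
  \<open>\<epsilon>\<close>, which makes it easy to combine the approximations for two times. The
  approximants vanish off \<open>{0..t}\<close>, so that their differences can be estimated over the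
  whole line, where the isometry is stated.\<close>

definition ito_limit :: "(real \<Rightarrow> 'a \<Rightarrow> real) \<Rightarrow> real \<Rightarrow> ('a \<Rightarrow> real) \<Rightarrow> bool" where
  "ito_limit H t I \<longleftrightarrow> I \<in> borel_measurable M \<and> (\<forall>\<epsilon>>0. \<exists>H0 J. simple_integral 0 H0 J \<and>
    (\<forall>u \<omega>. u \<notin> {0..t} \<longrightarrow> H0 u \<omega> = 0) \<and>
    sq_dist {0..t} H0 H \<le> ennreal \<epsilon> \<and>
    mean_sq_dist J I \<le> ennreal \<epsilon>)"

lemma elementary_simple_integral:
  assumes "elementary_data M F t k \<tau> \<xi>" "t \<le> T"
  shows "simple_integral 0 (elementary_process k \<tau> \<xi>) (elementary_integral B k \<tau> \<xi>)"
    and "u \<notin> {0..t} \<Longrightarrow> elementary_process k \<tau> \<xi> u \<omega> = 0"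
proof -
  have 0: "0 \<le> \<tau> 0" "\<tau> k \<le> t" and step: "\<And>j. j < k \<Longrightarrow> \<tau> j \<le> \<tau> (Suc j)"
    and bm: "\<And>j. j < k \<Longrightarrow> bounded_meas (\<tau> j) (\<xi> j)"
    using assms(1) unfolding elementary_data_def bounded_meas_def by (auto, blast)
  have lo: "0 \<le> \<tau> j" if "j \<le> k" for j
    using that
  proof (induction j)
    case (Suc j)
    then show ?case using step[of j] by simp
  qed (rule 0)
  have hi: "\<tau> j \<le> t" if "j \<le> k" for j
    using that
  proof (induction j rule: inc_induct)
    case (step n)
    then show ?case using assms(1) by (auto simp: elementary_data_def intro: order_trans)
  qed (rule 0)
  have "simple_integral 0 (elementary_process n \<tau> \<xi>) (elementary_integral B n \<tau> \<xi>)" if "n \<le> k" for n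
    using that
  proof (induction n)
    case 0
    then show ?case by (simp add: elementary_process_def elementary_integral_def simple_integral.zero)
  next
    case (Suc n)
    have "simple_integral 0 (\<lambda>u \<omega>. elementary_process n \<tau> \<xi> u \<omega> + \<xi> n \<omega> * indicator {\<tau> n<..\<tau> (Suc n)} u)
      (\<lambda>\<omega>. elementary_integral B n \<tau> \<xi> \<omega> + \<xi> n \<omega> * (B (\<tau> (Suc n)) \<omega> - B (\<tau> n) \<omega>))"
    proof (rule simple_integral.add)
      show "0 \<le> \<tau> n" "\<tau> n \<le> \<tau> (Suc n)" "bounded_meas (\<tau> n) (\<xi> n)"
        using Suc.prems lo[of n] step[of n] bm[of n] by auto
      show "\<tau> (Suc n) \<le> T" using hi[of "Suc n"] Suc.prems assms(2) by simp
    qed (use Suc in simp)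
    then show ?case by (simp add: elementary_process_def elementary_integral_def)
  qed
  then show "simple_integral 0 (elementary_process k \<tau> \<xi>) (elementary_integral B k \<tau> \<xi>)" by simp
  assume u: "u \<notin> {0..t}"
  have "indicator {\<tau> j<..\<tau> (Suc j)} u = (0::real)" if "j < k" for j
    using u lo[of j] hi[of "Suc j"] that by (auto simp: indicator_def)
  then show "elementary_process k \<tau> \<xi> u \<omega> = 0" by (simp add: elementary_process_def)
qed

text \<open>The limit tolerates a change of integrand and integral on a null set. It is the
  exceptional set common to all times that makes the inner time integrals coincide; this transfers
  the equation to a regular modification of the solution.\<close>

lemma has_ito_integral_imp_ito_limit:
  assumes ito: "has_ito_integral M F B H t I" and t: "t \<le> T"
    and H: "AE \<omega> in M. \<forall>u\<in>{0..t}. H' u \<omega> = H u \<omega>" and I: "AE \<omega> in M. I' \<omega> = I \<omega>"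
    and meas: "I' \<in> borel_measurable M"
  shows "ito_limit H' t I'"
  unfolding ito_limit_def
proof (intro conjI allI impI meas)
  fix \<epsilon> :: real assume "0 < \<epsilon>"
  from ito obtain k \<tau> \<xi> where data: "\<And>m. elementary_data M F t (k m) (\<tau> m) (\<xi> m)"
    and lim1: "(\<lambda>m::nat. sq_dist {0..t} (elementary_process (k m) (\<tau> m) (\<xi> m)) H) \<longlonglongrightarrow> 0"
    and lim2: "(\<lambda>m. mean_sq_dist (elementary_integral B (k m) (\<tau> m) (\<xi> m)) I) \<longlonglongrightarrow> 0"
    unfolding has_ito_integral_def by blast
  define H0 J where "H0 m = elementary_process (k m) (\<tau> m) (\<xi> m)"
    and "J m = elementary_integral B (k m) (\<tau> m) (\<xi> m)" for m
  have e: "0 < ennreal \<epsilon>" using \<open>0 < \<epsilon>\<close> by simp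
  have "eventually (\<lambda>m. sq_dist {0..t} (H0 m) H < ennreal \<epsilon> \<and> mean_sq_dist (J m) I < ennreal \<epsilon>) sequentially"
    using order_tendstoD(2)[OF lim1 e] order_tendstoD(2)[OF lim2 e] unfolding H0_def J_def
    by eventually_elim simp
  then obtain m where m: "sq_dist {0..t} (H0 m) H < ennreal \<epsilon>" "mean_sq_dist (J m) I < ennreal \<epsilon>"
    by (metis (mono_tags, lifting) eventually_happens trivial_limit_sequentially)
  have "sq_dist {0..t} (H0 m) H' = sq_dist {0..t} (H0 m) H"
    by (rule nn_integral_cong_AE, use H in eventually_elim, rule nn_integral_cong)
      (simp add: indicator_def)
  moreover have "mean_sq_dist (J m) I' = mean_sq_dist (J m) I"
    by (rule nn_integral_cong_AE, use I in eventually_elim, simp)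
  ultimately show "\<exists>H0 J. simple_integral 0 H0 J \<and> (\<forall>u \<omega>. u \<notin> {0..t} \<longrightarrow> H0 u \<omega> = 0) \<and>
    sq_dist {0..t} H0 H' \<le> ennreal \<epsilon> \<and> mean_sq_dist J I' \<le> ennreal \<epsilon>"
    using elementary_simple_integral[OF data[of m] t] m
    by (intro exI[of _ "H0 m"] exI[of _ "J m"]) (auto simp: H0_def J_def)
qed

lemma ito_limitE:
  assumes "ito_limit H t I" "0 < \<epsilon>"
  obtains H0 J where "simple_integral 0 H0 J" "\<And>u \<omega>. u \<notin> {0..t} \<Longrightarrow> H0 u \<omega> = 0"
    "sq_dist {0..t} H0 H \<le> ennreal \<epsilon>"
    "mean_sq_dist J I \<le> ennreal \<epsilon>"
  using assms(1)[unfolded ito_limit_def, THEN conjunct2, rule_format, OF assms(2)]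
  by (elim exE conjE) (rule that, auto)

text \<open>Cutting the approximating simple integrand at \<open>t\<close> approximates the increment by simple
  integrals that start at \<open>t\<close>.\<close>

lemma ito_limit_increment_approx:
  assumes 1: "ito_limit H t I" and 2: "ito_limit H t' I'" and tt: "0 \<le> t" "t \<le> t'" "t' \<le> T"
    and H[measurable]: "(\<lambda>(u, \<omega>). H u \<omega>) \<in> borel_measurable (lborel \<Otimes>\<^sub>M M)" and \<delta>: "0 < \<delta>"
  obtains H2 K2 where "simple_integral t H2 K2"
    and "(\<integral>\<^sup>+\<omega>. ennreal ((I' \<omega> - I \<omega> - K2 \<omega>)\<^sup>2) \<partial>M) \<le> ennreal \<delta>"
    and "(\<integral>\<^sup>+\<omega>. (\<integral>\<^sup>+u. ennreal ((H2 u \<omega> - H u \<omega> * indicator {t<..t'} u)\<^sup>2) \<partial>lborel) \<partial>M) \<le> ennreal \<delta>"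
proof -
  \<comment> \<open>The final estimate of the integral error is \<open>3 * \<epsilon> + 3 *
    \<epsilon> + 3 * (2 * \<epsilon> + 2 * \<epsilon>) = 18 * \<epsilon>\<close>.\<close>
  define \<epsilon> where "\<epsilon> = \<delta> / 18"
  have \<epsilon>: "0 < \<epsilon>" "0 \<le> \<epsilon>" using \<delta> by (auto simp: \<epsilon>_def)
  obtain H0 J where H0: "simple_integral 0 H0 J" "\<And>u \<omega>. u \<notin> {0..t} \<Longrightarrow> H0 u \<omega> = 0"
    "sq_dist {0..t} H0 H \<le> ennreal \<epsilon>"
    "mean_sq_dist J I \<le> ennreal \<epsilon>"
    by (rule ito_limitE[OF 1 \<epsilon>(1)]) (rule that, assumption+)
  obtain H1 K where H1: "simple_integral 0 H1 K" "\<And>u \<omega>. u \<notin> {0..t'} \<Longrightarrow> H1 u \<omega> = 0"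
    "sq_dist {0..t'} H1 H \<le> ennreal \<epsilon>"
    "mean_sq_dist K I' \<le> ennreal \<epsilon>"
    by (rule ito_limitE[OF 2 \<epsilon>(1)]) (rule that, assumption+)
  have tT: "t \<le> T" using tt by simp
  obtain K1 K2 where K: "simple_integral 0 (\<lambda>u \<omega>. H1 u \<omega> * indicator {..t} u) K1"
    "simple_integral t (\<lambda>u \<omega>. H1 u \<omega> * indicator {t<..} u) K2" "K = (\<lambda>\<omega>. K1 \<omega> + K2 \<omega>)"
    using simple_integral_split[OF H1(1) tt(1) tT] by blast
  have [measurable]: "I \<in> borel_measurable M" "I' \<in> borel_measurable M"
    using 1 2 by (auto simp: ito_limit_def)
  note [measurable] = simple_integral_measurable[OF H0(1) order_refl] simple_integral_measurable[OF H1(1) order_refl]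
    simple_integral_measurable[OF K(1) order_refl] simple_integral_measurable[OF K(2) tt(1)]
  \<comment> \<open>The approximants for \<open>t\<close> and for \<open>t'\<close> are chosen
    independently of each other. On \<open>{0..t}\<close> both are close to \<open>H\<close>, and
    off it \<open>S\<close> vanishes; the isometry therefore makes the early part \<open>K1\<close>
    of the integral for \<open>t'\<close> close to \<open>J\<close>, hence to
    \<open>I\<close>.\<close>
  define S where "S u \<omega> = H1 u \<omega> * indicator {..t} u - H0 u \<omega>" for u \<omega>
  define N where "N \<omega> = K1 \<omega> - J \<omega>" for \<omega>
  have SN: "simple_integral 0 S N"
    unfolding S_def N_def by (intro simple_integral_minus H0(1) K(1))
  note [measurable] = simple_integral_measurable[OF SN order_refl]
  have "(\<integral>\<^sup>+\<omega>. ennreal ((N \<omega>)\<^sup>2) \<partial>M) = (\<integral>\<^sup>+\<omega>. \<integral>\<^sup>+u. ennreal ((S u \<omega>)\<^sup>2) \<partial>lborel \<partial>M)"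
    by (rule ito_isometry_simple[OF SN order_refl])
  also have "\<dots> \<le> (\<integral>\<^sup>+\<omega>. 2 * (\<integral>\<^sup>+u\<in>{0..t'}. ennreal ((H1 u \<omega> - H u \<omega>)\<^sup>2) \<partial>lborel)
      + 2 * (\<integral>\<^sup>+u\<in>{0..t}. ennreal ((H0 u \<omega> - H u \<omega>)\<^sup>2) \<partial>lborel) \<partial>M)"
  proof (rule nn_integral_mono)
    fix \<omega> assume [measurable]: "\<omega> \<in> space M"
    have "(\<integral>\<^sup>+u. ennreal ((S u \<omega>)\<^sup>2) \<partial>lborel) \<le>
      (\<integral>\<^sup>+u. 2 * (ennreal ((H1 u \<omega> - H u \<omega>)\<^sup>2) * indicator {0..t'} u)
        + 2 * (ennreal ((H0 u \<omega> - H u \<omega>)\<^sup>2) * indicator {0..t} u) \<partial>lborel)"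
    proof (rule nn_integral_mono)
      fix u
      have "(S u \<omega>)\<^sup>2 \<le> 2 * ((H1 u \<omega> - H u \<omega>)\<^sup>2 * indicator {0..t'} u)
        + 2 * ((H0 u \<omega> - H u \<omega>)\<^sup>2 * indicator {0..t} u)"
      proof (cases "u \<in> {0..t}")
        case False
        then have "S u \<omega> = 0" using H0(2)[of u \<omega>] H1(2)[of u \<omega>] tt by (auto simp: S_def indicator_def)
        then show ?thesis by simp
      next
        case True
        then have "S u \<omega> = (H1 u \<omega> - H u \<omega>) + (- (H0 u \<omega> - H u \<omega>))" by (simp add: S_def)
        then have "(S u \<omega>)\<^sup>2 \<le> 2 * (H1 u \<omega> - H u \<omega>)\<^sup>2 + 2 * (- (H0 u \<omega> - H u \<omega>))\<^sup>2"
          by (metis square_add2_le)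
        then show ?thesis using True tt unfolding power2_minus by (simp add: power2_commute)
      qed
      then have "ennreal ((S u \<omega>)\<^sup>2) \<le> ennreal (2 * ((H1 u \<omega> - H u \<omega>)\<^sup>2 * indicator {0..t'} u)
        + 2 * ((H0 u \<omega> - H u \<omega>)\<^sup>2 * indicator {0..t} u))" by (rule ennreal_leI)
      also have "\<dots> = 2 * (ennreal ((H1 u \<omega> - H u \<omega>)\<^sup>2) * indicator {0..t'} u)
        + 2 * (ennreal ((H0 u \<omega> - H u \<omega>)\<^sup>2) * indicator {0..t} u)"
        by (simp add: ennreal_plus ennreal_mult ennreal_indicator)
      finally show "ennreal ((S u \<omega>)\<^sup>2) \<le> 2 * (ennreal ((H1 u \<omega> - H u \<omega>)\<^sup>2) * indicator {0..t'} u)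
        + 2 * (ennreal ((H0 u \<omega> - H u \<omega>)\<^sup>2) * indicator {0..t} u)" .
    qed
    also have "\<dots> = 2 * (\<integral>\<^sup>+u\<in>{0..t'}. ennreal ((H1 u \<omega> - H u \<omega>)\<^sup>2) \<partial>lborel)
      + 2 * (\<integral>\<^sup>+u\<in>{0..t}. ennreal ((H0 u \<omega> - H u \<omega>)\<^sup>2) \<partial>lborel)"
      by (subst nn_integral_add, measurable)+ (simp add: nn_integral_cmult)
    finally show "(\<integral>\<^sup>+u. ennreal ((S u \<omega>)\<^sup>2) \<partial>lborel) \<le> \<dots>" .
  qed
  also have "\<dots> = 2 * sq_dist {0..t'} H1 H
      + 2 * sq_dist {0..t} H0 H"
    by (subst nn_integral_add, measurable)+ (simp add: nn_integral_cmult)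
  also have "\<dots> \<le> 2 * ennreal \<epsilon> + 2 * ennreal \<epsilon>"
    using H0(3) H1(3) by (intro add_mono mult_left_mono) auto
  finally have N: "(\<integral>\<^sup>+\<omega>. ennreal ((N \<omega>)\<^sup>2) \<partial>M) \<le> 2 * ennreal \<epsilon> + 2 * ennreal \<epsilon>" .
  define D where "D \<omega> = I' \<omega> - I \<omega> - K2 \<omega>" for \<omega>
  have [measurable]: "D \<in> borel_measurable M" unfolding D_def by measurable
  have "(\<integral>\<^sup>+\<omega>. ennreal ((D \<omega>)\<^sup>2) \<partial>M)
    \<le> (\<integral>\<^sup>+\<omega>. 3 * ennreal ((K \<omega> - I' \<omega>)\<^sup>2) + 3 * ennreal ((J \<omega> - I \<omega>)\<^sup>2) + 3 * ennreal ((N \<omega>)\<^sup>2) \<partial>M)"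
  proof (rule nn_integral_mono)
    fix \<omega>
    have "D \<omega> = (I' \<omega> - K \<omega>) + (J \<omega> - I \<omega>) + N \<omega>"
      by (simp add: N_def D_def K(3))
    then have "(D \<omega>)\<^sup>2 \<le> 3 * (K \<omega> - I' \<omega>)\<^sup>2 + 3 * (J \<omega> - I \<omega>)\<^sup>2 + 3 * (N \<omega>)\<^sup>2"
      by (metis square_add3_le power2_commute)
    then have "ennreal ((D \<omega>)\<^sup>2) \<le> ennreal (3 * (K \<omega> - I' \<omega>)\<^sup>2 + 3 * (J \<omega> - I \<omega>)\<^sup>2 + 3 * (N \<omega>)\<^sup>2)"
      by (rule ennreal_leI)
    then show "ennreal ((D \<omega>)\<^sup>2)
      \<le> 3 * ennreal ((K \<omega> - I' \<omega>)\<^sup>2) + 3 * ennreal ((J \<omega> - I \<omega>)\<^sup>2) + 3 * ennreal ((N \<omega>)\<^sup>2)"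
      by (simp add: ennreal_plus ennreal_mult)
  qed
  also have "\<dots> = 3 * mean_sq_dist K I' + 3 * mean_sq_dist J I
      + 3 * (\<integral>\<^sup>+\<omega>. ennreal ((N \<omega>)\<^sup>2) \<partial>M)"
    by (subst nn_integral_add, measurable)+ (simp add: nn_integral_cmult)
  also have "\<dots> \<le> 3 * ennreal \<epsilon> + 3 * ennreal \<epsilon> + 3 * (2 * ennreal \<epsilon> + 2 * ennreal \<epsilon>)"
    using H0(4) H1(4) N by (intro add_mono mult_left_mono) auto
  also have "\<dots> = ennreal \<delta>"
    using \<delta> unfolding \<epsilon>_def by (simp flip: ennreal_numeral ennreal_mult ennreal_plus)
  finally have D2: "(\<integral>\<^sup>+\<omega>. ennreal ((D \<omega>)\<^sup>2) \<partial>M) \<le> ennreal \<delta>" .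
  have "(\<integral>\<^sup>+\<omega>. (\<integral>\<^sup>+u. ennreal ((H1 u \<omega> * indicator {t<..} u - H u \<omega> * indicator {t<..t'} u)\<^sup>2) \<partial>lborel) \<partial>M)
    \<le> sq_dist {0..t'} H1 H"
    using tt H1(2) by (intro nn_integral_mono) (auto simp: indicator_def)
  also have "\<dots> \<le> ennreal \<epsilon>" by (rule H1(3))
  also have "\<dots> \<le> ennreal \<delta>" using \<delta> by (intro ennreal_leI) (simp add: \<epsilon>_def)
  finally show ?thesis using D2 K(2) unfolding D_def by (intro that)
qed

text \<open>\<open>Z * (B t' - B t)\<close> is the integral of an integrand frozen at time
  \<open>t\<close>, so the isometry applies to its difference from the approximant. Squares of sums
  are split twice, which gives the factor \<open>4\<close>; the approximation errors enter with
  factors \<open>2\<close> and \<open>4\<close>, hence the choice \<open>e / 6\<close>. With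
  \<open>Z = 0\<close> this is a second moment bound for the increment itself.\<close>

lemma ito_limit_increment_bound:
  assumes 1: "ito_limit H t I" and 2: "ito_limit H t' I'" and tt: "0 \<le> t" "t \<le> t'" "t' \<le> T"
    and Z: "bounded_meas t Z" and H[measurable]: "(\<lambda>(u, \<omega>). H u \<omega>) \<in> borel_measurable (lborel \<Otimes>\<^sub>M M)"
  shows "(\<integral>\<^sup>+\<omega>. ennreal ((I' \<omega> - I \<omega> - Z \<omega> * (B t' \<omega> - B t \<omega>))\<^sup>2) \<partial>M)
    \<le> 4 * (\<integral>\<^sup>+\<omega>. (\<integral>\<^sup>+u\<in>{t<..t'}. ennreal ((H u \<omega> - Z \<omega>)\<^sup>2) \<partial>lborel) \<partial>M)" (is "?L \<le> 4 * ?V")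
proof (rule ennreal_le_epsilon)
  fix e :: real assume e: "0 < e"
  have e6: "0 < e / 6" using e by simp
  obtain H2 K2 where K: "simple_integral t H2 K2"
    "(\<integral>\<^sup>+\<omega>. ennreal ((I' \<omega> - I \<omega> - K2 \<omega>)\<^sup>2) \<partial>M) \<le> ennreal (e / 6)"
    "(\<integral>\<^sup>+\<omega>. (\<integral>\<^sup>+u. ennreal ((H2 u \<omega> - H u \<omega> * indicator {t<..t'} u)\<^sup>2) \<partial>lborel) \<partial>M) \<le> ennreal (e / 6)"
    by (rule ito_limit_increment_approx[OF 1 2 tt H e6])
  have [measurable]: "I \<in> borel_measurable M" "I' \<in> borel_measurable M"
    using 1 2 by (auto simp: ito_limit_def)
  have [measurable]: "Z \<in> borel_measurable M" using Z tt by (auto simp: bounded_meas_def intro: measurable_F[of t])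
  define S where "S u \<omega> = H2 u \<omega> - Z \<omega> * indicator {t<..t'} u" for u \<omega>
  define N where "N \<omega> = K2 \<omega> - Z \<omega> * (B t' \<omega> - B t \<omega>)" for \<omega>
  have SN: "simple_integral t S N"
    unfolding S_def N_def using tt Z by (intro simple_integral_minus K(1) simple_integral_term) auto
  note [measurable] = simple_integral_measurable[OF K(1) tt(1)] simple_integral_measurable[OF SN tt(1)]
  have ennreal_le: "ennreal (c\<^sup>2) \<le> 2 * ennreal (a\<^sup>2) + 2 * ennreal (b\<^sup>2)" if "c = a + b" for a b c :: real
    using ennreal_leI[OF square_add2_le[of a b]] that by (simp add: ennreal_plus ennreal_mult)
  have "(\<integral>\<^sup>+\<omega>. ennreal ((N \<omega>)\<^sup>2) \<partial>M) = (\<integral>\<^sup>+\<omega>. \<integral>\<^sup>+u. ennreal ((S u \<omega>)\<^sup>2) \<partial>lborel \<partial>M)"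
    by (rule ito_isometry_simple[OF SN tt(1)])
  also have "\<dots> \<le> (\<integral>\<^sup>+\<omega>. \<integral>\<^sup>+u. 2 * ennreal ((H2 u \<omega> - H u \<omega> * indicator {t<..t'} u)\<^sup>2)
      + 2 * (ennreal ((H u \<omega> - Z \<omega>)\<^sup>2) * indicator {t<..t'} u) \<partial>lborel \<partial>M)"
  proof (intro nn_integral_mono)
    fix u \<omega>
    have "ennreal ((S u \<omega>)\<^sup>2) \<le> 2 * ennreal ((H2 u \<omega> - H u \<omega> * indicator {t<..t'} u)\<^sup>2)
      + 2 * ennreal (((H u \<omega> - Z \<omega>) * indicator {t<..t'} u)\<^sup>2)"
      by (rule ennreal_le) (simp add: S_def algebra_simps)
    then show "ennreal ((S u \<omega>)\<^sup>2) \<le> 2 * ennreal ((H2 u \<omega> - H u \<omega> * indicator {t<..t'} u)\<^sup>2)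
      + 2 * (ennreal ((H u \<omega> - Z \<omega>)\<^sup>2) * indicator {t<..t'} u)"
      by (auto simp: indicator_def)
  qed
  also have "\<dots> = (\<integral>\<^sup>+\<omega>. 2 * (\<integral>\<^sup>+u. ennreal ((H2 u \<omega> - H u \<omega> * indicator {t<..t'} u)\<^sup>2) \<partial>lborel)
      + 2 * (\<integral>\<^sup>+u\<in>{t<..t'}. ennreal ((H u \<omega> - Z \<omega>)\<^sup>2) \<partial>lborel) \<partial>M)"
    by (intro nn_integral_cong) (subst nn_integral_add, measurable, simp add: nn_integral_cmult)
  also have "\<dots> = 2 * (\<integral>\<^sup>+\<omega>. (\<integral>\<^sup>+u. ennreal ((H2 u \<omega> - H u \<omega> * indicator {t<..t'} u)\<^sup>2) \<partial>lborel) \<partial>M) + 2 * ?V"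
    by (subst nn_integral_add, measurable) (simp add: nn_integral_cmult)
  also have "\<dots> \<le> 2 * ennreal (e / 6) + 2 * ?V"
    by (intro add_right_mono mult_left_mono K(3)) simp
  finally have N: "(\<integral>\<^sup>+\<omega>. ennreal ((N \<omega>)\<^sup>2) \<partial>M) \<le> 2 * ennreal (e / 6) + 2 * ?V" .
  have "?L \<le> (\<integral>\<^sup>+\<omega>. 2 * ennreal ((I' \<omega> - I \<omega> - K2 \<omega>)\<^sup>2) + 2 * ennreal ((N \<omega>)\<^sup>2) \<partial>M)"
    by (intro nn_integral_mono ennreal_le) (simp add: N_def)
  also have "\<dots> = 2 * (\<integral>\<^sup>+\<omega>. ennreal ((I' \<omega> - I \<omega> - K2 \<omega>)\<^sup>2) \<partial>M) + 2 * (\<integral>\<^sup>+\<omega>. ennreal ((N \<omega>)\<^sup>2) \<partial>M)"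
    by (subst nn_integral_add, measurable) (simp add: nn_integral_cmult)
  also have "\<dots> \<le> 2 * ennreal (e / 6) + 2 * (2 * ennreal (e / 6) + 2 * ?V)"
    by (intro add_mono mult_left_mono K(2) N) simp_all
  also have "\<dots> = 4 * ?V + (2 * ennreal (e / 6) + 4 * ennreal (e / 6))"
    by (simp add: distrib_left ac_simps flip: mult.assoc)
  also have "2 * ennreal (e / 6) + 4 * ennreal (e / 6) = ennreal e"
    using e by (simp flip: ennreal_numeral ennreal_mult ennreal_plus)
  finally show "?L \<le> 4 * ?V + ennreal e" .
qed

text \<open>For the approximant the expectation vanishes exactly, so only the effect of the
  approximation error \<open>D\<close> is left. It is controlled by its second moment, through a
  weighted bound of \<open>|D|\<close> by a constant and \<open>D\<^sup>2\<close>.\<close>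

lemma ito_limit_orthogonal:
  assumes 1: "ito_limit H t I" and 2: "ito_limit H t' I'" and tt: "0 \<le> t" "t \<le> t'" "t' \<le> T"
    and Z: "bounded_meas t Z" and H[measurable]: "(\<lambda>(u, \<omega>). H u \<omega>) \<in> borel_measurable (lborel \<Otimes>\<^sub>M M)"
    and int: "integrable M (\<lambda>\<omega>. I' \<omega> - I \<omega>)"
  shows "expectation (\<lambda>\<omega>. Z \<omega> * (I' \<omega> - I \<omega>)) = 0"
proof -
  have t: "t \<in> {0..T}" and tT: "t \<le> T" using tt by auto
  obtain C0 where "\<And>\<omega>. \<omega> \<in> space M \<Longrightarrow> \<bar>Z \<omega>\<bar> \<le> C0" using Z by (auto simp: bounded_meas_def)
  then obtain C where C: "0 < C" "\<And>\<omega>. \<omega> \<in> space M \<Longrightarrow> \<bar>Z \<omega>\<bar> \<le> C"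
    by (metis abs_ge_self abs_ge_zero add_strict_increasing2 le_add_same_cancel1 less_add_one order_le_less_trans
        order_less_imp_le order_trans zero_less_one)
  have intZ: "integrable M (\<lambda>\<omega>. Z \<omega> * (I' \<omega> - I \<omega>))"
    by (rule bounded_meas_integrable_mult[OF t Z int])
  have "\<bar>expectation (\<lambda>\<omega>. Z \<omega> * (I' \<omega> - I \<omega>))\<bar> \<le> \<delta>" if \<delta>: "0 < \<delta>" for \<delta>
  proof -
    \<comment> \<open>The second moment of \<open>D\<close> will be at most
      \<open>\<eta>\<^sup>2\<close>, so both parts of the bound
      \<open>C * (\<eta> + D\<^sup>2 / \<eta>)\<close> contribute at most \<open>C * \<eta>\<close>,
      together \<open>\<delta>\<close>.\<close>
    define \<eta> where "\<eta> = \<delta> / (2 * C)"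
    have \<eta>: "0 < \<eta>" using \<delta> C by (simp add: \<eta>_def)
    have \<epsilon>: "0 < \<eta>\<^sup>2" using \<eta> by simp
    obtain H2 K2 where K: "simple_integral t H2 K2"
      "(\<integral>\<^sup>+\<omega>. ennreal ((I' \<omega> - I \<omega> - K2 \<omega>)\<^sup>2) \<partial>M) \<le> ennreal (\<eta>\<^sup>2)"
      by (rule ito_limit_increment_approx[OF 1 2 tt H \<epsilon>])
    have [measurable]: "I \<in> borel_measurable M" "I' \<in> borel_measurable M"
      using 1 2 by (auto simp: ito_limit_def)
    note [measurable] = simple_integral_measurable[OF K(1) tt(1)]
    define D where "D \<omega> = I' \<omega> - I \<omega> - K2 \<omega>" for \<omega>
    have [measurable]: "D \<in> borel_measurable M" unfolding D_def by measurable
    have D2: "(\<integral>\<^sup>+\<omega>. ennreal ((D \<omega>)\<^sup>2) \<partial>M) \<le> ennreal (\<eta>\<^sup>2)" using K(2) by (simp add: D_def)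
    have D2i: "integrable M (\<lambda>\<omega>. (D \<omega>)\<^sup>2)"
      using D2 by (intro integrableI_bounded) (auto intro: le_less_trans)
    then have D2e: "expectation (\<lambda>\<omega>. (D \<omega>)\<^sup>2) \<le> \<eta>\<^sup>2"
      using D2 nn_integral_eq_integral[of M "\<lambda>\<omega>. (D \<omega>)\<^sup>2"] by simp
    note o = simple_integral_orthogonal[OF K(1) Z tt(1) tT]
    have eq: "Z \<omega> * D \<omega> = Z \<omega> * (I' \<omega> - I \<omega>) - Z \<omega> * K2 \<omega>" for \<omega>
      by (simp add: D_def right_diff_distrib)
    have ZD: "integrable M (\<lambda>\<omega>. Z \<omega> * D \<omega>)" unfolding eq using intZ o(1) by simp
    have "expectation (\<lambda>\<omega>. Z \<omega> * (I' \<omega> - I \<omega>)) = expectation (\<lambda>\<omega>. Z \<omega> * D \<omega>)"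
      unfolding eq using intZ o by simp
    also have "\<bar>\<dots>\<bar> \<le> expectation (\<lambda>\<omega>. \<bar>Z \<omega> * D \<omega>\<bar>)" by (rule integral_abs_bound)
    also have "\<dots> \<le> expectation (\<lambda>\<omega>. C * \<eta> + C / \<eta> * (D \<omega>)\<^sup>2)"
    proof (rule integral_mono)
      fix \<omega> assume "\<omega> \<in> space M"
      then have "\<bar>Z \<omega> * D \<omega>\<bar> \<le> C * \<bar>D \<omega>\<bar>" using C(2) by (simp add: abs_mult mult_right_mono)
      also have "\<bar>D \<omega>\<bar> \<le> \<eta> + (D \<omega>)\<^sup>2 / \<eta>"
      proof -
        have "0 \<le> (\<eta> - \<bar>D \<omega>\<bar>)\<^sup>2" "0 \<le> \<bar>D \<omega>\<bar> * \<eta>" using \<eta> by auto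
        then have "\<bar>D \<omega>\<bar> * \<eta> \<le> \<eta> * \<eta> + (D \<omega>)\<^sup>2" by (simp add: power2_eq_square algebra_simps)
        then show ?thesis using \<eta> by (simp add: field_simps)
      qed
      then have "C * \<bar>D \<omega>\<bar> \<le> C * (\<eta> + (D \<omega>)\<^sup>2 / \<eta>)" using C(1) by (intro mult_left_mono) auto
      finally show "\<bar>Z \<omega> * D \<omega>\<bar> \<le> C * \<eta> + C / \<eta> * (D \<omega>)\<^sup>2" by (simp add: distrib_left)
    qed (use ZD D2i in auto)
    also have "\<dots> = C * \<eta> + C / \<eta> * expectation (\<lambda>\<omega>. (D \<omega>)\<^sup>2)" using D2i by (simp add: prob_space)
    also have "\<dots> \<le> C * \<eta> + C / \<eta> * \<eta>\<^sup>2" using D2e C(1) \<eta> by (intro add_left_mono mult_left_mono) auto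
    also have "\<dots> = 2 * C * \<eta>" using \<eta> by (simp add: power2_eq_square)
    also have "\<dots> = \<delta>" using C(1) by (simp add: \<eta>_def)
    finally show ?thesis .
  qed
  then have "\<bar>expectation (\<lambda>\<omega>. Z \<omega> * (I' \<omega> - I \<omega>))\<bar> \<le> 0" by (rule field_le_epsilon) simp
  then show ?thesis by simp
qed

text \<open>In the expanded square, the products of \<open>e\<close> with the stochastic integral
  defect and with the \<open>w\<^sup>2 - h\<close> term have mean zero. The products with
  \<open>P\<close> and \<open>r\<close> do not; Young's inequality with weight \<open>h\<close>
  bounds them by \<open>h * e\<^sup>2\<close> each, which is the growth \<open>2 * h\<close>, plus
  \<open>P\<^sup>2 / h\<close> and \<open>r\<^sup>2 / h\<close>. The square of the sum of the four
  perturbations costs a factor \<open>4\<close>.\<close>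

lemma one_step_error:
  fixes t t' :: real and w :: "'a \<Rightarrow> real"
  defines "h \<equiv> t' - t" and "w \<equiv> \<lambda>\<omega>. B t' \<omega> - B t \<omega>"
  assumes tt: "0 \<le> t" "t < t'" "t' \<le> T" "t' - t \<le> 1"
    and ito: "ito_limit H t I" "ito_limit H t' I'" and intI: "integrable M (\<lambda>\<omega>. I' \<omega> - I \<omega>)"
    and H: "(\<lambda>(u, \<omega>). H u \<omega>) \<in> borel_measurable (lborel \<Otimes>\<^sub>M M)"
    and e: "bounded_meas t e" and Z: "bounded_meas t Z"
    and m: "bounded_meas t m" "\<And>\<omega>. \<omega> \<in> space M \<Longrightarrow> \<bar>m \<omega>\<bar> \<le> C"
    and P[measurable]: "P \<in> borel_measurable M" and P2: "integrable M (\<lambda>\<omega>. (P \<omega>)\<^sup>2)"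
    and r[measurable]: "r \<in> borel_measurable M"
    and r_le: "\<And>\<omega>. \<omega> \<in> space M \<Longrightarrow> \<bar>r \<omega>\<bar> \<le> K * (h\<^sup>2 + h * \<bar>w \<omega>\<bar> + \<bar>w \<omega>\<bar> ^ 3)"
    and V: "(\<integral>\<^sup>+\<omega>. (\<integral>\<^sup>+u\<in>{t<..t'}. ennreal ((H u \<omega> - Z \<omega>)\<^sup>2) \<partial>lborel) \<partial>M) \<le> ennreal V" "0 \<le> V"
    and e': "\<And>\<omega>. \<omega> \<in> space M \<Longrightarrow>
      e' \<omega> = e \<omega> + P \<omega> + (I' \<omega> - I \<omega> - Z \<omega> * w \<omega>) - m \<omega> * ((w \<omega>)\<^sup>2 - h) - r \<omega>"
  shows "integrable M (\<lambda>\<omega>. (e' \<omega>)\<^sup>2)"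
    and "expectation (\<lambda>\<omega>. (e' \<omega>)\<^sup>2) \<le> (1 + 2 * h) * expectation (\<lambda>\<omega>. (e \<omega>)\<^sup>2)
      + 5 / h * expectation (\<lambda>\<omega>. (P \<omega>)\<^sup>2) + 16 * V + (8 * C\<^sup>2 + 255 * K\<^sup>2) * h\<^sup>2"
proof -
  let ?E = "\<lambda>Z. expectation (\<lambda>\<omega>. (Z \<omega>)\<^sup>2)"
  have h: "0 < h" "h \<le> 1" using tt by (auto simp: h_def)
  have t: "t \<in> {0..T}" "t' \<in> {0..T}" and tle: "t \<le> t'" using tt by auto
  have [measurable]: "w \<in> borel_measurable M" unfolding w_def by (intro borel_measurable_diff B_measurable t)
  have [measurable]: "e \<in> borel_measurable M" "Z \<in> borel_measurable M" "m \<in> borel_measurable M"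
    using e Z m t by (auto simp: bounded_meas_def intro: measurable_F[of t])
  have [measurable]: "I \<in> borel_measurable M" "I' \<in> borel_measurable M"
    using ito by (auto simp: ito_limit_def)
  have wE: "B t' \<omega> - B t \<omega> = w \<omega>" for \<omega> by (simp add: w_def)
  have hE: "t' - t = h" by (simp add: h_def)
  note mom = increment_moments[OF tt(1) tle tt(3), unfolded wE hE]
  define Q where "Q \<omega> = I' \<omega> - I \<omega> - Z \<omega> * w \<omega>" for \<omega>
  define N where "N \<omega> = m \<omega> * ((w \<omega>)\<^sup>2 - h)" for \<omega>
  have [measurable]: "Q \<in> borel_measurable M" "N \<in> borel_measurable M" unfolding Q_def N_def by measurable
  have Qn: "(\<integral>\<^sup>+\<omega>. ennreal ((Q \<omega>)\<^sup>2) \<partial>M) \<le> ennreal (4 * V)"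
  proof -
    have "(\<integral>\<^sup>+\<omega>. ennreal ((Q \<omega>)\<^sup>2) \<partial>M)
      \<le> 4 * (\<integral>\<^sup>+\<omega>. (\<integral>\<^sup>+u\<in>{t<..t'}. ennreal ((H u \<omega> - Z \<omega>)\<^sup>2) \<partial>lborel) \<partial>M)"
      using ito_limit_increment_bound[OF ito tt(1) tle tt(3) Z H] unfolding Q_def wE .
    also have "\<dots> \<le> 4 * ennreal V" using V(1) by (intro mult_left_mono) auto
    finally show ?thesis using V(2) by (simp add: ennreal_mult)
  qed
  have Q2: "integrable M (\<lambda>\<omega>. (Q \<omega>)\<^sup>2)"
    using Qn by (intro integrableI_bounded) (auto intro: le_less_trans)
  have Q2e: "?E Q \<le> 4 * V"
    using Qn V(2) nn_integral_eq_integral[OF Q2] by simp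
  have weq: "((w \<omega>)\<^sup>2 - h)\<^sup>2 = (w \<omega>)^4 - 2 * h * (w \<omega>)\<^sup>2 + h\<^sup>2" for \<omega>
    by (simp add: power2_diff flip: power_mult)
  have w4i: "integrable M (\<lambda>\<omega>. ((w \<omega>)\<^sup>2 - h)\<^sup>2)" unfolding weq using mom(1)[of 2] mom(1)[of 4] by simp
  have w4: "expectation (\<lambda>\<omega>. ((w \<omega>)\<^sup>2 - h)\<^sup>2) = 2 * h\<^sup>2"
    unfolding weq using mom(1)[of 2] mom(1)[of 4] mom(3,4) by (simp add: prob_space power2_eq_square)
  have NC: "(N \<omega>)\<^sup>2 \<le> C\<^sup>2 * ((w \<omega>)\<^sup>2 - h)\<^sup>2" if "\<omega> \<in> space M" for \<omega>
    unfolding N_def power_mult_distrib using m(2)[OF that]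
    by (intro mult_right_mono) (auto simp: abs_le_square_iff[symmetric])
  have N2: "integrable M (\<lambda>\<omega>. (N \<omega>)\<^sup>2)"
    by (rule Bochner_Integration.integrable_bound[of _ "\<lambda>\<omega>. C\<^sup>2 * ((w \<omega>)\<^sup>2 - h)\<^sup>2"])
      (use w4i NC in \<open>auto intro!: AE_I2\<close>)
  have N2e: "?E N \<le> 2 * C\<^sup>2 * h\<^sup>2"
  proof -
    have "?E N \<le> expectation (\<lambda>\<omega>. C\<^sup>2 * ((w \<omega>)\<^sup>2 - h)\<^sup>2)"
      using N2 w4i NC by (intro integral_mono) auto
    then show ?thesis using w4 by simp
  qed
  \<comment> \<open>An integrable polynomial in \<open>w\<close> that dominates
    \<open>r\<^sup>2\<close>. Its mean is of order \<open>h ^ 3\<close>, with coefficient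
    \<open>3 * (1 + 1 + 15) = 51\<close>, where \<open>15\<close> is the sixth normal moment and
    \<open>h ^ 4\<close> is bounded by \<open>h ^ 3\<close>.\<close>
  define q where "q \<omega> = 3 * K\<^sup>2 * (h^4 + h\<^sup>2 * (w \<omega>)\<^sup>2 + (w \<omega>)^6)" for \<omega>
  have rq: "(r \<omega>)\<^sup>2 \<le> q \<omega>" if "\<omega> \<in> space M" for \<omega>
  proof -
    have "(r \<omega>)\<^sup>2 \<le> (K * (h\<^sup>2 + h * \<bar>w \<omega>\<bar> + \<bar>w \<omega>\<bar> ^ 3))\<^sup>2"
      using r_le[OF that] by (rule abs_le_square_iff[THEN iffD1, OF order_trans[OF _ abs_ge_self]])
    also have "\<dots> \<le> K\<^sup>2 * (3 * (h\<^sup>2)\<^sup>2 + 3 * (h * \<bar>w \<omega>\<bar>)\<^sup>2 + 3 * (\<bar>w \<omega>\<bar>^3)\<^sup>2)"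
      unfolding power_mult_distrib[of K] by (intro mult_left_mono square_add3_le) simp
    also have "\<dots> = q \<omega>" by (simp add: q_def power_mult_distrib algebra_simps flip: power_mult)
    finally show ?thesis .
  qed
  have qi: "integrable M q" unfolding q_def using mom(1)[of 2] mom(1)[of 6] by simp
  have qe: "expectation q \<le> 51 * K\<^sup>2 * h^3"
  proof -
    have "expectation q = 3 * K\<^sup>2 * (h^4 + h\<^sup>2 * h + 15 * h^3)"
      unfolding q_def using mom(1)[of 2] mom(1)[of 6] mom(3,5) by (simp add: prob_space)
    also have "\<dots> \<le> 3 * K\<^sup>2 * (h^3 + h\<^sup>2 * h + 15 * h^3)"
      using h by (intro mult_left_mono add_right_mono power_decreasing) auto
    also have "\<dots> = 51 * K\<^sup>2 * h^3" by (simp add: eval_nat_numeral)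
    finally show ?thesis .
  qed
  have r2: "integrable M (\<lambda>\<omega>. (r \<omega>)\<^sup>2)"
    by (rule Bochner_Integration.integrable_bound[OF qi]) (use order_trans[OF rq abs_ge_self] in \<open>auto intro!: AE_I2\<close>)
  have r2e: "?E r \<le> 51 * K\<^sup>2 * h^3"
    using integral_mono[OF r2 qi rq] qe by simp
  have e2: "integrable M (\<lambda>\<omega>. (e \<omega>)\<^sup>2)"
    using bounded_meas_integrable[OF t(1) bounded_meas_mult[OF e e]] by (simp add: power2_eq_square)
  have eQ: "integrable M (\<lambda>\<omega>. e \<omega> * Q \<omega>)" "expectation (\<lambda>\<omega>. e \<omega> * Q \<omega>) = 0"
  proof -
    show "integrable M (\<lambda>\<omega>. e \<omega> * Q \<omega>)" using e2 Q2 by (intro integrable_mult_square) auto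
    note i1 = bounded_meas_integrable_mult[OF t(1) e intI]
    have eZ: "(\<lambda>\<omega>. e \<omega> * Z \<omega>) \<in> borel_measurable (F t)" "integrable M (\<lambda>\<omega>. e \<omega> * Z \<omega>)"
      using bounded_meas_mult[OF e Z] bounded_meas_integrable[OF t(1) bounded_meas_mult[OF e Z]]
      by (auto simp: bounded_meas_def)
    note i2 = increment_orthogonal(1,2)[OF tt(1) tle tt(3) eZ, unfolded wE]
    have "expectation (\<lambda>\<omega>. e \<omega> * Q \<omega>)
      = expectation (\<lambda>\<omega>. e \<omega> * (I' \<omega> - I \<omega>) - e \<omega> * Z \<omega> * w \<omega>)"
      by (simp add: Q_def algebra_simps)
    also have "\<dots> = expectation (\<lambda>\<omega>. e \<omega> * (I' \<omega> - I \<omega>)) - expectation (\<lambda>\<omega>. e \<omega> * Z \<omega> * w \<omega>)"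
      by (rule Bochner_Integration.integral_diff[OF i1 i2(1)])
    also have "\<dots> = 0"
      using ito_limit_orthogonal[OF ito tt(1) tle tt(3) e H intI] i2(2) by simp
    finally show "expectation (\<lambda>\<omega>. e \<omega> * Q \<omega>) = 0" .
  qed
  have eN: "integrable M (\<lambda>\<omega>. e \<omega> * N \<omega>)" "expectation (\<lambda>\<omega>. e \<omega> * N \<omega>) = 0"
  proof -
    show "integrable M (\<lambda>\<omega>. e \<omega> * N \<omega>)" using e2 N2 by (intro integrable_mult_square) auto
    have em: "(\<lambda>\<omega>. e \<omega> * m \<omega>) \<in> borel_measurable (F t)" "integrable M (\<lambda>\<omega>. e \<omega> * m \<omega>)"
      using bounded_meas_mult[OF e m(1)] bounded_meas_integrable[OF t(1) bounded_meas_mult[OF e m(1)]]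
      by (auto simp: bounded_meas_def)
    note i2 = increment_orthogonal(3,4)[OF tt(1) tle tt(3) em, unfolded wE hE]
    have "expectation (\<lambda>\<omega>. e \<omega> * N \<omega>)
      = expectation (\<lambda>\<omega>. e \<omega> * m \<omega> * (w \<omega>)\<^sup>2 - h * (e \<omega> * m \<omega>))"
      by (simp add: N_def algebra_simps)
    then show "expectation (\<lambda>\<omega>. e \<omega> * N \<omega>) = 0" using i2 em by simp
  qed
  \<comment> \<open>The products of \<open>e\<close> with \<open>Q\<close> and \<open>N\<close> are
    kept as they stand, without estimating them, since their expectations vanish.\<close>
  define G where "G \<omega> = (1 + 2 * h) * (e \<omega>)\<^sup>2 + (4 + 1 / h) * (P \<omega>)\<^sup>2 + (4 + 1 / h) * (r \<omega>)\<^sup>2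
    + 4 * (Q \<omega>)\<^sup>2 + 4 * (N \<omega>)\<^sup>2 + 2 * (e \<omega> * Q \<omega>) - 2 * (e \<omega> * N \<omega>)" for \<omega>
  have e'G: "(e' \<omega>)\<^sup>2 \<le> G \<omega>" if "\<omega> \<in> space M" for \<omega>
  proof -
    define x where "x = P \<omega> + Q \<omega> - N \<omega> - r \<omega>"
    have ex: "e' \<omega> = e \<omega> + x" using e'[OF that] by (simp add: x_def Q_def N_def)
    have y: "2 * a * b \<le> h * a\<^sup>2 + b\<^sup>2 / h" for a b :: real
    proof -
      have "0 \<le> (h * a - b)\<^sup>2 / h" using h by simp
      also have "\<dots> = h * a\<^sup>2 + b\<^sup>2 / h - 2 * a * b" using h by (simp add: power2_eq_square field_simps)
      finally show ?thesis by simp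
    qed
    have xe: "x = (P \<omega> + Q \<omega>) + (- N \<omega> + - r \<omega>)" by (simp add: x_def)
    have x4: "x\<^sup>2 \<le> 4 * (P \<omega>)\<^sup>2 + 4 * (Q \<omega>)\<^sup>2 + 4 * (N \<omega>)\<^sup>2 + 4 * (r \<omega>)\<^sup>2"
      using square_add2_le[of "P \<omega> + Q \<omega>" "- N \<omega> + - r \<omega>"] square_add2_le[of "P \<omega>" "Q \<omega>"]
        square_add2_le[of "- N \<omega>" "- r \<omega>"] unfolding xe power2_minus by linarith
    have "(e' \<omega>)\<^sup>2 = (e \<omega>)\<^sup>2 + 2 * e \<omega> * P \<omega> + 2 * e \<omega> * (- r \<omega>) + 2 * (e \<omega> * Q \<omega>) - 2 * (e \<omega> * N \<omega>) + x\<^sup>2"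
      unfolding ex by (simp add: power2_sum) (simp add: x_def algebra_simps)
    also have "\<dots> \<le> (e \<omega>)\<^sup>2 + (h * (e \<omega>)\<^sup>2 + (P \<omega>)\<^sup>2 / h) + (h * (e \<omega>)\<^sup>2 + (- r \<omega>)\<^sup>2 / h)
      + 2 * (e \<omega> * Q \<omega>) - 2 * (e \<omega> * N \<omega>) + (4 * (P \<omega>)\<^sup>2 + 4 * (Q \<omega>)\<^sup>2 + 4 * (N \<omega>)\<^sup>2 + 4 * (r \<omega>)\<^sup>2)"
      by (intro add_mono diff_right_mono y x4 order_refl)
    also have "\<dots> = G \<omega>" by (simp add: G_def algebra_simps)
    finally show ?thesis .
  qed
  have Gi: "integrable M G" unfolding G_def using e2 P2 r2 Q2 N2 eQ(1) eN(1) by simp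
  have e'm: "(\<lambda>\<omega>. (e' \<omega>)\<^sup>2) \<in> borel_measurable M"
    by (subst measurable_cong[OF arg_cong[where f = "\<lambda>x. x\<^sup>2", OF e']]) measurable
  show e'2: "integrable M (\<lambda>\<omega>. (e' \<omega>)\<^sup>2)"
    by (rule Bochner_Integration.integrable_bound[OF Gi e'm]) (use order_trans[OF e'G abs_ge_self] in \<open>auto intro!: AE_I2\<close>)
  have "?E e' \<le> expectation G"
    by (rule integral_mono[OF e'2 Gi e'G])
  also have "expectation G = (1 + 2 * h) * ?E e + (4 + 1 / h) * ?E P
    + (4 + 1 / h) * ?E r + 4 * ?E Q + 4 * ?E N"
    unfolding G_def using e2 P2 r2 Q2 N2 eQ eN by simp
  \<comment> \<open>\<open>4 + 1 / h \<le> 5 / h\<close> because \<open>h \<le> 1\<close>; the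
    moment bounds for \<open>Q\<close>, \<open>N\<close> and \<open>r\<close> then give the
    constants \<open>16\<close>, \<open>8\<close> and \<open>5 * 51 = 255\<close>.\<close>
  also have "\<dots> \<le> (1 + 2 * h) * ?E e + 5 / h * ?E P
    + 5 / h * (51 * K\<^sup>2 * h^3) + 4 * (4 * V) + 4 * (2 * C\<^sup>2 * h\<^sup>2)"
    using h r2e Q2e N2e
    by (intro add_mono mult_mono mult_right_mono mult_left_mono order_refl)
      (auto simp: field_simps intro!: Bochner_Integration.integral_nonneg)
  also have "\<dots> = (1 + 2 * h) * ?E e + 5 / h * ?E P
    + 16 * V + (8 * C\<^sup>2 + 255 * K\<^sup>2) * h\<^sup>2"
    using h by (simp add: eval_nat_numeral distrib_right)
  finally show "?E e' \<le> (1 + 2 * h) * ?E e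
      + 5 / h * ?E P + 16 * V + (8 * C\<^sup>2 + 255 * K\<^sup>2) * h\<^sup>2" .
qed

end

subsection \<open>Measurability\<close>

lemma borel_measurable_vec_nth [measurable (raw)]:
  fixes X :: "'a \<Rightarrow> real^'d::finite"
  shows "X \<in> borel_measurable M \<Longrightarrow> (\<lambda>\<omega>. X \<omega> $ i) \<in> borel_measurable M"
  by (rule measurable_compose[OF _ borel_measurable_continuous_onI]) (auto intro!: continuous_intros)

lemma borel_measurable_vec_lambda:
  fixes X :: "'d::finite \<Rightarrow> 'a \<Rightarrow> real"
  assumes "\<And>i. X i \<in> borel_measurable M"
  shows "(\<lambda>\<omega>. \<chi> i. X i \<omega>) \<in> borel_measurable M"
  unfolding borel_measurable_euclidean_space[where f = "\<lambda>\<omega>. \<chi> i. X i \<omega>"]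
  using assms by (auto simp: Basis_vec_def inner_axis)

lemma borel_measurable_coord_subst [measurable (raw)]:
  fixes Y :: "'a \<Rightarrow> real^'d::finite"
  assumes [measurable]: "Y \<in> borel_measurable M"
  shows "(\<lambda>\<omega>. coord_subst i s (Y \<omega>)) \<in> borel_measurable M"
  unfolding coord_subst_def
proof (rule borel_measurable_vec_lambda)
  fix j show "(\<lambda>\<omega>. if j = i then s else Y \<omega> $ j) \<in> borel_measurable M" by measurable
qed

lemma borel_measurable_edp_step:
  fixes f g :: "real^'d \<Rightarrow> real^'d::finite"
  assumes [measurable]: "f \<in> borel_measurable borel" "g \<in> borel_measurable borel"
    "Y \<in> borel_measurable M" "w \<in> borel_measurable M" "\<theta> \<in> borel_measurable M"
  shows "(\<lambda>\<omega>. edp_step f g L R h (Y \<omega>) (w \<omega>) (\<theta> \<omega>)) \<in> borel_measurable M"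
  unfolding edp_step_def Let_def
proof (rule borel_measurable_vec_lambda)
  fix i
  have [measurable]: "(\<lambda>\<omega>. step_left f g L R h (Y \<omega>) (w \<omega>) i) \<in> borel_measurable M"
    unfolding step_left_def alpha_left_def beta_left_def F_left_def by measurable
  have [measurable]: "(\<lambda>\<omega>. step_right f g L R h (Y \<omega>) (w \<omega>) i) \<in> borel_measurable M"
    unfolding step_right_def alpha_right_def beta_right_def F_right_def by measurable
  show "(\<lambda>\<omega>. step_left f g L R h (Y \<omega>) (w \<omega>) i * of_bool (step_right f g L R h (Y \<omega>) (w \<omega>) i \<le> L $ i)
    + step_right f g L R h (Y \<omega>) (w \<omega>) i * of_bool (R $ i \<le> step_left f g L R h (Y \<omega>) (w \<omega>) i)
    + ((1 - \<theta> \<omega> $ i) * step_left f g L R h (Y \<omega>) (w \<omega>) i + \<theta> \<omega> $ i * step_right f g L R h (Y \<omega>) (w \<omega>) i)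
      * of_bool (L $ i < step_right f g L R h (Y \<omega>) (w \<omega>) i \<and> step_left f g L R h (Y \<omega>) (w \<omega>) i < R $ i))
    \<in> borel_measurable M"
    unfolding of_bool_def by measurable
qed

text \<open>Time is rounded down to a multiple of \<open>1 / Suc n\<close>. The rounded process
  depends on time through countably many values only, so it is jointly measurable, and continuity of
  the paths gives pointwise convergence.\<close>

lemma borel_measurable_pair_continuous:
  fixes X :: "real \<Rightarrow> 'a \<Rightarrow> 'b::{metric_space, second_countable_topology}"
  assumes X: "\<And>t. X t \<in> borel_measurable M"
    and c: "\<And>\<omega>. \<omega> \<in> space M \<Longrightarrow> continuous_on UNIV (\<lambda>t. X t \<omega>)"
  shows "(\<lambda>(t, \<omega>). X t \<omega>) \<in> borel_measurable (lborel \<Otimes>\<^sub>M M)"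
proof -
  define q where "q n t = real_of_int \<lfloor>t * real (Suc n)\<rfloor> / real (Suc n)" for n :: nat and t :: real
  have meas: "(\<lambda>(t, \<omega>). X (q n t) \<omega>) \<in> borel_measurable (lborel \<Otimes>\<^sub>M M)" for n
  proof -
    have "(\<lambda>x. (\<lambda>(i::int) x. X (real_of_int i / real (Suc n)) (snd x)) \<lfloor>fst x * real (Suc n)\<rfloor> x)
      \<in> borel_measurable (lborel \<Otimes>\<^sub>M M)"
    proof (rule measurable_compose_countable[where f = "\<lambda>(i::int) x. X (real_of_int i / real (Suc n)) (snd x)"
          and g = "\<lambda>x. \<lfloor>fst x * real (Suc n)\<rfloor>"])
      show "(\<lambda>x. X (real_of_int i / real (Suc n)) (snd x)) \<in> borel_measurable (lborel \<Otimes>\<^sub>M M)" for i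
        by (rule measurable_compose[OF measurable_snd X])
    qed measurable
    then show ?thesis by (simp add: q_def case_prod_unfold)
  qed
  have lim: "(\<lambda>n. case x of (t, \<omega>) \<Rightarrow> X (q n t) \<omega>) \<longlonglongrightarrow> (case x of (t, \<omega>) \<Rightarrow> X t \<omega>)"
    if "x \<in> space (lborel \<Otimes>\<^sub>M M)" for x
  proof -
    from that obtain t \<omega> where x: "x = (t, \<omega>)" "\<omega> \<in> space M" by (auto simp: space_pair_measure)
    have "(\<lambda>n. q n t) \<longlonglongrightarrow> t"
    proof (rule tendsto_sandwich)
      have "(\<lambda>n. t - inverse (real (Suc n))) \<longlonglongrightarrow> t - 0"
        by (intro tendsto_intros LIMSEQ_inverse_real_of_nat)
      then show "(\<lambda>n. t - inverse (real (Suc n))) \<longlonglongrightarrow> t" by simp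
      show "\<forall>\<^sub>F n in sequentially. t - inverse (real (Suc n)) \<le> q n t"
      proof (intro always_eventually allI)
        fix n :: nat
        have "t * real (Suc n) - 1 \<le> real_of_int \<lfloor>t * real (Suc n)\<rfloor>" by linarith
        then have "(t * real (Suc n) - 1) / real (Suc n) \<le> q n t"
          unfolding q_def by (rule divide_right_mono) simp
        then show "t - inverse (real (Suc n)) \<le> q n t" by (simp only: diff_divide_distrib) (simp add: inverse_eq_divide)
      qed
      show "\<forall>\<^sub>F n in sequentially. q n t \<le> t"
      proof (intro always_eventually allI)
        fix n :: nat
        have "real_of_int \<lfloor>t * real (Suc n)\<rfloor> \<le> t * real (Suc n)" by linarith
        then have "q n t \<le> t * real (Suc n) / real (Suc n)"
          unfolding q_def by (rule divide_right_mono) simp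
        then show "q n t \<le> t" by simp
      qed
    qed simp
    then have "(\<lambda>n. X (q n t) \<omega>) \<longlonglongrightarrow> X t \<omega>"
      using c[OF x(2)] continuous_on_tendsto_compose[of UNIV "\<lambda>t. X t \<omega>" "\<lambda>n. q n t" t sequentially] by simp
    then show ?thesis by (simp add: x)
  qed
  show ?thesis
    by (rule borel_measurable_LIMSEQ_metric[where f = "\<lambda>n (t, \<omega>). X (q n t) \<omega>", OF meas lim])
qed

text \<open>The Cauchy-Schwarz inequality on an interval, obtained from the nonnegativity of the
  integral of \<open>(\<phi> u - c)\<^sup>2\<close> with \<open>c\<close> the mean of
  \<open>\<phi>\<close>.\<close>

lemma set_integral_square_le:
  fixes \<phi> :: "real \<Rightarrow> real"
  assumes "a < b" "set_integrable lborel {a<..b} \<phi>" "set_integrable lborel {a<..b} (\<lambda>u. (\<phi> u)\<^sup>2)"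
  shows "(LBINT u:{a<..b}. \<phi> u)\<^sup>2 \<le> (b - a) * (LBINT u:{a<..b}. (\<phi> u)\<^sup>2)"
proof -
  define c where "c = (LBINT u:{a<..b}. \<phi> u) / (b - a)"
  have k: "set_integrable lborel {a<..b} (\<lambda>u. k :: real)" "(LBINT u:{a<..b}. k) = k * (b - a)" for k
    using assms(1) by (simp_all add: set_integrable_def set_lebesgue_integral_def)
  have "0 \<le> (LBINT u:{a<..b}. (\<phi> u - c)\<^sup>2)"
    unfolding set_lebesgue_integral_def by (intro Bochner_Integration.integral_nonneg) (auto simp: indicator_def)
  also have "(LBINT u:{a<..b}. (\<phi> u - c)\<^sup>2) = (LBINT u:{a<..b}. (\<phi> u)\<^sup>2 - (2 * c * \<phi> u - c\<^sup>2))"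
  proof -
    have "(\<phi> u - c)\<^sup>2 = (\<phi> u)\<^sup>2 - (2 * c * \<phi> u - c\<^sup>2)" for u
      by (simp add: power2_eq_square algebra_simps)
    then show ?thesis by simp
  qed
  also have "\<dots> = (LBINT u:{a<..b}. (\<phi> u)\<^sup>2) - (2 * c * (LBINT u:{a<..b}. \<phi> u) - c\<^sup>2 * (b - a))"
    using assms k by (simp add: set_integral_diff set_integrable_mult_right)
  also have "(LBINT u:{a<..b}. \<phi> u) = c * (b - a)" using assms(1) by (simp add: c_def)
  finally have "c\<^sup>2 * (b - a) \<le> (LBINT u:{a<..b}. (\<phi> u)\<^sup>2)" by (simp add: power2_eq_square)
  then have "(b - a) * (c\<^sup>2 * (b - a)) \<le> (b - a) * (LBINT u:{a<..b}. (\<phi> u)\<^sup>2)"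
    using assms(1) by (intro mult_left_mono) auto
  moreover have "(LBINT u:{a<..b}. \<phi> u)\<^sup>2 = (b - a) * (c\<^sup>2 * (b - a))"
    using assms(1) by (simp add: c_def power2_eq_square)
  ultimately show ?thesis by simp
qed

lemma norm_vec_power2: "(norm (x :: real^'d::finite))\<^sup>2 = (\<Sum>i\<in>UNIV. (x $ i)\<^sup>2)"
  by (simp add: norm_vec_def L2_set_def sum_nonneg)

text \<open>On the exceptional null set the path is replaced by the constant \<open>x0\<close>, and
  time is clamped to \<open>{0..T}\<close>. Range and continuity then hold for every
  \<open>\<omega>\<close> and every real time, so the estimates that follow need no exceptional
  sets.\<close>

lemma sde_modification:
  fixes X :: "real \<Rightarrow> 'a \<Rightarrow> real^'d::finite"
  assumes filt: "normal_filtration M T F" and T: "0 < T" and x0: "x0 \<in> box L R"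
    and sde: "sde_solution M T F W f g L R x0 X"
  obtains X' where "\<And>t. t \<in> {0..T} \<Longrightarrow> X' t \<in> borel_measurable (F t)"
    and "\<And>t. X' t \<in> borel_measurable M"
    and "\<And>t \<omega>. \<omega> \<in> space M \<Longrightarrow> X' t \<omega> \<in> box L R"
    and "\<And>\<omega>. \<omega> \<in> space M \<Longrightarrow> continuous_on UNIV (\<lambda>t. X' t \<omega>)"
    and "AE \<omega> in M. \<forall>t\<in>{0..T}. X' t \<omega> = X t \<omega>"
proof -
  have ad: "\<And>t. t \<in> {0..T} \<Longrightarrow> X t \<in> borel_measurable (F t)"
    and ae: "AE \<omega> in M. continuous_on {0..T} (\<lambda>t. X t \<omega>) \<and> (\<forall>t\<in>{0..T}. X t \<omega> \<in> box L R)"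
  proof -
    show "\<And>t. t \<in> {0..T} \<Longrightarrow> X t \<in> borel_measurable (F t)"
      using sde unfolding sde_solution_def by blast
    have 1: "AE \<omega> in M. continuous_on {0..T} (\<lambda>t. X t \<omega>)"
      and 2: "AE \<omega> in M. \<forall>t\<in>{0..T}. X t \<omega> \<in> box L R"
      using sde unfolding sde_solution_def by blast+
    show "AE \<omega> in M. continuous_on {0..T} (\<lambda>t. X t \<omega>) \<and> (\<forall>t\<in>{0..T}. X t \<omega> \<in> box L R)"
      using 1 2 by eventually_elim (rule conjI)
  qed
  obtain N where N: "\<And>\<omega>. \<omega> \<in> space M - N \<Longrightarrow>
      continuous_on {0..T} (\<lambda>t. X t \<omega>) \<and> (\<forall>t\<in>{0..T}. X t \<omega> \<in> box L R)"
    and N0: "N \<in> null_sets M"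
    using AE_E3[OF ae] by metis
  define c where "c t = max 0 (min T t)" for t :: real
  have c: "c t \<in> {0..T}" for t using T by (auto simp: c_def)
  have cid: "c t = t" if "t \<in> {0..T}" for t using that by (auto simp: c_def)
  define X' where "X' t \<omega> = (if \<omega> \<in> N then x0 else X (c t) \<omega>)" for t \<omega>
  have sub: "subalgebra M (F t)" if "t \<in> {0..T}" for t using filt that by (auto simp: normal_filtration_def)
  have 1: "X' t \<in> borel_measurable (F (c t))" for t
  proof -
    \<comment> \<open>Completeness of the normal filtration: null sets belong to \<open>F 0\<close>,
      so changing the process on one preserves adaptedness.\<close>
    have "N \<in> sets (F 0)" using N0 filt unfolding normal_filtration_def by blast
    moreover have "sets (F 0) \<subseteq> sets (F (c t))"
      using filt c[of t] unfolding normal_filtration_def by auto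
    ultimately have NF: "N \<in> sets (F (c t))" by auto
    have "(\<lambda>\<omega>. if \<omega> \<in> N then x0 else X (c t) \<omega>) \<in> borel_measurable (F (c t))"
      by (rule measurable_If_set[OF _ ad[OF c]]) (use NF in auto)
    then show ?thesis unfolding X'_def .
  qed
  show ?thesis
  proof (rule that[of X'])
    show "X' t \<in> borel_measurable (F t)" if "t \<in> {0..T}" for t using 1[of t] cid[OF that] by simp
    show "X' t \<in> borel_measurable M" for t by (rule measurable_from_subalg[OF sub[OF c] 1])
    show "X' t \<omega> \<in> box L R" if "\<omega> \<in> space M" for t \<omega>
      using N[of \<omega>] c[of t] that x0 by (auto simp: X'_def)
    show "continuous_on UNIV (\<lambda>t. X' t \<omega>)" if "\<omega> \<in> space M" for \<omega>
    proof (cases "\<omega> \<in> N")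
      case False
      have "continuous_on UNIV (\<lambda>t. X (c t) \<omega>)"
      proof (rule continuous_on_compose2[OF conjunct1[OF N]])
        show "continuous_on UNIV c" unfolding c_def by (intro continuous_intros)
      qed (use False that c in auto)
      then show ?thesis using False by (simp add: X'_def)
    qed (simp add: X'_def)
    show "AE \<omega> in M. \<forall>t\<in>{0..T}. X' t \<omega> = X t \<omega>"
      using AE_not_in[OF N0] by eventually_elim (auto simp: X'_def cid)
  qed
qed

text \<open>A preimage under the coordinate increment is a preimage of a Borel cylinder under the
  vector increment, so its independence from the past is inherited.\<close>

lemma brownian_motion_component:
  fixes W :: "real \<Rightarrow> 'a \<Rightarrow> real^'d::finite"
  assumes M: "prob_space M" and filt: "normal_filtration M T F" and bm: "brownian_motion M T F W"
  shows "brownian_component M T F (\<lambda>t \<omega>. W t \<omega> $ i)"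
proof -
  interpret prob_space M by fact
  show ?thesis
  proof
    show "subalgebra M (F t)" if "t \<in> {0..T}" for t
      using filt that by (auto simp: normal_filtration_def)
    show "sets (F s) \<subseteq> sets (F t)" if "0 \<le> s" "s \<le> t" "t \<le> T" for s t
      using filt that by (auto simp: normal_filtration_def)
    show "(\<lambda>\<omega>. W t \<omega> $ i) \<in> borel_measurable (F t)" if "t \<in> {0..T}" for t
      using bm that by (auto simp: brownian_motion_def intro: borel_measurable_vec_nth)
    fix s t assume st: "0 \<le> s" "s < t" "t \<le> T"
    show "distributed M lborel (\<lambda>\<omega>. W t \<omega> $ i - W s \<omega> $ i) (\<lambda>x. ennreal (normal_density 0 (sqrt (t - s)) x))"
      using bm st by (auto simp: brownian_motion_def)
    have ind: "indep_set (sets (F s)) {(\<lambda>\<omega>. W t \<omega> - W s \<omega>) -` A \<inter> space M | A. A \<in> sets borel}"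
      using bm st by (auto simp: brownian_motion_def)
    have sub: "{(\<lambda>\<omega>. W t \<omega> $ i - W s \<omega> $ i) -` A \<inter> space M | A. A \<in> sets borel}
      \<subseteq> {(\<lambda>\<omega>. W t \<omega> - W s \<omega>) -` A \<inter> space M | A. A \<in> sets borel}"
    proof clarify
      fix A :: "real set" assume A: "A \<in> sets borel"
      have nth: "(\<lambda>x::real^'d. x $ i) \<in> borel_measurable borel" by measurable
      have "(\<lambda>x::real^'d. x $ i) -` A \<in> sets borel" using measurable_sets[OF nth A] by simp
      moreover have "(\<lambda>\<omega>. W t \<omega> $ i - W s \<omega> $ i) -` A = (\<lambda>\<omega>. W t \<omega> - W s \<omega>) -` ((\<lambda>x. x $ i) -` A)"
        by auto
      ultimately show "\<exists>A'. (\<lambda>\<omega>. W t \<omega> $ i - W s \<omega> $ i) -` A \<inter> space M = (\<lambda>\<omega>. W t \<omega> - W s \<omega>) -` A' \<inter> space M \<and> A' \<in> sets borel"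
        by (intro exI[of _ "(\<lambda>x. x $ i) -` A"]) simp
    qed
    show "indep_set (sets (F s)) {(\<lambda>\<omega>. W t \<omega> $ i - W s \<omega> $ i) -` A \<inter> space M | A. A \<in> sets borel}"
    proof (rule indep_setI)
      have i: "sets (F s) \<subseteq> events" "{(\<lambda>\<omega>. W t \<omega> - W s \<omega>) -` A \<inter> space M | A. A \<in> sets borel} \<subseteq> events"
        using ind unfolding indep_sets2_eq by simp_all
      show "sets (F s) \<subseteq> events" by (rule i(1))
      show "{(\<lambda>\<omega>. W t \<omega> $ i - W s \<omega> $ i) -` A \<inter> space M | A. A \<in> sets borel} \<subseteq> events"
        by (rule order_trans[OF sub i(2)])
    qed (rule indep_setD[OF ind _ subsetD[OF sub]])
  qed
qed

section \<open>Measurability and regularity of the coefficients on the box\<close>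

context box_domain
begin

lemma continuous_fg: "continuous_on (cbox L R) f" "continuous_on (cbox L R) g"
proof -
  have "continuous_on (cbox L R) k" if "\<And>y z. y \<in> cbox L R \<Longrightarrow> z \<in> cbox L R \<Longrightarrow> norm (k y - k z) \<le> A * norm (y - z)"
    for k :: "real^'d \<Rightarrow> real^'d"
  proof -
    have "A-lipschitz_on (cbox L R) k"
      using that A_nonneg by (intro lipschitz_onI) (auto simp: dist_norm)
    then show ?thesis by (rule lipschitz_on_continuous_on)
  qed
  then show "continuous_on (cbox L R) f" "continuous_on (cbox L R) g" using f_lip g_lip by blast+
qed

text \<open>Off the closed box \<open>f\<close> and \<open>g\<close> are arbitrary and may fail to
  be measurable. The truncation is Borel on the whole space and agrees with the original wherever
  the solution or the scheme evaluates it.\<close>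

definition cut :: "(real^'d \<Rightarrow> real^'d) \<Rightarrow> real^'d \<Rightarrow> real^'d" where
  "cut k y = (if y \<in> cbox L R then k y else 0)"

lemma cut_measurable [measurable]: "cut f \<in> borel_measurable borel" "cut g \<in> borel_measurable borel"
proof -
  have "cut k \<in> borel_measurable borel" if "continuous_on (cbox L R) k" for k
    unfolding cut_def by (intro borel_measurable_continuous_on_if that) auto
  then show "cut f \<in> borel_measurable borel" "cut g \<in> borel_measurable borel" using continuous_fg by blast+
qed

lemma cut_eq: "y \<in> box L R \<Longrightarrow> cut k y = k y"
  using box_subset_cbox by (auto simp: cut_def)

text \<open>A step evaluates the coefficients at \<open>y\<close> and at its projections to the
  faces only, and all these points lie in the closed box.\<close>

lemma edp_step_cut:
  assumes "y \<in> box L R"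
  shows "edp_step (cut f) (cut g) L R h y w \<theta> = edp_step f g L R h y w \<theta>"
  using face_mem[OF assms] cut_eq[OF assms]
  by (simp add: edp_step_def step_left_def step_right_def alpha_left_def alpha_right_def
      F_left_def F_right_def beta_left_def beta_right_def cut_def)

lemma abs_diffusion_coeff_le:
  assumes "y \<in> box L R" shows "\<bar>diffusion_coeff g L R i y\<bar> \<le> A ^ 3"
proof -
  have "\<bar>diffusion_coeff g L R i y\<bar> = \<bar>g y $ i\<bar> * (y $ i - L $ i) * (R $ i - y $ i)"
    using gap_pos[OF assms, of i] by (simp add: diffusion_coeff_def abs_mult)
  also have "\<dots> \<le> A * A * A"
    using gap_pos[OF assms, of i] gap_le[OF assms, of i] comp_le(2)[OF assms, of i] A_nonneg
    by (intro mult_mono) auto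
  finally show ?thesis by (simp add: eval_nat_numeral)
qed

text \<open>The three factors are exchanged one at a time; each exchange costs at most
  \<open>A ^ 3\<close> times the distance.\<close>

lemma diffusion_coeff_lipschitz:
  assumes "y \<in> box L R" "z \<in> box L R"
  shows "\<bar>diffusion_coeff g L R i y - diffusion_coeff g L R i z\<bar> \<le> 3 * A ^ 3 * norm (y - z)"
proof -
  let ?b = "\<lambda>y. y $ i - L $ i" and ?a = "\<lambda>y. R $ i - y $ i" and ?n = "norm (y - z)"
  have n: "\<bar>y $ i - z $ i\<bar> \<le> ?n" using component_le_norm_cart[of "y - z" i] by simp
  have g: "\<bar>g y $ i - g z $ i\<bar> \<le> A * ?n"
    using component_le_norm_cart[of "g y - g z" i] g_lip[OF y_cbox[OF assms(1)] y_cbox[OF assms(2)]] by simp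
  note b = gap_pos[OF assms(1), of i] gap_le[OF assms(1), of i] gap_pos[OF assms(2), of i] gap_le[OF assms(2), of i]
  have A2: "A * A \<le> A^3" using A_ge_1 power_increasing[of 2 3 A] by (simp add: power2_eq_square)
  have t1: "\<bar>(g y $ i - g z $ i) * ?b y * ?a y\<bar> \<le> A^3 * ?n"
  proof -
    have "\<bar>(g y $ i - g z $ i) * ?b y * ?a y\<bar> \<le> (A * ?n) * A * A"
      unfolding abs_mult using b g A_nonneg by (intro mult_mono) auto
    then show ?thesis by (simp add: eval_nat_numeral mult_ac)
  qed
  have t2: "\<bar>g z $ i * (y $ i - z $ i) * ?a y\<bar> \<le> A^3 * ?n"
  proof -
    have "\<bar>g z $ i * (y $ i - z $ i) * ?a y\<bar> \<le> A * ?n * A"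
      unfolding abs_mult using b n comp_le(2)[OF assms(2), of i] A_nonneg by (intro mult_mono) auto
    also have "\<dots> = A * A * ?n" by (simp add: mult_ac)
    also have "\<dots> \<le> A^3 * ?n" using A2 by (intro mult_right_mono) auto
    finally show ?thesis .
  qed
  have t3: "\<bar>g z $ i * ?b z * (z $ i - y $ i)\<bar> \<le> A^3 * ?n"
  proof -
    have "\<bar>g z $ i * ?b z * (z $ i - y $ i)\<bar> \<le> A * A * ?n"
      unfolding abs_mult using b n comp_le(2)[OF assms(2), of i] A_nonneg by (intro mult_mono) auto
    also have "\<dots> \<le> A^3 * ?n" using A2 by (intro mult_right_mono) auto
    finally show ?thesis .
  qed
  have "diffusion_coeff g L R i y - diffusion_coeff g L R i z
    = (g y $ i - g z $ i) * ?b y * ?a y + g z $ i * (y $ i - z $ i) * ?a y + g z $ i * ?b z * (z $ i - y $ i)"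
    by (simp add: diffusion_coeff_def algebra_simps)
  then show ?thesis using t1 t2 t3 by linarith
qed

text \<open>This a priori bound makes the squared errors integrable and settles the coarse step
  sizes.\<close>

lemma norm_box_diff_le:
  assumes "y \<in> box L R" "z \<in> box L R"
  shows "(norm (y - z))\<^sup>2 \<le> real CARD('d) * A\<^sup>2"
proof -
  have "((y - z) $ i)\<^sup>2 \<le> A\<^sup>2" for i
    using gap_pos[OF assms(1), of i] gap_pos[OF assms(2), of i] width(1)[of i] A_nonneg
    by (intro abs_le_square_iff[THEN iffD1]) auto
  then have "(\<Sum>i\<in>UNIV. ((y - z) $ i)\<^sup>2) \<le> (\<Sum>i\<in>(UNIV::'d set). A\<^sup>2)" by (rule sum_mono)
  then show ?thesis by (simp add: norm_vec_power2)
qed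

end

subsection \<open>Error propagation\<close>

text \<open>The \<open>- 1\<close> makes the induction close:
  \<open>(1 + G * h) * h * (E - 1) + G * h\<^sup>2\<close> is exactly
  \<open>h * ((1 + G * h) * E - 1)\<close>.\<close>

lemma discrete_gronwall:
  fixes a :: "nat \<Rightarrow> real"
  assumes "a 0 \<le> 0" and step: "\<And>n. n < N \<Longrightarrow> a (Suc n) \<le> (1 + G * h) * a n + G * h\<^sup>2"
    and "0 \<le> G" "0 \<le> h" "n \<le> N"
  shows "a n \<le> h * (exp (G * h * real n) - 1)"
  using assms(5)
proof (induction n)
  case (Suc n)
  let ?E = "exp (G * h * real n)"
  have "a (Suc n) \<le> (1 + G * h) * a n + G * h\<^sup>2" using step[of n] Suc.prems by simp
  also have "\<dots> \<le> (1 + G * h) * (h * (?E - 1)) + G * h\<^sup>2"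
    using Suc assms(3,4) by (intro add_right_mono mult_left_mono) auto
  also have "\<dots> = h * ((1 + G * h) * ?E - 1)" by (simp add: power2_eq_square algebra_simps)
  also have "\<dots> \<le> h * (exp (G * h) * ?E - 1)"
    using assms(4) by (intro mult_left_mono diff_right_mono mult_right_mono exp_ge_add_one_self) auto
  also have "exp (G * h) * ?E = exp (G * h * real (Suc n))" by (simp add: algebra_simps flip: exp_add)
  finally show ?case .
qed (use assms(1) in simp)

lemma set_integrable_bounded:
  fixes \<phi> :: "real \<Rightarrow> real"
  assumes [measurable]: "\<phi> \<in> borel_measurable lborel" "S \<in> sets lborel"
    and C: "\<And>u. \<bar>\<phi> u\<bar> \<le> C" and S: "emeasure lborel S < \<infinity>"
  shows "set_integrable lborel S \<phi>" "\<bar>LBINT u:S. \<phi> u\<bar> \<le> C * measure lborel S"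
proof -
  have Ci: "integrable lborel (\<lambda>u. C * indicator S u)"
    by (intro integrable_mult_right integrable_real_indicator assms(2) S)
  have le: "\<bar>indicator S u *\<^sub>R \<phi> u\<bar> \<le> C * indicator S u" for u
    using C[of u] by (auto simp: indicator_def)
  show i: "set_integrable lborel S \<phi>"
    unfolding set_integrable_def
    by (rule Bochner_Integration.integrable_bound[OF Ci])
      (use order_trans[OF le abs_ge_self] in \<open>auto intro!: AE_I2\<close>)
  have "\<bar>LBINT u:S. \<phi> u\<bar> \<le> (\<integral>u. C * indicator S u \<partial>lborel)"
    unfolding set_lebesgue_integral_def
    using Bochner_Integration.integral_norm_bound_integral[OF i[unfolded set_integrable_def] Ci] le by simp
  then show "\<bar>LBINT u:S. \<phi> u\<bar> \<le> C * measure lborel S" by simp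
qed

text \<open>The Ito integral is not a separate object here: the difference of the solution, its
  initial value and its drift integral is required to be the limit. The integral equation thereby
  holds identically in \<open>\<omega>\<close>.\<close>

locale edp_setting = box_domain L R f g A + prob_space M
  for L R :: "real^'d::finite" and f g :: "real^'d \<Rightarrow> real^'d" and A :: real and M :: "'a measure" +
  fixes T :: real and F :: "real \<Rightarrow> 'a measure" and W X :: "real \<Rightarrow> 'a \<Rightarrow> real^'d" and x0 :: "real^'d"
  assumes T_pos: "0 < T"
    and x0_box: "x0 \<in> box L R"
    and brownian: "brownian_component M T F (\<lambda>t \<omega>. W t \<omega> $ i)"
    and W_adapted: "t \<in> {0..T} \<Longrightarrow> W t \<in> borel_measurable (F t)"
    and X_adapted: "t \<in> {0..T} \<Longrightarrow> X t \<in> borel_measurable (F t)"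
    and X_joint [measurable]: "(\<lambda>(t, \<omega>). X t \<omega>) \<in> borel_measurable (lborel \<Otimes>\<^sub>M M)"
    and X_box: "\<omega> \<in> space M \<Longrightarrow> X t \<omega> \<in> box L R"
    and X_ito: "t \<in> {0..T} \<Longrightarrow> brownian_component.ito_limit M T F (\<lambda>t \<omega>. W t \<omega> $ i)
      (\<lambda>u \<omega>. diffusion_coeff g L R i (X u \<omega>)) t
      (\<lambda>\<omega>. X t \<omega> $ i - x0 $ i - (LBINT s:{0..t}. f (X s \<omega>) $ i))"

section \<open>Mean square regularity of the solution and the error of one step\<close>

context edp_setting
begin

sublocale B: brownian_component M T F "\<lambda>t \<omega>. W t \<omega> $ i" for i
  by (rule brownian)

lemma X_measurable [measurable]: "X t \<in> borel_measurable M"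
  using measurable_compose[OF measurable_Pair1'[of t lborel M] X_joint] by simp

lemma fX_measurable [measurable]:
  "(\<lambda>(u, \<omega>). f (X u \<omega>) $ i) \<in> borel_measurable (lborel \<Otimes>\<^sub>M M)"
  "(\<lambda>(u, \<omega>). diffusion_coeff g L R i (X u \<omega>)) \<in> borel_measurable (lborel \<Otimes>\<^sub>M M)"
proof -
  have [measurable]: "(\<lambda>x. X (fst x) (snd x)) \<in> borel_measurable (lborel \<Otimes>\<^sub>M M)"
    using X_joint by (simp add: case_prod_unfold)
  have eq: "k (X (fst x) (snd x)) = cut k (X (fst x) (snd x))" if "x \<in> space (lborel \<Otimes>\<^sub>M M)" for x k
    using that X_box by (auto simp: space_pair_measure cut_eq)
  have [measurable]: "(\<lambda>x. f (X (fst x) (snd x))) \<in> borel_measurable (lborel \<Otimes>\<^sub>M M)"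
    by (subst measurable_cong[OF eq]) measurable
  have [measurable]: "(\<lambda>x. g (X (fst x) (snd x))) \<in> borel_measurable (lborel \<Otimes>\<^sub>M M)"
    by (subst measurable_cong[OF eq]) measurable
  show "(\<lambda>(u, \<omega>). f (X u \<omega>) $ i) \<in> borel_measurable (lborel \<Otimes>\<^sub>M M)"
    unfolding case_prod_unfold by measurable
  show "(\<lambda>(u, \<omega>). diffusion_coeff g L R i (X u \<omega>)) \<in> borel_measurable (lborel \<Otimes>\<^sub>M M)"
    unfolding case_prod_unfold diffusion_coeff_def by measurable
qed

lemma fX_slice: "\<omega> \<in> space M \<Longrightarrow> (\<lambda>u. f (X u \<omega>) $ i) \<in> borel_measurable lborel"
  by measurable

lemma fX_le: "\<omega> \<in> space M \<Longrightarrow> \<bar>f (X u \<omega>) $ i\<bar> \<le> A"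
  by (rule comp_le(1)[OF X_box])

definition mart :: "'d \<Rightarrow> real \<Rightarrow> 'a \<Rightarrow> real" where
  "mart i t \<omega> = X t \<omega> $ i - x0 $ i - (LBINT s:{0..t}. f (X s \<omega>) $ i)"

lemma mart_ito: "t \<in> {0..T} \<Longrightarrow> B.ito_limit i (\<lambda>u \<omega>. diffusion_coeff g L R i (X u \<omega>)) t (mart i t)"
  unfolding mart_def by (rule X_ito)

lemma mart_measurable: "t \<in> {0..T} \<Longrightarrow> mart i t \<in> borel_measurable M"
  using mart_ito B.ito_limit_def by blast

lemma X_increment:
  assumes "0 \<le> t" "t \<le> t'" "\<omega> \<in> space M"
  shows "X t' \<omega> $ i = X t \<omega> $ i + (LBINT s:{t<..t'}. f (X s \<omega>) $ i) + (mart i t' \<omega> - mart i t \<omega>)"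
proof -
  have "{0..t'} = {0..t} \<union> {t<..t'}" using assms by auto
  moreover have "(LBINT s:{0..t} \<union> {t<..t'}. f (X s \<omega>) $ i)
    = (LBINT s:{0..t}. f (X s \<omega>) $ i) + (LBINT s:{t<..t'}. f (X s \<omega>) $ i)"
    by (rule set_integral_Un) (use fX_slice fX_le assms in \<open>auto intro!: set_integrable_bounded(1)[where C = A]\<close>)
  ultimately show ?thesis by (simp add: mart_def)
qed

lemma X_comp_diff_le: "y \<in> box L R \<Longrightarrow> z \<in> box L R \<Longrightarrow> \<bar>y $ i - z $ i\<bar> \<le> A"
  using gap_pos[of y i] gap_pos[of z i] width(1)[of i] by (auto simp: abs_le_iff)

lemma mart_increment_integrable:
  assumes "0 \<le> t" "t \<le> t'" "t' \<le> T"
  shows "integrable M (\<lambda>\<omega>. mart i t' \<omega> - mart i t \<omega>)"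
proof (rule integrable_const_bound)
  show "AE \<omega> in M. norm (mart i t' \<omega> - mart i t \<omega>) \<le> A + A * (t' - t)"
  proof (rule AE_I2)
    fix \<omega> assume \<omega>: "\<omega> \<in> space M"
    have "\<bar>LBINT s:{t<..t'}. f (X s \<omega>) $ i\<bar> \<le> A * measure lborel {t<..t'}"
      by (rule set_integrable_bounded(2)) (use fX_slice fX_le \<omega> assms in auto)
    moreover have "\<bar>X t' \<omega> $ i - X t \<omega> $ i\<bar> \<le> A" by (intro X_comp_diff_le X_box \<omega>)
    ultimately show "norm (mart i t' \<omega> - mart i t \<omega>) \<le> A + A * (t' - t)"
      using X_increment[OF assms(1,2) \<omega>, of i] assms by simp
  qed
  show "(\<lambda>\<omega>. mart i t' \<omega> - mart i t \<omega>) \<in> borel_measurable M"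
    by (intro borel_measurable_diff mart_measurable) (use assms in auto)
qed

text \<open>The drift contributes \<open>2 * A\<^sup>2 * (s - t)\<^sup>2\<close>, where one factor
  \<open>s - t\<close> is bounded by \<open>T\<close>. The stochastic part contributes
  \<open>2 * 4 * A ^ 6 * (s - t)\<close>, since the diffusion coefficient is at most
  \<open>A ^ 3\<close>. Both are summed over the coordinates.\<close>

definition inc_const :: real where "inc_const = real CARD('d) * (2 * A\<^sup>2 * T + 8 * A ^ 6)"

lemma inc_const_nonneg: "0 \<le> inc_const"
  using T_pos A_nonneg by (simp add: inc_const_def)

lemma integrable_square_diff:
  assumes [measurable]: "Y \<in> borel_measurable M" and "\<And>\<omega>. \<omega> \<in> space M \<Longrightarrow> Y \<omega> \<in> box L R"
  shows "integrable M (\<lambda>\<omega>. (norm (X t \<omega> - Y \<omega>))\<^sup>2)" "integrable M (\<lambda>\<omega>. (X t \<omega> $ i - Y \<omega> $ i)\<^sup>2)"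
proof -
  show "integrable M (\<lambda>\<omega>. (norm (X t \<omega> - Y \<omega>))\<^sup>2)"
    by (rule integrable_const_bound[where B = "real CARD('d) * A\<^sup>2"])
      (use norm_box_diff_le[OF X_box] assms in \<open>auto intro!: AE_I2\<close>)
  have "(X t \<omega> $ i - Y \<omega> $ i)\<^sup>2 \<le> A\<^sup>2" if "\<omega> \<in> space M" for \<omega>
    using X_comp_diff_le[OF X_box[OF that] assms(2)[OF that], of t i] A_nonneg
    by (intro abs_le_square_iff[THEN iffD1]) auto
  then show "integrable M (\<lambda>\<omega>. (X t \<omega> $ i - Y \<omega> $ i)\<^sup>2)"
    by (intro integrable_const_bound[where B = "A\<^sup>2"]) (auto intro!: AE_I2)
qed

lemma expectation_norm_square:
  assumes [measurable]: "Y \<in> borel_measurable M" and "\<And>\<omega>. \<omega> \<in> space M \<Longrightarrow> Y \<omega> \<in> box L R"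
  shows "expectation (\<lambda>\<omega>. (norm (X t \<omega> - Y \<omega>))\<^sup>2) = (\<Sum>i\<in>UNIV. expectation (\<lambda>\<omega>. (X t \<omega> $ i - Y \<omega> $ i)\<^sup>2))"
  using integrable_square_diff(2)[OF assms] by (simp add: norm_vec_power2)

text \<open>The stochastic part is estimated by the increment bound for Ito integrals with frozen
  value \<open>0\<close>; the drift part is bounded pathwise.\<close>

lemma X_increment_L2:
  assumes ts: "0 \<le> t" "t \<le> s" "s \<le> T"
  shows "expectation (\<lambda>\<omega>. (norm (X s \<omega> - X t \<omega>))\<^sup>2) \<le> inc_const * (s - t)"
proof -
  have T: "t \<in> {0..T}" "s \<in> {0..T}" using ts by auto
  have comp: "expectation (\<lambda>\<omega>. (X s \<omega> $ i - X t \<omega> $ i)\<^sup>2) \<le> (2 * A\<^sup>2 * T + 8 * A ^ 6) * (s - t)" for i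
  proof -
    define m where "m \<omega> = mart i s \<omega> - mart i t \<omega>" for \<omega>
    have [measurable]: "m \<in> borel_measurable M"
      unfolding m_def by (intro borel_measurable_diff mart_measurable T)
    have "(\<integral>\<^sup>+\<omega>. ennreal ((m \<omega>)\<^sup>2) \<partial>M)
      \<le> 4 * (\<integral>\<^sup>+\<omega>. (\<integral>\<^sup>+u\<in>{t<..s}. ennreal ((diffusion_coeff g L R i (X u \<omega>) - 0)\<^sup>2) \<partial>lborel) \<partial>M)"
      using B.ito_limit_increment_bound[OF mart_ito[OF T(1)] mart_ito[OF T(2)] ts B.bounded_meas_const fX_measurable(2), of i 0]
      by (simp add: m_def)
    also have "\<dots> \<le> 4 * (\<integral>\<^sup>+\<omega>. (\<integral>\<^sup>+u\<in>{t<..s}. ennreal (A ^ 6) \<partial>lborel) \<partial>M)"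
    proof (intro mult_left_mono nn_integral_mono mult_right_mono ennreal_leI)
      fix u \<omega> assume \<omega>: "\<omega> \<in> space M"
      have "(diffusion_coeff g L R i (X u \<omega>))\<^sup>2 \<le> (A ^ 3)\<^sup>2"
        using abs_diffusion_coeff_le[OF X_box[OF \<omega>, of u], of i] A_nonneg
        by (intro abs_le_square_iff[THEN iffD1]) auto
      then show "(diffusion_coeff g L R i (X u \<omega>) - 0)\<^sup>2 \<le> A ^ 6" by (simp flip: power_mult)
    qed auto
    also have "\<dots> = ennreal (4 * A ^ 6 * (s - t))"
      using ts A_nonneg
      by (simp add: nn_integral_cmult_indicator emeasure_space_1 ennreal_mult mult.assoc)
    finally have n: "(\<integral>\<^sup>+\<omega>. ennreal ((m \<omega>)\<^sup>2) \<partial>M) \<le> ennreal (4 * A ^ 6 * (s - t))" .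
    have mi: "integrable M (\<lambda>\<omega>. (m \<omega>)\<^sup>2)"
      using n by (intro integrableI_bounded) (auto intro: le_less_trans)
    then have me: "expectation (\<lambda>\<omega>. (m \<omega>)\<^sup>2) \<le> 4 * A ^ 6 * (s - t)"
      using n ts A_nonneg nn_integral_eq_integral[OF mi] by simp
    have le: "(X s \<omega> $ i - X t \<omega> $ i)\<^sup>2 \<le> 2 * A\<^sup>2 * (s - t)\<^sup>2 + 2 * (m \<omega>)\<^sup>2" if \<omega>: "\<omega> \<in> space M" for \<omega>
    proof -
      have "\<bar>LBINT u:{t<..s}. f (X u \<omega>) $ i\<bar> \<le> A * measure lborel {t<..s}"
        by (rule set_integrable_bounded(2)) (use fX_slice fX_le \<omega> ts in auto)
      then have "(LBINT u:{t<..s}. f (X u \<omega>) $ i)\<^sup>2 \<le> (A * (s - t))\<^sup>2"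
        using ts A_nonneg by (intro abs_le_square_iff[THEN iffD1]) auto
      moreover have "X s \<omega> $ i - X t \<omega> $ i = (LBINT u:{t<..s}. f (X u \<omega>) $ i) + m \<omega>"
        using X_increment[OF ts(1,2) \<omega>, of i] by (simp add: m_def)
      ultimately show ?thesis
        using square_add2_le[of "LBINT u:{t<..s}. f (X u \<omega>) $ i" "m \<omega>"] by (simp add: power_mult_distrib)
    qed
    have "expectation (\<lambda>\<omega>. (X s \<omega> $ i - X t \<omega> $ i)\<^sup>2) \<le> expectation (\<lambda>\<omega>. 2 * A\<^sup>2 * (s - t)\<^sup>2 + 2 * (m \<omega>)\<^sup>2)"
      by (rule integral_mono[OF integrable_square_diff(2)]) (use X_box mi le in auto)
    also have "\<dots> = 2 * A\<^sup>2 * (s - t)\<^sup>2 + 2 * expectation (\<lambda>\<omega>. (m \<omega>)\<^sup>2)" using mi by (simp add: prob_space)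
    also have "\<dots> \<le> 2 * A\<^sup>2 * (T * (s - t)) + 2 * (4 * A ^ 6 * (s - t))"
      using ts me unfolding power2_eq_square[of "s - t"]
      by (intro add_mono mult_left_mono mult_right_mono) auto
    also have "\<dots> = (2 * A\<^sup>2 * T + 8 * A ^ 6) * (s - t)" by (simp add: algebra_simps)
    finally show ?thesis .
  qed
  have "expectation (\<lambda>\<omega>. (norm (X s \<omega> - X t \<omega>))\<^sup>2) = (\<Sum>i\<in>UNIV. expectation (\<lambda>\<omega>. (X s \<omega> $ i - X t \<omega> $ i)\<^sup>2))"
    by (rule expectation_norm_square) (auto intro: X_box)
  also have "\<dots> \<le> (\<Sum>i\<in>(UNIV::'d set). (2 * A\<^sup>2 * T + 8 * A ^ 6) * (s - t))" by (rule sum_mono[OF comp])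
  finally show ?thesis by (simp add: inc_const_def)
qed

abbreviation (input) "path_dist t t' Y \<equiv>
  (\<integral>\<^sup>+\<omega>. (\<integral>\<^sup>+u\<in>{t<..t'}. ennreal ((norm (X u \<omega> - Y \<omega>))\<^sup>2) \<partial>lborel) \<partial>M)"

text \<open>After exchanging time and expectation, \<open>X u - Y\<close> is split at
  \<open>X t\<close>, so that the mean square increment bound applies at each fixed
  \<open>u\<close>. Drift and diffusion errors both reduce to this quantity.\<close>

lemma path_distance_integral:
  assumes ts: "0 \<le> t" "t \<le> t'" "t' \<le> T"
    and Y[measurable]: "Y \<in> borel_measurable M" and Yb: "\<And>\<omega>. \<omega> \<in> space M \<Longrightarrow> Y \<omega> \<in> box L R"
  shows "path_dist t t' Y
    \<le> ennreal ((t' - t) * (2 * inc_const * (t' - t) + 2 * expectation (\<lambda>\<omega>. (norm (X t \<omega> - Y \<omega>))\<^sup>2)))"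
proof -
  interpret P: pair_sigma_finite lborel M ..
  define a where "a = expectation (\<lambda>\<omega>. (norm (X t \<omega> - Y \<omega>))\<^sup>2)"
  have a0: "0 \<le> a" unfolding a_def by (intro Bochner_Integration.integral_nonneg) auto
  have "(\<integral>\<^sup>+\<omega>. (\<integral>\<^sup>+u. ennreal ((norm (X u \<omega> - Y \<omega>))\<^sup>2) * indicator {t<..t'} u \<partial>lborel) \<partial>M)
    = (\<integral>\<^sup>+u. (\<integral>\<^sup>+\<omega>. ennreal ((norm (X u \<omega> - Y \<omega>))\<^sup>2) * indicator {t<..t'} u \<partial>M) \<partial>lborel)"
    by (rule P.Fubini') measurable
  also have "\<dots> \<le> (\<integral>\<^sup>+u. ennreal (2 * inc_const * (t' - t) + 2 * a) * indicator {t<..t'} u \<partial>lborel)"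
  proof (rule nn_integral_mono)
    fix u
    have "(\<integral>\<^sup>+\<omega>. ennreal ((norm (X u \<omega> - Y \<omega>))\<^sup>2) \<partial>M) \<le> ennreal (2 * inc_const * (t' - t) + 2 * a)"
      if u: "u \<in> {t<..t'}"
    proof -
      have i1: "integrable M (\<lambda>\<omega>. (norm (X u \<omega> - X t \<omega>))\<^sup>2)"
        by (rule integrable_square_diff) (auto intro: X_box)
      have i2: "integrable M (\<lambda>\<omega>. (norm (X t \<omega> - Y \<omega>))\<^sup>2)" "integrable M (\<lambda>\<omega>. (norm (X u \<omega> - Y \<omega>))\<^sup>2)"
        by (rule integrable_square_diff(1)[OF Y], erule Yb)+
      have "expectation (\<lambda>\<omega>. (norm (X u \<omega> - Y \<omega>))\<^sup>2)
        \<le> expectation (\<lambda>\<omega>. 2 * (norm (X u \<omega> - X t \<omega>))\<^sup>2 + 2 * (norm (X t \<omega> - Y \<omega>))\<^sup>2)"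
      proof (rule integral_mono)
        fix \<omega>
        have "norm (X u \<omega> - Y \<omega>) \<le> norm (X u \<omega> - X t \<omega>) + norm (X t \<omega> - Y \<omega>)"
          using norm_triangle_ineq[of "X u \<omega> - X t \<omega>" "X t \<omega> - Y \<omega>"] by simp
        then have "(norm (X u \<omega> - Y \<omega>))\<^sup>2 \<le> (norm (X u \<omega> - X t \<omega>) + norm (X t \<omega> - Y \<omega>))\<^sup>2"
          by (rule power_mono) simp
        also have "\<dots> \<le> 2 * (norm (X u \<omega> - X t \<omega>))\<^sup>2 + 2 * (norm (X t \<omega> - Y \<omega>))\<^sup>2" by (rule square_add2_le)
        finally show "(norm (X u \<omega> - Y \<omega>))\<^sup>2 \<le> 2 * (norm (X u \<omega> - X t \<omega>))\<^sup>2 + 2 * (norm (X t \<omega> - Y \<omega>))\<^sup>2" .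
      qed (use i1 i2 in auto)
      also have "\<dots> = 2 * expectation (\<lambda>\<omega>. (norm (X u \<omega> - X t \<omega>))\<^sup>2) + 2 * a"
        using i1 i2 by (simp add: a_def)
      also have "\<dots> \<le> 2 * (inc_const * (t' - t)) + 2 * a"
      proof -
        have "expectation (\<lambda>\<omega>. (norm (X u \<omega> - X t \<omega>))\<^sup>2) \<le> inc_const * (u - t)"
          by (rule X_increment_L2) (use u ts in auto)
        also have "\<dots> \<le> inc_const * (t' - t)" using u inc_const_nonneg by (intro mult_left_mono) auto
        finally show ?thesis by simp
      qed
      finally have "expectation (\<lambda>\<omega>. (norm (X u \<omega> - Y \<omega>))\<^sup>2) \<le> 2 * inc_const * (t' - t) + 2 * a" by simp
      then show ?thesis using nn_integral_eq_integral[OF i2(2)] by (simp add: ennreal_leI)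
    qed
    then show "(\<integral>\<^sup>+\<omega>. ennreal ((norm (X u \<omega> - Y \<omega>))\<^sup>2) * indicator {t<..t'} u \<partial>M)
      \<le> ennreal (2 * inc_const * (t' - t) + 2 * a) * indicator {t<..t'} u"
      by (auto simp: indicator_def)
  qed
  also have "\<dots> = ennreal ((t' - t) * (2 * inc_const * (t' - t) + 2 * a))"
  proof -
    define K where "K = 2 * inc_const * (t' - t) + 2 * a"
    have "0 \<le> K" using ts a0 inc_const_nonneg by (simp add: K_def)
    then show ?thesis
      unfolding K_def[symmetric] using ts by (simp add: nn_integral_cmult_indicator ennreal_mult mult.commute)
  qed
  finally show ?thesis unfolding a_def .
qed

text \<open>The initial condition is encoded in the integral equation at time \<open>0\<close>. The
  zero variable is also an Ito limit at time \<open>0\<close>, and comparing the two over an empty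
  time interval forces the stochastic part to vanish in mean square.\<close>

lemma X_initial: "expectation (\<lambda>\<omega>. (norm (X 0 \<omega> - x0))\<^sup>2) = 0"
proof -
  have T: "0 \<in> {0..T}" using T_pos by simp
  have comp: "expectation (\<lambda>\<omega>. (X 0 \<omega> $ i - x0 $ i)\<^sup>2) = 0" for i
  proof -
    let ?H = "\<lambda>u \<omega>. diffusion_coeff g L R i (X u \<omega>)"
    have z: "(\<integral>\<^sup>+u\<in>{0..0}. k u \<partial>lborel) = 0" for k :: "real \<Rightarrow> ennreal"
      by (rule nn_integral_null_set) (simp add: finite_imp_null_set_lborel)
    have "B.ito_limit i ?H 0 (\<lambda>\<omega>. 0)"
      unfolding B.ito_limit_def
      by (intro conjI allI impI exI[of _ "\<lambda>u \<omega>. 0"] exI[of _ "\<lambda>\<omega>. 0"]) (simp_all add: B.simple_integral.zero z)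
    from B.ito_limit_increment_bound[OF this mart_ito[OF T] order_refl order_refl _ B.bounded_meas_const fX_measurable(2), of 0]
    have n: "(\<integral>\<^sup>+\<omega>. ennreal ((mart i 0 \<omega>)\<^sup>2) \<partial>M) \<le> 0" using T_pos by simp
    have m: "mart i 0 \<omega> = X 0 \<omega> $ i - x0 $ i" if \<omega>: "\<omega> \<in> space M" for \<omega>
    proof -
      have "\<bar>LBINT s:{0..0}. f (X s \<omega>) $ i\<bar> \<le> A * measure lborel {0..0::real}"
        by (rule set_integrable_bounded(2)) (use fX_slice fX_le \<omega> in auto)
      then show ?thesis by (simp add: mart_def)
    qed
    have "(\<integral>\<^sup>+\<omega>. ennreal ((X 0 \<omega> $ i - x0 $ i)\<^sup>2) \<partial>M) = (\<integral>\<^sup>+\<omega>. ennreal ((mart i 0 \<omega>)\<^sup>2) \<partial>M)"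
      by (rule nn_integral_cong) (simp add: m)
    then have n': "(\<integral>\<^sup>+\<omega>. ennreal ((X 0 \<omega> $ i - x0 $ i)\<^sup>2) \<partial>M) \<le> 0" using n by simp
    have i: "integrable M (\<lambda>\<omega>. (X 0 \<omega> $ i - x0 $ i)\<^sup>2)"
      by (rule integrable_square_diff) (use x0_box in auto)
    have "ennreal (expectation (\<lambda>\<omega>. (X 0 \<omega> $ i - x0 $ i)\<^sup>2)) \<le> 0"
      using n' nn_integral_eq_integral[OF i] by simp
    moreover have "0 \<le> expectation (\<lambda>\<omega>. (X 0 \<omega> $ i - x0 $ i)\<^sup>2)"
      by (intro Bochner_Integration.integral_nonneg) auto
    ultimately show ?thesis by (simp add: ennreal_eq_0_iff)
  qed
  have "expectation (\<lambda>\<omega>. (norm (X 0 \<omega> - x0))\<^sup>2) = (\<Sum>i\<in>UNIV. expectation (\<lambda>\<omega>. (X 0 \<omega> $ i - x0 $ i)\<^sup>2))"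
    by (rule expectation_norm_square) (use x0_box in auto)
  then show ?thesis using comp by simp
qed

lemma cut_comp_measurable:
  assumes [measurable]: "Y \<in> borel_measurable (F t)" and t: "t \<in> {0..T}"
    and Y: "\<And>\<omega>. \<omega> \<in> space M \<Longrightarrow> Y \<omega> \<in> box L R"
  shows "(\<lambda>\<omega>. f (Y \<omega>) $ i) \<in> borel_measurable (F t)" "(\<lambda>\<omega>. g (Y \<omega>) $ i) \<in> borel_measurable (F t)"
proof -
  have eq: "k (Y \<omega>) $ i = cut k (Y \<omega>) $ i" if "\<omega> \<in> space (F t)" for \<omega> k
    using that Y by (simp add: B.space_F[OF t] cut_eq)
  show "(\<lambda>\<omega>. f (Y \<omega>) $ i) \<in> borel_measurable (F t)" by (subst measurable_cong[OF eq]) measurable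
  show "(\<lambda>\<omega>. g (Y \<omega>) $ i) \<in> borel_measurable (F t)" by (subst measurable_cong[OF eq]) measurable
qed

lemma edp_step_measurable:
  assumes ts: "0 \<le> t" "t \<le> t'" "t' \<le> T"
    and Y: "Y \<in> borel_measurable (F t)" "\<And>\<omega>. \<omega> \<in> space M \<Longrightarrow> Y \<omega> \<in> box L R"
    and \<theta>: "\<theta> \<in> borel_measurable (F t)"
  shows "(\<lambda>\<omega>. edp_step f g L R h (Y \<omega>) (W t' \<omega> - W t \<omega>) (\<theta> \<omega>)) \<in> borel_measurable (F t')"
proof -
  have t': "t' \<in> {0..T}" using ts by auto
  have [measurable]: "Y \<in> borel_measurable (F t')" "\<theta> \<in> borel_measurable (F t')"
    "W t' \<in> borel_measurable (F t')" "W t \<in> borel_measurable (F t')"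
    using Y(1) \<theta> W_adapted[of t] W_adapted[of t'] ts by (auto intro: B.measurable_F_mono)
  have eq: "edp_step f g L R h (Y \<omega>) (W t' \<omega> - W t \<omega>) (\<theta> \<omega>)
    = edp_step (cut f) (cut g) L R h (Y \<omega>) (W t' \<omega> - W t \<omega>) (\<theta> \<omega>)" if "\<omega> \<in> space (F t')" for \<omega>
    using that Y(2) by (simp add: B.space_F[OF t'] edp_step_cut)
  show ?thesis
    by (subst measurable_cong[OF eq]) (auto intro!: borel_measurable_edp_step)
qed

text \<open>The leading \<open>2\<close> is the growth from Young's inequality. With
  \<open>U = h * (2 * inc_const * h + 2 * a)\<close> bounding the path distance and \<open>a\<close>
  the current squared error, the drift contributes \<open>5 * A\<^sup>2 * U\<close> and the
  diffusion \<open>16 * 9 * A ^ 6 * U\<close>. The factor \<open>1 + inc_const\<close> covers both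
  parts of \<open>U\<close>, and the last summand collects the \<open>w\<^sup>2 - h\<close> term and
  the remainder of the expansion.\<close>

definition step_growth :: real where
  "step_growth = 2 + 2 * (real CARD('d) * (5 * A\<^sup>2 + 144 * A ^ 6)) * (1 + inc_const)
    + real CARD('d) * (8 * (A ^ 5)\<^sup>2 + 255 * step_const\<^sup>2)"

lemma step_growth_nonneg: "0 \<le> step_growth"
  using inc_const_nonneg A_nonneg by (simp add: step_growth_def)

text \<open>Serves the drift with \<open>C = A\<close> and the diffusion with
  \<open>C = 3 * A ^ 3\<close>, the respective Lipschitz constants.\<close>

lemma path_functional_L2:
  assumes [measurable]: "Y \<in> borel_measurable M" and "0 \<le> C"
    and \<phi>: "\<And>u \<omega>. \<omega> \<in> space M \<Longrightarrow> \<bar>\<phi> u \<omega>\<bar> \<le> C * norm (X u \<omega> - Y \<omega>)"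
    and U: "path_dist t t' Y \<le> ennreal U"
  shows "(\<integral>\<^sup>+\<omega>. (\<integral>\<^sup>+u\<in>{t<..t'}. ennreal ((\<phi> u \<omega>)\<^sup>2) \<partial>lborel) \<partial>M) \<le> ennreal (C\<^sup>2 * U)"
proof -
  have "(\<integral>\<^sup>+\<omega>. (\<integral>\<^sup>+u\<in>{t<..t'}. ennreal ((\<phi> u \<omega>)\<^sup>2) \<partial>lborel) \<partial>M)
    \<le> (\<integral>\<^sup>+\<omega>. (\<integral>\<^sup>+u. ennreal (C\<^sup>2) * (ennreal ((norm (X u \<omega> - Y \<omega>))\<^sup>2) * indicator {t<..t'} u) \<partial>lborel) \<partial>M)"
  proof (intro nn_integral_mono)
    fix u \<omega> assume "\<omega> \<in> space M"
    then have "(\<phi> u \<omega>)\<^sup>2 \<le> (C * norm (X u \<omega> - Y \<omega>))\<^sup>2" using power_mono[OF \<phi>, of \<omega> u 2] by simp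
    then have "ennreal ((\<phi> u \<omega>)\<^sup>2) \<le> ennreal (C\<^sup>2) * ennreal ((norm (X u \<omega> - Y \<omega>))\<^sup>2)"
      by (simp add: power_mult_distrib ennreal_leI flip: ennreal_mult)
    then show "ennreal ((\<phi> u \<omega>)\<^sup>2) * indicator {t<..t'} u
      \<le> ennreal (C\<^sup>2) * (ennreal ((norm (X u \<omega> - Y \<omega>))\<^sup>2) * indicator {t<..t'} u)"
      by (auto simp: indicator_def)
  qed
  also have "\<dots> = (\<integral>\<^sup>+\<omega>. ennreal (C\<^sup>2) * (\<integral>\<^sup>+u\<in>{t<..t'}. ennreal ((norm (X u \<omega> - Y \<omega>))\<^sup>2) \<partial>lborel) \<partial>M)"
    by (intro nn_integral_cong nn_integral_cmult) measurable
  also have "\<dots> = ennreal (C\<^sup>2) * path_dist t t' Y"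
    by (rule nn_integral_cmult) measurable
  also have "\<dots> \<le> ennreal (C\<^sup>2) * ennreal U" using U by (rule mult_left_mono) simp
  also have "\<dots> = ennreal (C\<^sup>2 * U)" by (simp add: ennreal_mult')
  finally show ?thesis .
qed

text \<open>Cauchy-Schwarz in time yields the factor \<open>t' - t\<close>. It compensates the
  division by the step size in the one-step estimate.\<close>

lemma drift_difference_L2:
  assumes ts: "0 \<le> t" "t < t'" "t' \<le> T"
    and Y: "Y \<in> borel_measurable (F t)" "\<And>\<omega>. \<omega> \<in> space M \<Longrightarrow> Y \<omega> \<in> box L R"
    and U: "path_dist t t' Y \<le> ennreal U" "0 \<le> U"
  shows "(\<lambda>\<omega>. LBINT u:{t<..t'}. f (X u \<omega>) $ i - f (Y \<omega>) $ i) \<in> borel_measurable M" (is "?P \<in> _")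
    and "integrable M (\<lambda>\<omega>. (LBINT u:{t<..t'}. f (X u \<omega>) $ i - f (Y \<omega>) $ i)\<^sup>2)"
    and "expectation (\<lambda>\<omega>. (LBINT u:{t<..t'}. f (X u \<omega>) $ i - f (Y \<omega>) $ i)\<^sup>2) \<le> (t' - t) * A\<^sup>2 * U"
proof -
  have t: "t \<in> {0..T}" using ts by auto
  have [measurable]: "Y \<in> borel_measurable M" by (rule B.measurable_F[OF t Y(1)])
  have [measurable]: "(\<lambda>\<omega>. f (Y \<omega>) $ i) \<in> borel_measurable M"
    by (rule B.measurable_F[OF t cut_comp_measurable(1)[OF Y(1) t Y(2)]])
  show P[measurable]: "?P \<in> borel_measurable M"
    unfolding set_lebesgue_integral_def by measurable
  have lip: "\<bar>f (X u \<omega>) $ i - f (Y \<omega>) $ i\<bar> \<le> A * norm (X u \<omega> - Y \<omega>)" if "\<omega> \<in> space M" for u \<omega>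
    using component_le_norm_cart[of "f (X u \<omega>) - f (Y \<omega>)" i]
      f_lip[OF y_cbox[OF X_box[OF that, of u]] y_cbox[OF Y(2)[OF that]]] by simp
  have "(\<integral>\<^sup>+\<omega>. ennreal ((?P \<omega>)\<^sup>2) \<partial>M) \<le> (\<integral>\<^sup>+\<omega>. ennreal (t' - t)
    * (\<integral>\<^sup>+u\<in>{t<..t'}. ennreal ((f (X u \<omega>) $ i - f (Y \<omega>) $ i)\<^sup>2) \<partial>lborel) \<partial>M)"
  proof (rule nn_integral_mono)
    fix \<omega> assume \<omega>: "\<omega> \<in> space M"
    define \<phi> where "\<phi> u = f (X u \<omega>) $ i - f (Y \<omega>) $ i" for u
    have [measurable]: "\<phi> \<in> borel_measurable lborel" unfolding \<phi>_def using \<omega> by measurable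
    have \<phi>b: "\<bar>\<phi> u\<bar> \<le> 2 * A" for u
      using fX_le[OF \<omega>, of u i] comp_le(1)[OF Y(2)[OF \<omega>], of i] unfolding \<phi>_def by linarith
    have \<phi>2b: "\<bar>(\<phi> u)\<^sup>2\<bar> \<le> (2 * A)\<^sup>2" for u
      using power_mono[OF \<phi>b[of u], of 2] by simp
    have i1: "set_integrable lborel {t<..t'} \<phi>"
      by (rule set_integrable_bounded(1)[OF _ _ \<phi>b]) (use ts in auto)
    have i2: "set_integrable lborel {t<..t'} (\<lambda>u. (\<phi> u)\<^sup>2)"
      by (rule set_integrable_bounded(1)[OF _ _ \<phi>2b]) (use ts in auto)
    have "(?P \<omega>)\<^sup>2 \<le> (t' - t) * (LBINT u:{t<..t'}. (\<phi> u)\<^sup>2)"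
      using set_integral_square_le[OF ts(2) i1 i2] by (simp add: \<phi>_def)
    then have "ennreal ((?P \<omega>)\<^sup>2) \<le> ennreal ((t' - t) * (LBINT u:{t<..t'}. (\<phi> u)\<^sup>2))" by (rule ennreal_leI)
    also have "\<dots> = ennreal (t' - t) * ennreal (LBINT u:{t<..t'}. (\<phi> u)\<^sup>2)"
      using ts by (simp add: ennreal_mult')
    also have "ennreal (LBINT u:{t<..t'}. (\<phi> u)\<^sup>2) = (\<integral>\<^sup>+u. ennreal (indicator {t<..t'} u *\<^sub>R (\<phi> u)\<^sup>2) \<partial>lborel)"
      unfolding set_lebesgue_integral_def
      using i2 unfolding set_integrable_def by (intro nn_integral_eq_integral[symmetric]) (auto simp: indicator_def)
    also have "\<dots> = (\<integral>\<^sup>+u\<in>{t<..t'}. ennreal ((\<phi> u)\<^sup>2) \<partial>lborel)"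
      by (intro nn_integral_cong) (auto simp: indicator_def)
    finally show "ennreal ((?P \<omega>)\<^sup>2) \<le> ennreal (t' - t)
      * (\<integral>\<^sup>+u\<in>{t<..t'}. ennreal ((f (X u \<omega>) $ i - f (Y \<omega>) $ i)\<^sup>2) \<partial>lborel)" unfolding \<phi>_def .
  qed
  also have "\<dots> = ennreal (t' - t)
      * (\<integral>\<^sup>+\<omega>. (\<integral>\<^sup>+u\<in>{t<..t'}. ennreal ((f (X u \<omega>) $ i - f (Y \<omega>) $ i)\<^sup>2) \<partial>lborel) \<partial>M)"
    by (rule nn_integral_cmult) measurable
  also have "\<dots> \<le> ennreal (t' - t) * ennreal (A\<^sup>2 * U)"
    by (intro mult_left_mono path_functional_L2[OF _ A_nonneg lip U(1)]) auto
  also have "\<dots> = ennreal ((t' - t) * A\<^sup>2 * U)" using ts by (simp add: ennreal_mult' mult.assoc)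
  finally have n: "(\<integral>\<^sup>+\<omega>. ennreal ((?P \<omega>)\<^sup>2) \<partial>M) \<le> ennreal ((t' - t) * A\<^sup>2 * U)" .
  show Pi: "integrable M (\<lambda>\<omega>. (?P \<omega>)\<^sup>2)"
    using n by (intro integrableI_bounded) (auto intro: le_less_trans)
  show "expectation (\<lambda>\<omega>. (?P \<omega>)\<^sup>2) \<le> (t' - t) * A\<^sup>2 * U"
    using n nn_integral_eq_integral[OF Pi] ts U(2) by simp
qed

text \<open>The scalar estimate is applied to each coordinate, with the diffusion frozen at the
  numerical state. Since the Lipschitz bounds involve the full norm, the coordinates are coupled
  through \<open>U\<close>, and only the sum over all of them yields a closed recursion.\<close>

lemma edp_one_step_error:
  fixes t t' :: real and Y \<theta> :: "'a \<Rightarrow> real^'d"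
  defines "h \<equiv> t' - t"
  defines "Y' \<equiv> \<lambda>\<omega>. edp_step f g L R h (Y \<omega>) (W t' \<omega> - W t \<omega>) (\<theta> \<omega>)"
  assumes ts: "0 \<le> t" "t < t'" "t' \<le> T" and small: "12 * A ^ 4 * h \<le> 1"
    and Y: "Y \<in> borel_measurable (F t)" "\<And>\<omega>. \<omega> \<in> space M \<Longrightarrow> Y \<omega> \<in> box L R"
    and \<theta>: "\<theta> \<in> borel_measurable (F t)" "\<And>\<omega> i. \<omega> \<in> space M \<Longrightarrow> 0 < \<theta> \<omega> $ i \<and> \<theta> \<omega> $ i < 1"
  shows "expectation (\<lambda>\<omega>. (norm (X t' \<omega> - Y' \<omega>))\<^sup>2)
    \<le> (1 + step_growth * h) * expectation (\<lambda>\<omega>. (norm (X t \<omega> - Y \<omega>))\<^sup>2) + step_growth * h\<^sup>2"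
proof -
  let ?e = "\<lambda>i. expectation (\<lambda>\<omega>. (X t \<omega> $ i - Y \<omega> $ i)\<^sup>2)"
  let ?e' = "\<lambda>i. expectation (\<lambda>\<omega>. (X t' \<omega> $ i - Y' \<omega> $ i)\<^sup>2)"
  have t: "t \<in> {0..T}" and t': "t' \<in> {0..T}" and tle: "t \<le> t'" using ts by auto
  have h0: "0 < h" using ts by (simp add: h_def)
  have "1 * h \<le> A ^ 4 * h" using A_ge_1 h0 by (intro mult_right_mono one_le_power) auto
  then have h1: "h \<le> 1" using small by linarith
  have Y'F: "Y' \<in> borel_measurable (F t')"
    unfolding Y'_def by (rule edp_step_measurable[OF ts(1) tle ts(3) Y \<theta>(1)])
  have Y'M: "Y' \<in> borel_measurable M" and YM: "Y \<in> borel_measurable M"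
    by (rule B.measurable_F[OF t' Y'F], rule B.measurable_F[OF t Y(1)])
  have Y'b: "Y' \<omega> \<in> box L R" if "\<omega> \<in> space M" for \<omega>
    unfolding Y'_def by (rule edp_step_mem_box[OF Y(2)[OF that] less_imp_le[OF h0] \<theta>(2)[OF that]])
  define a where "a = expectation (\<lambda>\<omega>. (norm (X t \<omega> - Y \<omega>))\<^sup>2)"
  have a0: "0 \<le> a" unfolding a_def by (intro Bochner_Integration.integral_nonneg) auto
  define U where "U = h * (2 * inc_const * h + 2 * a)"
  have U0: "0 \<le> U" using h0 a0 inc_const_nonneg by (simp add: U_def)
  have U: "path_dist t t' Y \<le> ennreal U"
    using path_distance_integral[OF ts(1) tle ts(3) YM Y(2)] unfolding U_def a_def h_def .
  have comp: "?e' i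
    \<le> (1 + 2 * h) * ?e i
      + ((5 * A\<^sup>2 + 144 * A ^ 6) * U + (8 * (A ^ 5)\<^sup>2 + 255 * step_const\<^sup>2) * h\<^sup>2)" for i
  proof -
    define w where "w \<omega> = W t' \<omega> $ i - W t \<omega> $ i" for \<omega>
    define Z where "Z \<omega> = diffusion_coeff g L R i (Y \<omega>)" for \<omega>
    define m where "m \<omega> = step_coeff g L R (Y \<omega>) (\<theta> \<omega>) i" for \<omega>
    define P where "P \<omega> = (LBINT u:{t<..t'}. f (X u \<omega>) $ i - f (Y \<omega>) $ i)" for \<omega>
    \<comment> \<open>The remainder is defined as the defect of the expansion, so that the
      decomposition of the new error is an identity; its size is a separate matter.\<close>
    define r where "r \<omega> = Y' \<omega> $ i - (Y \<omega> $ i + f (Y \<omega>) $ i * h + Z \<omega> * w \<omega> + m \<omega> * ((w \<omega>)\<^sup>2 - h))" for \<omega>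
    note gY = cut_comp_measurable[OF Y(1) t Y(2)]
    note [measurable] = Y(1) \<theta>(1) X_adapted[OF t]
    have ZF: "Z \<in> borel_measurable (F t)" unfolding Z_def diffusion_coeff_def using gY(2) by measurable
    have mF: "m \<in> borel_measurable (F t)" unfolding m_def step_coeff_def using gY(2) by measurable
    have eF: "(\<lambda>\<omega>. X t \<omega> $ i - Y \<omega> $ i) \<in> borel_measurable (F t)" by measurable
    have mb: "\<bar>m \<omega>\<bar> \<le> A ^ 5" if "\<omega> \<in> space M" for \<omega>
      unfolding m_def using abs_step_coeff_le[OF Y(2)[OF that]] \<theta>(2)[OF that] by blast
    have bm: "B.bounded_meas t (\<lambda>\<omega>. X t \<omega> $ i - Y \<omega> $ i)" "B.bounded_meas t Z" "B.bounded_meas t m"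
      unfolding B.bounded_meas_def
    proof (safe intro!: ZF mF eF exI)
      show "\<bar>X t \<omega> $ i - Y \<omega> $ i\<bar> \<le> A" if "\<omega> \<in> space M" for \<omega>
        by (rule X_comp_diff_le[OF X_box[OF that] Y(2)[OF that]])
      show "\<bar>Z \<omega>\<bar> \<le> A ^ 3" if "\<omega> \<in> space M" for \<omega>
        unfolding Z_def by (rule abs_diffusion_coeff_le[OF Y(2)[OF that]])
    qed (rule mb)
    note PP = drift_difference_L2[OF ts Y U U0, of i, folded P_def h_def]
    have rM: "r \<in> borel_measurable M"
    proof -
      note [measurable] = B.measurable_F[OF t ZF] B.measurable_F[OF t mF] B.measurable_F[OF t gY(1)] Y'M YM
        B.B_measurable[OF t] B.B_measurable[OF t']
      show ?thesis unfolding r_def w_def by measurable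
    qed
    have rb: "\<bar>r \<omega>\<bar> \<le> step_const * (h\<^sup>2 + h * \<bar>w \<omega>\<bar> + \<bar>w \<omega>\<bar> ^ 3)" if "\<omega> \<in> space M" for \<omega>
      using edp_step_expansion[OF Y(2)[OF that] less_imp_le[OF h0] small, of "\<theta> \<omega>" i "W t' \<omega> - W t \<omega>"] \<theta>(2)[OF that, of i]
      by (simp add: r_def Y'_def Z_def m_def w_def)
    have V: "(\<integral>\<^sup>+\<omega>. (\<integral>\<^sup>+u\<in>{t<..t'}. ennreal ((diffusion_coeff g L R i (X u \<omega>) - Z \<omega>)\<^sup>2) \<partial>lborel) \<partial>M)
      \<le> ennreal (9 * A ^ 6 * U)"
    proof -
      have "\<bar>diffusion_coeff g L R i (X u \<omega>) - Z \<omega>\<bar> \<le> 3 * A ^ 3 * norm (X u \<omega> - Y \<omega>)" if "\<omega> \<in> space M" for u \<omega>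
        unfolding Z_def by (rule diffusion_coeff_lipschitz[OF X_box[OF that] Y(2)[OF that]])
      from path_functional_L2[OF YM _ this U] show ?thesis
        using A_nonneg by (simp add: power_mult_distrib flip: power_mult)
    qed
    have e': "X t' \<omega> $ i - Y' \<omega> $ i = (X t \<omega> $ i - Y \<omega> $ i) + P \<omega>
      + (mart i t' \<omega> - mart i t \<omega> - Z \<omega> * (W t' \<omega> $ i - W t \<omega> $ i))
      - m \<omega> * ((W t' \<omega> $ i - W t \<omega> $ i)\<^sup>2 - (t' - t)) - r \<omega>" if \<omega>: "\<omega> \<in> space M" for \<omega>
    proof -
      have "P \<omega> = (LBINT u:{t<..t'}. f (X u \<omega>) $ i) - (LBINT u:{t<..t'}. f (Y \<omega>) $ i)"
        unfolding P_def
      proof (rule set_integral_diff)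
        show "set_integrable lborel {t<..t'} (\<lambda>u. f (X u \<omega>) $ i)"
          by (rule set_integrable_bounded(1)[OF fX_slice[OF \<omega>] _ fX_le[OF \<omega>]]) (use ts in auto)
        show "set_integrable lborel {t<..t'} (\<lambda>u. f (Y \<omega>) $ i)"
          by (rule set_integrable_bounded(1)[where C = "\<bar>f (Y \<omega>) $ i\<bar>"]) (use ts in auto)
      qed
      also have "(LBINT u:{t<..t'}. f (Y \<omega>) $ i) = f (Y \<omega>) $ i * h"
        using ts by (simp add: set_lebesgue_integral_def h_def)
      finally have "(LBINT u:{t<..t'}. f (X u \<omega>) $ i) = P \<omega> + f (Y \<omega>) $ i * h" by simp
      then show ?thesis
        using X_increment[OF ts(1) tle \<omega>, of i] by (simp add: r_def w_def h_def)
    qed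
    have "?e' i
      \<le> (1 + 2 * (t' - t)) * ?e i
        + 5 / (t' - t) * expectation (\<lambda>\<omega>. (P \<omega>)\<^sup>2) + 16 * (9 * A ^ 6 * U)
        + (8 * (A ^ 5)\<^sup>2 + 255 * step_const\<^sup>2) * (t' - t)\<^sup>2"
      by (rule B.one_step_error(2)[OF ts h1[unfolded h_def] mart_ito[OF t] mart_ito[OF t']
            mart_increment_integrable[OF ts(1) tle ts(3)] fX_measurable(2) bm mb PP(1,2) rM _ V _ e'])
        (use rb[unfolded w_def h_def] U0 A_nonneg in auto)
    also have "\<dots> \<le> (1 + 2 * (t' - t)) * ?e i
        + 5 / (t' - t) * (h * A\<^sup>2 * U) + 16 * (9 * A ^ 6 * U)
        + (8 * (A ^ 5)\<^sup>2 + 255 * step_const\<^sup>2) * (t' - t)\<^sup>2"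
      using PP(3) ts by (intro add_mono order_refl mult_left_mono) auto
    also have "\<dots> = (1 + 2 * h) * ?e i
      + ((5 * A\<^sup>2 + 144 * A ^ 6) * U + (8 * (A ^ 5)\<^sup>2 + 255 * step_const\<^sup>2) * h\<^sup>2)"
    proof -
      have "5 / h * (h * A\<^sup>2 * U) = 5 * A\<^sup>2 * U" using h0 by simp
      then show ?thesis unfolding h_def[symmetric] by (simp add: distrib_right)
    qed
    finally show ?thesis .
  qed
  have "expectation (\<lambda>\<omega>. (norm (X t' \<omega> - Y' \<omega>))\<^sup>2) = (\<Sum>i\<in>UNIV. ?e' i)"
    by (rule expectation_norm_square[OF Y'M Y'b])
  also have "\<dots> \<le> (\<Sum>i\<in>UNIV. (1 + 2 * h) * ?e i
      + ((5 * A\<^sup>2 + 144 * A ^ 6) * U + (8 * (A ^ 5)\<^sup>2 + 255 * step_const\<^sup>2) * h\<^sup>2))"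
    by (rule sum_mono[OF comp])
  also have "\<dots> = (1 + 2 * h) * a
      + real CARD('d) * ((5 * A\<^sup>2 + 144 * A ^ 6) * U + (8 * (A ^ 5)\<^sup>2 + 255 * step_const\<^sup>2) * h\<^sup>2)"
  proof -
    have "a = (\<Sum>i\<in>UNIV. ?e i)"
      unfolding a_def by (rule expectation_norm_square[OF YM Y(2)])
    then show ?thesis by (simp add: sum.distrib flip: sum_distrib_left)
  qed
  also have "\<dots> \<le> (1 + step_growth * h) * a + step_growth * h\<^sup>2"
  proof -
    define q where "q = real CARD('d) * (5 * A\<^sup>2 + 144 * A ^ 6)"
    define p where "p = real CARD('d) * (8 * (A ^ 5)\<^sup>2 + 255 * step_const\<^sup>2)"
    have qp: "0 \<le> q" "0 \<le> p" using A_nonneg by (auto simp: q_def p_def)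
    have G: "step_growth = 2 + 2 * q * (1 + inc_const) + p" by (simp add: step_growth_def q_def p_def)
    have "(1 + step_growth * h) * a + step_growth * h\<^sup>2
      = (1 + 2 * h) * a + (q * U + p * h\<^sup>2) + (2 * q * inc_const * h * a + p * h * a + 2 * h\<^sup>2 + 2 * q * h\<^sup>2)"
      unfolding G U_def by (simp add: power2_eq_square algebra_simps)
    moreover have "0 \<le> 2 * q * inc_const * h * a + p * h * a + 2 * h\<^sup>2 + 2 * q * h\<^sup>2"
      using qp inc_const_nonneg h0 a0 by simp
    moreover have "real CARD('d) * ((5 * A\<^sup>2 + 144 * A ^ 6) * U + (8 * (A ^ 5)\<^sup>2 + 255 * step_const\<^sup>2) * h\<^sup>2)
      = q * U + p * h\<^sup>2" by (simp add: q_def p_def algebra_simps)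
    ultimately show ?thesis by linarith
  qed
  finally show ?thesis unfolding a_def .
qed

text \<open>The summand \<open>1\<close> allows the Gronwall bound to be multiplied by the constant,
  \<open>step_growth\<close> is the rate in the exponent, and the last summand covers coarse
  steps.\<close>

definition conv_const :: real where
  "conv_const = 1 + step_growth + 12 * (real CARD('d) * A ^ 6)"

lemma conv_const_pos: "0 < conv_const"
  using step_growth_nonneg A_nonneg by (simp add: conv_const_def add_pos_nonneg)

section \<open>The error over the whole grid\<close>

context
  fixes N :: nat and \<theta> :: "nat \<Rightarrow> 'a \<Rightarrow> real^'d"
  assumes N: "1 \<le> N"
    and \<theta>_measurable: "\<And>n. n < N \<Longrightarrow> \<theta> n \<in> borel_measurable (F (real n * (T / real N)))"
    and \<theta>_range: "\<And>n \<omega> i. n < N \<Longrightarrow> \<omega> \<in> space M \<Longrightarrow> 0 < \<theta> n \<omega> $ i \<and> \<theta> n \<omega> $ i < 1"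
begin

abbreviation (input) "h \<equiv> T / real N"
abbreviation (input) "Y \<equiv> edp f g L R x0 W h \<theta>"

lemma h_pos: "0 < h" using T_pos N by simp

lemma grid: "n \<le> N \<Longrightarrow> 0 \<le> real n * h \<and> real n * h \<le> T"
  using T_pos N by (simp add: field_simps)

lemma grid_Suc: "real (Suc n) * h = real n * h + h"
  by (simp add: algebra_simps add_divide_distrib)

text \<open>Measurability and range are proved together: a step is known to be measurable only when
  the preceding state lies in the box.\<close>

lemma edp_adapted:
  assumes "n \<le> N"
  shows "Y n \<in> borel_measurable (F (real n * h)) \<and> (\<forall>\<omega>\<in>space M. Y n \<omega> \<in> box L R)"
  using assms
proof (induction n)
  case (Suc n)
  let ?t = "real n * h" and ?t' = "real (Suc n) * h"
  have IH: "Y n \<in> borel_measurable (F ?t)" "\<And>\<omega>. \<omega> \<in> space M \<Longrightarrow> Y n \<omega> \<in> box L R"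
    using Suc by auto
  have ts: "0 \<le> ?t" "?t \<le> ?t'" "?t' \<le> T"
    using grid[of n] grid[of "Suc n"] Suc.prems h_pos unfolding grid_Suc by linarith+
  have n: "n < N" using Suc.prems by simp
  have "(\<lambda>\<omega>. edp_step f g L R h (Y n \<omega>) (W ?t' \<omega> - W ?t \<omega>) (\<theta> n \<omega>)) \<in> borel_measurable (F ?t')"
    by (rule edp_step_measurable[OF ts IH \<theta>_measurable[OF n]])
  moreover have "edp_step f g L R h (Y n \<omega>) (W ?t' \<omega> - W ?t \<omega>) (\<theta> n \<omega>) \<in> box L R"
    if "\<omega> \<in> space M" for \<omega>
    by (rule edp_step_mem_box[OF IH(2)[OF that] less_imp_le[OF h_pos] \<theta>_range[OF n that]])
  moreover have "Y (Suc n) = (\<lambda>\<omega>. edp_step f g L R h (Y n \<omega>) (W ?t' \<omega> - W ?t \<omega>) (\<theta> n \<omega>))"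
    by (simp add: fun_eq_iff)
  ultimately show ?case by simp
next
  case 0
  have "(\<lambda>\<omega>. x0) \<in> borel_measurable (F 0)" by simp
  moreover have "Y 0 = (\<lambda>\<omega>. x0)" by (simp add: fun_eq_iff)
  ultimately show ?case using x0_box by simp
qed

lemma edp_measurable: "n \<le> N \<Longrightarrow> Y n \<in> borel_measurable M"
  using edp_adapted[of n] grid[of n] B.measurable_F[of "real n * h" "Y n"] by auto

lemma edp_error:
  assumes n: "n \<le> N"
  shows "expectation (\<lambda>\<omega>. (norm (X (real n * h) \<omega> - Y n \<omega>))\<^sup>2) \<le> conv_const * h * exp (conv_const * T)"
proof -
  define a where "a n = expectation (\<lambda>\<omega>. (norm (X (real n * h) \<omega> - Y n \<omega>))\<^sup>2)" for n
  have e1: "1 \<le> exp (conv_const * T)" using conv_const_pos T_pos by simp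
  have "a n \<le> conv_const * h * exp (conv_const * T)"
  proof (cases "12 * A ^ 4 * h \<le> 1")
    case True
    have "a n \<le> h * (exp (step_growth * h * real n) - 1)"
    proof (rule discrete_gronwall[where N = N])
      have "Y 0 = (\<lambda>\<omega>. x0)" by (simp add: fun_eq_iff)
      then show "a 0 \<le> 0" using X_initial by (simp add: a_def)
      fix k assume k: "k < N"
      let ?t = "real k * h" and ?t' = "real (Suc k) * h"
      have ts: "0 \<le> ?t" "?t < ?t'" "?t' \<le> T"
        using grid[of k] grid[of "Suc k"] k h_pos unfolding grid_Suc by linarith+
      have d: "?t' - ?t = h" unfolding grid_Suc by simp
      have Yk: "Y k \<in> borel_measurable (F ?t)" "\<And>\<omega>. \<omega> \<in> space M \<Longrightarrow> Y k \<omega> \<in> box L R"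
        using edp_adapted[of k] k by auto
      have "Y (Suc k) = (\<lambda>\<omega>. edp_step f g L R (?t' - ?t) (Y k \<omega>) (W ?t' \<omega> - W ?t \<omega>) (\<theta> k \<omega>))"
        unfolding d by (simp add: fun_eq_iff)
      then show "a (Suc k) \<le> (1 + step_growth * h) * a k + step_growth * h\<^sup>2"
        using edp_one_step_error[OF ts _ Yk \<theta>_measurable[OF k] \<theta>_range[OF k]] True
        unfolding a_def d by simp
    qed (use n step_growth_nonneg h_pos in auto)
    also have "\<dots> \<le> h * exp (conv_const * T)"
    proof (intro mult_left_mono)
      have "step_growth * (h * real n) \<le> conv_const * T"
        using grid[OF n] step_growth_nonneg A_nonneg conv_const_pos
        by (intro mult_mono) (auto simp: conv_const_def mult.commute)
      then have "exp (step_growth * h * real n) \<le> exp (conv_const * T)" by (simp add: mult.assoc)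
      then show "exp (step_growth * h * real n) - 1 \<le> exp (conv_const * T)" by linarith
    qed (use h_pos in simp)
    also have "\<dots> \<le> conv_const * (h * exp (conv_const * T))"
    proof -
      have "1 \<le> conv_const" using step_growth_nonneg A_nonneg by (simp add: conv_const_def)
      moreover have "0 \<le> h * exp (conv_const * T)" using h_pos by (intro mult_nonneg_nonneg) auto
      ultimately show ?thesis using mult_right_mono[of 1 conv_const "h * exp (conv_const * T)"] by simp
    qed
    finally show ?thesis by (simp add: mult.assoc)
  next
    \<comment> \<open>Here \<open>1 < 12 * A ^ 4 * h\<close>, so the a priori bound
      \<open>CARD('d) * A\<^sup>2\<close> for the squared error can be multiplied by
      \<open>12 * A ^ 4 * h\<close>.\<close>
    case False
    have A2: "0 \<le> real CARD('d) * A\<^sup>2" by simp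
    have Yn: "Y n \<in> borel_measurable M" "\<And>\<omega>. \<omega> \<in> space M \<Longrightarrow> Y n \<omega> \<in> box L R"
      using edp_measurable[OF n] edp_adapted[OF n] by auto
    have "a n \<le> expectation (\<lambda>\<omega>. real CARD('d) * A\<^sup>2)"
      unfolding a_def
      by (rule integral_mono[OF integrable_square_diff(1)[OF Yn]]) (use norm_box_diff_le[OF X_box Yn(2)] in auto)
    then have "a n \<le> real CARD('d) * A\<^sup>2 * 1" by (simp add: prob_space)
    also have "\<dots> \<le> real CARD('d) * A\<^sup>2 * (12 * A ^ 4 * h)"
      using False A2 by (intro mult_left_mono) auto
    also have "\<dots> = 12 * (real CARD('d) * A ^ 6) * h" by (simp add: eval_nat_numeral)
    also have "\<dots> \<le> conv_const * h"
      using step_growth_nonneg h_pos by (intro mult_right_mono) (auto simp: conv_const_def)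
    also have "\<dots> \<le> conv_const * h * exp (conv_const * T)"
    proof -
      have "0 \<le> conv_const * h" by (intro mult_nonneg_nonneg less_imp_le conv_const_pos h_pos)
      from mult_left_mono[OF e1 this] show ?thesis by (simp only: mult_1_right)
    qed
    finally show ?thesis .
  qed
  then show ?thesis unfolding a_def .
qed

end

end

section \<open>From the hypotheses of the theorem to the uniform constant and the regular
  solution\<close>

lemma box_domain_exists:
  fixes L R :: "real^'d::finite"
  assumes LR: "\<And>i. L $ i < R $ i"
    and f: "C1_on (closure (box L R)) f" and g: "C1_on (closure (box L R)) g"
    and fl: "\<And>i y. y \<in> closure (box L R) \<Longrightarrow> f (coord_subst i (L $ i) y) $ i \<ge> 0"
    and fr: "\<And>i y. y \<in> closure (box L R) \<Longrightarrow> f (coord_subst i (R $ i) y) $ i \<le> 0"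
  obtains A where "box_domain L R f g A"
proof -
  have "box L R \<noteq> {}" using LR by (simp add: interval_ne_empty_cart)
  then have cl: "closure (box L R) = cbox L R" by (rule closure_box)
  obtain K1 where K1: "0 \<le> K1" "\<And>x. x \<in> cbox L R \<Longrightarrow> norm (f x) \<le> K1"
    "\<And>x y. x \<in> cbox L R \<Longrightarrow> y \<in> cbox L R \<Longrightarrow> norm (f x - f y) \<le> K1 * norm (x - y)"
    using C1_on_cbox_bounds[OF f[unfolded cl]] by auto
  obtain K2 where K2: "0 \<le> K2" "\<And>x. x \<in> cbox L R \<Longrightarrow> norm (g x) \<le> K2"
    "\<And>x y. x \<in> cbox L R \<Longrightarrow> y \<in> cbox L R \<Longrightarrow> norm (g x - g y) \<le> K2 * norm (x - y)"
    using C1_on_cbox_bounds[OF g[unfolded cl]] by auto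
  \<comment> \<open>Sums of positive terms serve as bounds for all widths and for all reciprocal
    widths at once.\<close>
  define S1 S2 where "S1 = (\<Sum>i\<in>UNIV. R $ i - L $ i)" and "S2 = (\<Sum>i\<in>UNIV. 1 / (R $ i - L $ i))"
  have S1: "R $ i - L $ i \<le> S1" for i
    unfolding S1_def by (rule member_le_sum) (use LR in \<open>auto simp: less_imp_le\<close>)
  have S2: "1 / (R $ i - L $ i) \<le> S2" for i
    unfolding S2_def by (rule member_le_sum) (use LR in \<open>auto simp: less_imp_le\<close>)
  have S0: "0 \<le> S1" "0 \<le> S2"
    unfolding S1_def S2_def using LR by (auto intro!: sum_nonneg simp: less_imp_le)
  define A where "A = 1 + K1 + K2 + S1 + S2"
  have A: "K1 \<le> A" "K2 \<le> A" "S1 \<le> A" "S2 \<le> A" "1 \<le> A" using K1(1) K2(1) S0 by (auto simp: A_def)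
  have "box_domain L R f g A"
  proof
    fix i y z
    show "L $ i < R $ i" by (rule LR)
    show "1 \<le> A" by (rule A)
    show "R $ i - L $ i \<le> A" using S1[of i] A by linarith
    show "1 \<le> A * (R $ i - L $ i)"
      using order_trans[OF S2[of i] A(4)] LR[of i] by (simp add: divide_le_eq)
    assume y: "y \<in> cbox L R"
    show "norm (f y) \<le> A" using K1(2)[OF y] A by linarith
    show "norm (g y) \<le> A" using K2(2)[OF y] A by linarith
    show "0 \<le> f (coord_subst i (L $ i) y) $ i" "f (coord_subst i (R $ i) y) $ i \<le> 0"
      using fl fr y by (auto simp: cl)
    assume z: "z \<in> cbox L R"
    show "norm (f y - f z) \<le> A * norm (y - z)"
      using K1(3)[OF y z] mult_right_mono[OF A(1) norm_ge_zero[of "y - z"]] by linarith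
    show "norm (g y - g z) \<le> A * norm (y - z)"
      using K2(3)[OF y z] mult_right_mono[OF A(2) norm_ge_zero[of "y - z"]] by linarith
  qed
  then show ?thesis by (rule that)
qed

theorem theorem2:
  fixes M :: "'a measure"
    and F :: "real \<Rightarrow> 'a measure"
    and W X :: "real \<Rightarrow> 'a \<Rightarrow> real^'d::finite"
    and T :: real
    and L R x0 :: "real^'d"
    and f g :: "real^'d \<Rightarrow> real^'d"
    and \<theta> :: "nat \<Rightarrow> nat \<Rightarrow> 'a \<Rightarrow> real^'d"
  assumes "prob_space M"
    and "0 < T"
    and "normal_filtration M T F"
    and "brownian_motion M T F W"
    and "\<And>i. L $ i < R $ i"
    and "C1_on (closure (box L R)) f"
    and "C1_on (closure (box L R)) g"
    and "\<And>i y. y \<in> closure (box L R) \<Longrightarrow> f (coord_subst i (L $ i) y) $ i \<ge> 0"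
    and "\<And>i y. y \<in> closure (box L R) \<Longrightarrow> f (coord_subst i (R $ i) y) $ i \<le> 0"
    and "x0 \<in> box L R"
    and "sde_solution M T F W f g L R x0 X"
    and "\<And>N n. n < N \<Longrightarrow> \<theta> N n \<in> borel_measurable (F (real n * (T / real N)))"
    and "\<And>N n \<omega> i. n < N \<Longrightarrow> \<omega> \<in> space M \<Longrightarrow> 0 < \<theta> N n \<omega> $ i \<and> \<theta> N n \<omega> $ i < 1"
  shows "\<exists>K>0. \<forall>N\<ge>1. \<forall>n\<in>{1..N}.
    integrable M (\<lambda>\<omega>. (norm (X (real n * (T / real N)) \<omega>
        - edp f g L R x0 W (T / real N) (\<theta> N) n \<omega>))\<^sup>2) \<and>
    prob_space.expectation M (\<lambda>\<omega>. (norm (X (real n * (T / real N)) \<omega>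
        - edp f g L R x0 W (T / real N) (\<theta> N) n \<omega>))\<^sup>2)
      \<le> K * (T / real N) * exp (K * T)"
proof -
  note T = assms(2) and filt = assms(3) and sde = assms(11)
  obtain A where "box_domain L R f g A"
    by (rule box_domain_exists[OF assms(5,6,7,8,9)])
  then interpret D: box_domain L R f g A .
  interpret prob_space M by (rule assms(1))
  obtain X' where X'F: "\<And>t. t \<in> {0..T} \<Longrightarrow> X' t \<in> borel_measurable (F t)"
    and X'M: "\<And>t. X' t \<in> borel_measurable M"
    and X'b: "\<And>t \<omega>. \<omega> \<in> space M \<Longrightarrow> X' t \<omega> \<in> box L R"
    and X'c: "\<And>\<omega>. \<omega> \<in> space M \<Longrightarrow> continuous_on UNIV (\<lambda>t. X' t \<omega>)"
    and X'X: "AE \<omega> in M. \<forall>t\<in>{0..T}. X' t \<omega> = X t \<omega>"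
    by (rule sde_modification[OF filt T assms(10) sde]) (rule that, assumption+)
  note joint = borel_measurable_pair_continuous[OF X'M X'c]
  note bmc = brownian_motion_component[OF assms(1) filt assms(4)]
  interpret E: edp_setting L R f g A M T F W X' x0
  proof (intro edp_setting.intro D.box_domain_axioms prob_space_axioms edp_setting_axioms.intro)
    fix t i
    show "0 < T" "x0 \<in> box L R" by (rule T, rule assms(10))
    show "brownian_component M T F (\<lambda>t \<omega>. W t \<omega> $ i)" by (rule bmc)
    show "(\<lambda>(t, \<omega>). X' t \<omega>) \<in> borel_measurable (lborel \<Otimes>\<^sub>M M)" by (rule joint)
    show "\<omega> \<in> space M \<Longrightarrow> X' t \<omega> \<in> box L R" for \<omega> by (rule X'b)
    assume t: "t \<in> {0..T}"
    show "W t \<in> borel_measurable (F t)" using assms(4) t unfolding brownian_motion_def by blast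
    show "X' t \<in> borel_measurable (F t)" by (rule X'F[OF t])
    obtain I where ito: "has_ito_integral M F (\<lambda>u \<omega>. W u \<omega> $ i) (\<lambda>u \<omega>. diffusion_coeff g L R i (X u \<omega>)) t I"
      and I: "AE \<omega> in M. X t \<omega> $ i = x0 $ i + (LBINT s:{0..t}. f (X s \<omega>) $ i) + I \<omega>"
      using sde t unfolding sde_solution_def by blast
    show "brownian_component.ito_limit M T F (\<lambda>t \<omega>. W t \<omega> $ i)
      (\<lambda>u \<omega>. diffusion_coeff g L R i (X' u \<omega>)) t
      (\<lambda>\<omega>. X' t \<omega> $ i - x0 $ i - (LBINT s:{0..t}. f (X' s \<omega>) $ i))"
    \<comment> \<open>Integrand, drift integral and Ito integral are exchanged for those of the
      modification, which agrees with the solution at all times outside one null set.\<close>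
    proof (rule brownian_component.has_ito_integral_imp_ito_limit[OF bmc ito])
      show "t \<le> T" using t by simp
      show "AE \<omega> in M. \<forall>u\<in>{0..t}. diffusion_coeff g L R i (X' u \<omega>) = diffusion_coeff g L R i (X u \<omega>)"
        using X'X by eventually_elim (use t in auto)
      show "AE \<omega> in M. X' t \<omega> $ i - x0 $ i - (LBINT s:{0..t}. f (X' s \<omega>) $ i) = I \<omega>"
        using X'X I
      proof eventually_elim
        case (elim \<omega>)
        have "(LBINT s:{0..t}. f (X' s \<omega>) $ i) = (LBINT s:{0..t}. f (X s \<omega>) $ i)"
          by (rule set_lebesgue_integral_cong) (use elim t in auto)
        then show ?case using elim t by simp
      qed
      \<comment> \<open>The drift integral is measurable for the truncated coefficient; as the
        modification stays in the box, this is the same function on \<open>space M\<close>.\<close>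
      have "(\<lambda>\<omega>. X' t \<omega> $ i - x0 $ i - (LBINT s:{0..t}. D.cut f (X' s \<omega>) $ i)) \<in> borel_measurable M"
      proof -
        note [measurable] = X'M joint
        show ?thesis unfolding set_lebesgue_integral_def by measurable
      qed
      moreover have "X' t \<omega> $ i - x0 $ i - (LBINT s:{0..t}. D.cut f (X' s \<omega>) $ i)
        = X' t \<omega> $ i - x0 $ i - (LBINT s:{0..t}. f (X' s \<omega>) $ i)" if "\<omega> \<in> space M" for \<omega>
        using X'b[OF that] by (simp add: D.cut_eq)
      ultimately show "(\<lambda>\<omega>. X' t \<omega> $ i - x0 $ i - (LBINT s:{0..t}. f (X' s \<omega>) $ i)) \<in> borel_measurable M"
        by (simp cong: measurable_cong)
    qed
  qed
  show ?thesis
  proof (intro exI conjI allI impI ballI)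
    \<comment> \<open>The constant is built from \<open>A\<close>, \<open>T\<close> and the
      dimension before the number of steps and the weights are fixed, hence its independence of
      \<open>N\<close>.\<close>
    show "0 < E.conv_const" by (rule E.conv_const_pos)
    fix N n :: nat assume N: "1 \<le> N" and "n \<in> {1..N}"
    then have n: "n \<le> N" by simp
    note \<theta> = assms(12)[of _ N] assms(13)[of _ N]
    let ?t = "real n * (T / real N)" and ?Y = "edp f g L R x0 W (T / real N) (\<theta> N) n"
    have t: "?t \<in> {0..T}" using E.grid[OF N \<theta> n] by auto
    have Y: "?Y \<in> borel_measurable M" "\<And>\<omega>. \<omega> \<in> space M \<Longrightarrow> ?Y \<omega> \<in> box L R"
      using E.edp_measurable[OF N \<theta> n] E.edp_adapted[OF N \<theta> n] by auto
    have "X ?t \<in> borel_measurable (F ?t)" using sde t unfolding sde_solution_def by blast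
    then have XM: "X ?t \<in> borel_measurable M" by (rule E.B.measurable_F[OF t])
    \<comment> \<open>The error bound was obtained for the modification; equality almost surely at
      the grid point carries integrability and expectation over to the given solution.\<close>
    have ae: "AE \<omega> in M. (norm (X' ?t \<omega> - ?Y \<omega>))\<^sup>2 = (norm (X ?t \<omega> - ?Y \<omega>))\<^sup>2"
      using X'X by eventually_elim (use t in auto)
    have m: "(\<lambda>\<omega>. (norm (X' ?t \<omega> - ?Y \<omega>))\<^sup>2) \<in> borel_measurable M"
      "(\<lambda>\<omega>. (norm (X ?t \<omega> - ?Y \<omega>))\<^sup>2) \<in> borel_measurable M"
      using X'M[of ?t] XM Y(1) by measurable
    have "integrable M (\<lambda>\<omega>. (norm (X' ?t \<omega> - ?Y \<omega>))\<^sup>2)" by (rule E.integrable_square_diff(1)[OF Y])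
    then show "integrable M (\<lambda>\<omega>. (norm (X ?t \<omega> - ?Y \<omega>))\<^sup>2)"
      using integrable_cong_AE[OF m ae] by simp
    show "expectation (\<lambda>\<omega>. (norm (X ?t \<omega> - ?Y \<omega>))\<^sup>2) \<le> E.conv_const * (T / real N) * exp (E.conv_const * T)"
      using E.edp_error[OF N \<theta> n] integral_cong_AE[OF m ae] by simp
  qed
qed

end
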